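(* Let $G$ be a word hyperbolic group, let $X$ be a finite symmetric generating set of $G$, and let $L\subset X^*$ be the language of all geodesic words over $X$ (this is a biautomatic structure on $G$, unique up to equivalence). Let $A$ be a finitely generated abelian group on which $G$ acts with finite image in $\mathrm{Aut}(A)$. Then $H^2_L(G;A)=H^2(G;A)$, i.e. every class in $H^2(G;A)$ is represented by an $L$-regular $2$-cocycle. In particular, every virtually central extension $0\to A\to E\to G\to 1$ (inducing the given action of $G$ on $A$) has a biautomatic structure.
   Context: For a finite set $X$ with a map to a group $G$ whose image generates $G$ as a monoid (symmetric: image closed under inverses), $w\mapsto \overline w$ denotes the evaluation $X^*\to G$. A language $L\subset X^*$ is a normal form if it surjects onto $G$; a rational structure is a normal form that is a regular language. A subset $S\subset G$ is $L$-rational if $\{w\in L:\overline w\in S\}$ is a regular language. Each word $w$ gives a path $w(t)$ in the Cayley graph ($w(t)$ is the value of the length-$t$ prefix for integer $t\le \mathrm{len}(w)$, linearly interpolated, and constant $=\overline w$ afterwards). Words $u,v$ synchronously $\delta$-fellow-travel if $d(u(t),v(t))\le\delta$ for all $t$. A rational structure $L$ is a (synchronous) biautomatic structure if there is $\delta$ such that whenever $v,w\in L$, $x\in X$ and $\overline w=\overline{x}\,\overline v$ or $\overline w=\overline v\,\overline x$ (or $\overline w=\overline v$), the paths $w$ and $\overline x v$ (resp. $w$ and $v$) synchronously $\delta$-fellow-travel; a group is biautomatic if it admits such a structure. The action of $g\in G$ on $A$ is written $a\mapsto a^g$ (a right action). A $2$-cocycle is a function $\sigma:G\times G\to A$ with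 $\sigma(g,h_1h_2)=\sigma(g,h_1)^{h_2}+\sigma(gh_1,h_2)-\sigma(h_1,h_2)$; two cocycles are cohomologous if they differ by $(g,h)\mapsto f(g)^h+f(h)-f(gh)$ for some $f:G\to A$; $H^2(G;A)$ is the quotient group. A virtually central extension with a section $s:G\to E$ corresponds to the cocycle given by $s(g_1)\iota(a_1)s(g_2)\iota(a_2)=s(g_1g_2)\iota(a_1^{g_2}+a_2+\sigma(g_1,g_2))$. A cocycle $\sigma$ is weakly bounded if $\sigma(g,G)$ and $\sigma(G,g)$ are finite for every $g\in G$; it is $L$-regular if it is weakly bounded and for every $h\in G$ and $a\in A$ the set $\{g\in G:\sigma(g,h)=a\}$ is $L$-rational. $H^2_L(G;A)$ is the set of classes represented by $L$-regular cocycles. *)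

theory Defs
  imports "HOL-Algebra.Group"
begin

definition word_eval :: "('g, 'm) monoid_scheme \<Rightarrow> 'g list \<Rightarrow> 'g" where
  "word_eval G w = foldr (\<lambda>x y. x \<otimes>\<^bsub>G\<^esub> y) w \<one>\<^bsub>G\<^esub>"

definition fin_sym_gen :: "('g, 'm) monoid_scheme \<Rightarrow> 'g set \<Rightarrow> bool" where
  "fin_sym_gen G X \<longleftrightarrow> finite X \<and> X \<subseteq> carrier G
     \<and> (\<forall>x\<in>X. inv\<^bsub>G\<^esub> x \<in> X)
     \<and> (\<forall>g\<in>carrier G. \<exists>w\<in>lists X. word_eval G w = g)"

definition word_len :: "('g, 'm) monoid_scheme \<Rightarrow> 'g set \<Rightarrow> 'g \<Rightarrow> nat" where
  "word_len G X g = (LEAST n. \<exists>w\<in>lists X. length w = n \<and> word_eval G w = g)"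

definition word_dist :: "('g, 'm) monoid_scheme \<Rightarrow> 'g set \<Rightarrow> 'g \<Rightarrow> 'g \<Rightarrow> nat" where
  "word_dist G X g h = word_len G X (inv\<^bsub>G\<^esub> g \<otimes>\<^bsub>G\<^esub> h)"

(* the vertex w(t) of the path of w: value of the length-t prefix (constant after the end) *)
definition path_pt :: "('g, 'm) monoid_scheme \<Rightarrow> 'g list \<Rightarrow> nat \<Rightarrow> 'g" where
  "path_pt G w t = word_eval G (take t w)"

definition geodesics :: "('g, 'm) monoid_scheme \<Rightarrow> 'g set \<Rightarrow> 'g list set" where
  "geodesics G X = {w \<in> lists X. length w = word_len G X (word_eval G w)}"

definition regular_lang :: "'x set \<Rightarrow> 'x list set \<Rightarrow> bool" where
  "regular_lang X L \<longleftrightarrow> (\<exists>(Q::nat set) q0 (\<delta>::nat \<Rightarrow> 'x \<Rightarrow> nat) F.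
      finite Q \<and> q0 \<in> Q \<and> (\<forall>q\<in>Q. \<forall>x\<in>X. \<delta> q x \<in> Q) \<and> F \<subseteq> Q \<and>
      L = {w \<in> lists X. fold (\<lambda>x q. \<delta> q x) w q0 \<in> F})"

definition L_rational ::
  "('g, 'm) monoid_scheme \<Rightarrow> 'g set \<Rightarrow> 'g list set \<Rightarrow> 'g set \<Rightarrow> bool" where
  "L_rational G X L S \<longleftrightarrow> regular_lang X {w \<in> L. word_eval G w \<in> S}"

(* geodesic triangles in the Cayley graph w.r.t. X are delta-slim (checked at vertices);
   by translation invariance it suffices to consider triangles with one vertex at 1 *)
definition slim_triangles :: "('g, 'm) monoid_scheme \<Rightarrow> 'g set \<Rightarrow> nat \<Rightarrow> bool" where
  "slim_triangles G X \<delta> \<longleftrightarrow>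
     (\<forall>u\<in>geodesics G X. \<forall>v\<in>geodesics G X. \<forall>w\<in>geodesics G X.
        word_eval G u \<otimes>\<^bsub>G\<^esub> word_eval G v = word_eval G w \<longrightarrow>
        (\<forall>t. \<exists>s. word_dist G X (path_pt G w t) (path_pt G u s) \<le> \<delta>
               \<or> word_dist G X (path_pt G w t) (word_eval G u \<otimes>\<^bsub>G\<^esub> path_pt G v s) \<le> \<delta>))"

definition word_hyperbolic :: "('g, 'm) monoid_scheme \<Rightarrow> bool" where
  "word_hyperbolic G \<longleftrightarrow> group G \<and>
     (\<exists>X. fin_sym_gen G X \<and> (\<exists>\<delta>. slim_triangles G X \<delta>))"

definition fellow_travel ::
  "('g, 'm) monoid_scheme \<Rightarrow> 'g set \<Rightarrow> nat \<Rightarrow> 'g \<Rightarrow> 'g list \<Rightarrow> 'g list \<Rightarrow> bool" where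
  "fellow_travel G X \<delta> g u v \<longleftrightarrow>
     (\<forall>t. word_dist G X (g \<otimes>\<^bsub>G\<^esub> path_pt G u t) (path_pt G v t) \<le> \<delta>)"

definition biautomatic_structure ::
  "('g, 'm) monoid_scheme \<Rightarrow> 'g set \<Rightarrow> 'g list set \<Rightarrow> bool" where
  "biautomatic_structure G X L \<longleftrightarrow>
     fin_sym_gen G X \<and> L \<subseteq> lists X \<and> regular_lang X L \<and>
     word_eval G ` L = carrier G \<and>
     (\<exists>\<delta>. \<forall>v\<in>L. \<forall>w\<in>L.
        (word_eval G w = word_eval G v \<longrightarrow> fellow_travel G X \<delta> \<one>\<^bsub>G\<^esub> v w) \<and>
        (\<forall>x\<in>X. word_eval G w = x \<otimes>\<^bsub>G\<^esub> word_eval G v \<longrightarrow> fellow_travel G X \<delta> x v w) \<and>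
        (\<forall>x\<in>X. word_eval G w = word_eval G v \<otimes>\<^bsub>G\<^esub> x \<longrightarrow> fellow_travel G X \<delta> \<one>\<^bsub>G\<^esub> v w))"

definition biautomatic :: "('g, 'm) monoid_scheme \<Rightarrow> bool" where
  "biautomatic G \<longleftrightarrow> group G \<and> (\<exists>X L. biautomatic_structure G X L)"

inductive_set zgen :: "'a::ab_group_add set \<Rightarrow> 'a set" for S where
  zgen_zero: "0 \<in> zgen S"
| zgen_gen: "s \<in> S \<Longrightarrow> s \<in> zgen S"
| zgen_diff: "a \<in> zgen S \<Longrightarrow> b \<in> zgen S \<Longrightarrow> a - b \<in> zgen S"

definition fin_gen_ab :: "'a::ab_group_add itself \<Rightarrow> bool" where
  "fin_gen_ab _ \<longleftrightarrow> (\<exists>S::'a set. finite S \<and> zgen S = UNIV)"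

definition right_action :: "('g, 'm) monoid_scheme \<Rightarrow> ('g \<Rightarrow> 'a::ab_group_add \<Rightarrow> 'a) \<Rightarrow> bool" where
  "right_action G act \<longleftrightarrow>
     (\<forall>g\<in>carrier G. bij (act g) \<and> (\<forall>a b. act g (a + b) = act g a + act g b)) \<and>
     act \<one>\<^bsub>G\<^esub> = id \<and>
     (\<forall>g\<in>carrier G. \<forall>h\<in>carrier G. \<forall>a. act (g \<otimes>\<^bsub>G\<^esub> h) a = act h (act g a))"

definition cocycle2 ::
  "('g, 'm) monoid_scheme \<Rightarrow> ('g \<Rightarrow> 'a::ab_group_add \<Rightarrow> 'a) \<Rightarrow> ('g \<Rightarrow> 'g \<Rightarrow> 'a) \<Rightarrow> bool" where
  "cocycle2 G act \<sigma> \<longleftrightarrow>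
     (\<forall>g\<in>carrier G. \<forall>h1\<in>carrier G. \<forall>h2\<in>carrier G.
        \<sigma> g (h1 \<otimes>\<^bsub>G\<^esub> h2) = act h2 (\<sigma> g h1) + \<sigma> (g \<otimes>\<^bsub>G\<^esub> h1) h2 - \<sigma> h1 h2)"

definition cohomologous ::
  "('g, 'm) monoid_scheme \<Rightarrow> ('g \<Rightarrow> 'a::ab_group_add \<Rightarrow> 'a) \<Rightarrow> ('g \<Rightarrow> 'g \<Rightarrow> 'a) \<Rightarrow> ('g \<Rightarrow> 'g \<Rightarrow> 'a) \<Rightarrow> bool" where
  "cohomologous G act \<sigma> \<tau> \<longleftrightarrow>
     (\<exists>f. \<forall>g\<in>carrier G. \<forall>h\<in>carrier G.
        \<sigma> g h - \<tau> g h = act h (f g) + f h - f (g \<otimes>\<^bsub>G\<^esub> h))"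

definition weakly_bounded :: "('g, 'm) monoid_scheme \<Rightarrow> ('g \<Rightarrow> 'g \<Rightarrow> 'a) \<Rightarrow> bool" where
  "weakly_bounded G \<sigma> \<longleftrightarrow>
     (\<forall>g\<in>carrier G. finite (\<sigma> g ` carrier G) \<and> finite ((\<lambda>h. \<sigma> h g) ` carrier G))"

definition L_regular_cocycle ::
  "('g, 'm) monoid_scheme \<Rightarrow> 'g set \<Rightarrow> 'g list set \<Rightarrow> ('g \<Rightarrow> 'g \<Rightarrow> 'a) \<Rightarrow> bool" where
  "L_regular_cocycle G X L \<sigma> \<longleftrightarrow> weakly_bounded G \<sigma> \<and>
     (\<forall>h\<in>carrier G. \<forall>a. L_rational G X L {g \<in> carrier G. \<sigma> g h = a})"

definition extension_inducing ::
  "('e, 'n) monoid_scheme \<Rightarrow> ('g, 'm) monoid_scheme \<Rightarrow> ('g \<Rightarrow> 'a::ab_group_add \<Rightarrow> 'a)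
     \<Rightarrow> ('a \<Rightarrow> 'e) \<Rightarrow> ('e \<Rightarrow> 'g) \<Rightarrow> bool" where
  "extension_inducing E G act \<iota> \<pi> \<longleftrightarrow> group E \<and>
     inj \<iota> \<and> range \<iota> \<subseteq> carrier E \<and> (\<forall>a b. \<iota> (a + b) = \<iota> a \<otimes>\<^bsub>E\<^esub> \<iota> b) \<and>
     \<pi> \<in> hom E G \<and> \<pi> ` carrier E = carrier G \<and>
     range \<iota> = {e \<in> carrier E. \<pi> e = \<one>\<^bsub>G\<^esub>} \<and>
     (\<forall>e\<in>carrier E. \<forall>a. inv\<^bsub>E\<^esub> e \<otimes>\<^bsub>E\<^esub> \<iota> a \<otimes>\<^bsub>E\<^esub> e = \<iota> (act (\<pi> e) a))"

end

theory Submission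
  imports Defs Complex_Main
begin

text \<open>
  Choose words over X as coordinates on an extension E of G by A. For a homomorphism l from A to the
  integers and an element e of E let Phi l e be the minimum of l a + K |w| over all words w and all a
  such that e is the lift of w times a. By Dehn's algorithm the minimum exists for K large, and the minimising
  words are quasi-geodesics. Phi is equivariant along fibres and changes by a bounded amount under
  translations, so a section s that keeps an averaged A-valued combination Psi of the Phi l in a finite set
  has a weakly bounded cocycle. As minimising words pass near the geodesic prefixes, the values
  of s beyond g relative to s g are determined by finitely many bounded data near g (Cannon's cone type argument),
  whence regularity by Myhill and Nerode.

  For the biautomatic structure, A needs a regular normal form which is invariant under the finite image of G in Aut(A)
  and fellow-travels synchronously. It comes from an invariant simplicial fan, the barycentric
  subdivision of an invariant polytope; nonnegative combinations in a common simplex are unique, and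
  Dickson's lemma turns uniqueness into bounded distance of coefficients.
\<close>

section \<open>Discrete hyperbolic geometry\<close>

text \<open>The action need not permute a basis of A and A may have torsion, so there are no
  equivariant coordinates on A. The whole orbit \<open>Lam\<close> of coordinate functionals is used
  instead. It is redundant, and since \<open>Phi l\<close> is not additive in l, shifting along a
  fibre cannot be expected to bound all the numbers \<open>Phi l\<close> at once. The operator
  \<open>psi\<close> turns the family into a single element of A, equivariantly, at the price of
  multiplication by \<open>mm\<close>. As this multiplication has finite kernel and cokernel,
  confining \<open>Psi\<close> to a finite set fixes a point of a fibre up to finitely many choices.

  Choosing freely among them in every fibre would give a weakly bounded cocycle, but nothing that an
  automaton could follow. Therefore s is defined by recursion along geodesics, and both choices in a
  step, the last letter and the correction in A, depend only on data that finitely many types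
  determine.

  The fan answers the same lack of an invariant basis: multiplication in E passes elements of A
  through the action, so the normal form of A has to be respected by H, and every path in it has to
  keep time with its neighbours.\<close>

locale geodesic_space =
  fixes P :: "'p set" and d :: "'p \<Rightarrow> 'p \<Rightarrow> nat"
  assumes d_refl: "a \<in> P \<Longrightarrow> d a a = 0"
    and d_eq: "a \<in> P \<Longrightarrow> b \<in> P \<Longrightarrow> d a b = 0 \<Longrightarrow> a = b"
    and d_sym: "a \<in> P \<Longrightarrow> b \<in> P \<Longrightarrow> d a b = d b a"
    and d_tri: "a \<in> P \<Longrightarrow> b \<in> P \<Longrightarrow> c \<in> P \<Longrightarrow> d a c \<le> d a b + d b c"
    and d_mid: "a \<in> P \<Longrightarrow> b \<in> P \<Longrightarrow> t \<le> d a b \<Longrightarrow> \<exists>q\<in>P. d a q = t \<and> d q b = d a b - t"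
begin

text \<open>The union of all geodesics from a to b: by \<open>d_mid\<close> each of its points lies
  on one. Intervals spare the choice of paths, and \<open>slim\<close> then speaks of all geodesic
  triangles at once.\<close>

definition ival :: "'p \<Rightarrow> 'p \<Rightarrow> 'p set" where
  "ival a b = {q \<in> P. d a q + d q b = d a b}"

definition slim :: "nat \<Rightarrow> bool" where
  "slim \<delta> \<longleftrightarrow> (\<forall>a\<in>P. \<forall>b\<in>P. \<forall>c\<in>P. \<forall>q\<in>ival a b. \<exists>q'\<in>ival a c \<union> ival c b. d q q' \<le> \<delta>)"

lemma ivalD: "q \<in> ival a b \<Longrightarrow> q \<in> P" "q \<in> ival a b \<Longrightarrow> d a q + d q b = d a b"
  by (auto simp: ival_def)

lemma ival_sym: "a \<in> P \<Longrightarrow> b \<in> P \<Longrightarrow> ival a b = ival b a"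
  using d_sym by (auto simp: ival_def)

lemma ival_ends: "a \<in> P \<Longrightarrow> b \<in> P \<Longrightarrow> a \<in> ival a b" "a \<in> P \<Longrightarrow> b \<in> P \<Longrightarrow> b \<in> ival a b"
  by (auto simp: ival_def d_refl)

lemma ival_left:
  assumes "a \<in> P" "b \<in> P" "q \<in> ival a b" "y \<in> ival a q"
  shows "y \<in> ival a b" "q \<in> ival y b"
proof -
  have P: "q \<in> P" "y \<in> P" using assms ivalD by blast+
  have e: "d a q + d q b = d a b" "d a y + d y q = d a q" using assms ivalD by blast+
  have "d a b \<le> d a y + d y b" "d y b \<le> d y q + d q b" using d_tri P assms by auto
  with e show "y \<in> ival a b" "q \<in> ival y b" using P by (auto simp: ival_def)
qed

lemma ival_right:
  assumes "a \<in> P" "b \<in> P" "q \<in> ival a b" "z \<in> ival q b"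
  shows "z \<in> ival a b" "q \<in> ival a z"
  using ival_left[of b a q z] assms ival_sym ivalD(1) by metis+

lemma ival_both:
  assumes "a \<in> P" "b \<in> P" "q \<in> ival a b" "y \<in> ival a q" "z \<in> ival q b"
  shows "q \<in> ival y z"
  using ival_left[OF assms(1,2,3,4)] ival_right[of y b q z] assms ivalD(1) by metis

lemma slimD:
  assumes "slim \<delta>" "a \<in> P" "b \<in> P" "c \<in> P" "q \<in> ival a b"
  obtains q' where "q' \<in> ival a c \<or> q' \<in> ival c b" "d q q' \<le> \<delta>" "q' \<in> P"
  using assms ivalD(1) unfolding slim_def by (metis UnE)

lemma slim_quad:
  assumes "slim \<delta>" "a \<in> P" "b \<in> P" "c \<in> P" "e \<in> P" "q \<in> ival a b"
  obtains q' where "q' \<in> ival a c \<or> q' \<in> ival c e \<or> q' \<in> ival e b" "d q q' \<le> 2 * \<delta>" "q' \<in> P"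
proof -
  obtain q1 where q1: "q1 \<in> ival a c \<or> q1 \<in> ival c b" "d q q1 \<le> \<delta>" "q1 \<in> P"
    using slimD[of \<delta> a b c q] assms by metis
  show thesis
  proof (cases "q1 \<in> ival a c")
    case True then show ?thesis using q1 that[of q1] by auto
  next
    case False
    then have "q1 \<in> ival c b" using q1 by auto
    then obtain q2 where q2: "q2 \<in> ival c e \<or> q2 \<in> ival e b" "d q1 q2 \<le> \<delta>" "q2 \<in> P"
      using slimD[of \<delta> c b e q1] assms by metis
    have "q \<in> P" using assms ivalD by auto
    then have "d q q2 \<le> d q q1 + d q1 q2" using d_tri q1 q2 by auto
    then show ?thesis using that[of q2] q1 q2 by auto
  qed
qed

text \<open>A bigon is a degenerate triangle with third vertex y. The point near x on one of the two
  halves is pinned down by its distance from a or from b, which leaves only the difference of the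
  heights of x and y over a.\<close>

lemma ival_thin:
  assumes "slim \<delta>" "a \<in> P" "b \<in> P" "x \<in> ival a b" "y \<in> ival a b"
  shows "d x y \<le> 2 * \<delta> + (if d a x \<le> d a y then d a y - d a x else d a x - d a y)"
proof -
  have *: "d x y \<le> 2 * \<delta> + (d a x - d a y)"
    if h: "x \<in> ival a b" "y \<in> ival a b" "d a x \<ge> d a y" for x y
  proof -
    have P: "x \<in> P" "y \<in> P" using that(1,2) ivalD by auto
    obtain q where q: "q \<in> ival a y \<or> q \<in> ival y b" "d x q \<le> \<delta>" "q \<in> P"
      using slimD[OF assms(1-3) P(2) h(1)] by metis
    have e: "d a x + d x b = d a b" "d a y + d y b = d a b" using that ivalD by auto
    have tri: "d x y \<le> d x q + d q y" "d a x \<le> d a q + d q x" "d q b \<le> d q x + d x b" "d x b \<le> d x q + d q b"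
      using d_tri P q assms by auto
    have s: "d q x = d x q" "d q y = d y q" using d_sym P q by auto
    show ?thesis using q(1)
    proof
      assume "q \<in> ival a y"
      then have "d a q + d q y = d a y" using ivalD by auto
      then show ?thesis using tri s q e that by auto
    next
      assume "q \<in> ival y b"
      then have "d y q + d q b = d y b" using ivalD by auto
      then show ?thesis using tri s q e that by auto
    qed
  qed
  have P: "x \<in> P" "y \<in> P" using assms ivalD by auto
  show ?thesis using *[of x y] *[of y x] assms d_sym[OF P] by (cases "d a x \<le> d a y") auto
qed

text \<open>Here t is time: a point runs along its geodesic and then rests at the end. The
  quadrilateral puts x within \<open>2 * \<delta> + M\<close> of a point of the second geodesic, the
  times of that point and of y differ by at most \<open>2 * \<delta> + 4 * M\<close>, and
  \<open>ival_thin\<close> turns nearly equal times into proximity.\<close>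

lemma fellow:
  assumes "slim \<delta>" "p \<in> P" "q \<in> P" "p' \<in> P" "q' \<in> P"
    and "d p p' \<le> M" "d q q' \<le> M" and x: "x \<in> ival p q" and y: "y \<in> ival p' q'"
    and t: "d p x = t \<or> (t \<ge> d p q \<and> x = q)" "d p' y = t \<or> (t \<ge> d p' q' \<and> y = q')"
  shows "d x y \<le> 8 * \<delta> + 6 * M"
proof -
  have P: "x \<in> P" "y \<in> P" using x y ivalD by auto
  obtain z where z: "z \<in> ival p p' \<or> z \<in> ival p' q' \<or> z \<in> ival q' q" "d x z \<le> 2 * \<delta>" "z \<in> P"
    using slim_quad[of \<delta> p q p' q' x] assms by metis
  have "\<exists>x'\<in>ival p' q'. d x x' \<le> 2 * \<delta> + M"
    using z(1)
  proof (elim disjE)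
    assume "z \<in> ival p p'"
    then have "d p z + d z p' = d p p'" using ivalD by auto
    then have "d x p' \<le> 2 * \<delta> + M" using d_tri[of x z p'] z P assms by auto
    then show ?thesis using ival_ends assms by auto
  next
    assume "z \<in> ival q' q"
    then have "d q' z + d z q = d q' q" using ivalD by auto
    then have "d x q' \<le> 2 * \<delta> + M" using d_tri[of x z q'] d_sym[of q' z] d_sym[of q q'] z P assms by auto
    then show ?thesis using ival_ends assms by auto
  next
    assume "z \<in> ival p' q'" then show ?thesis using z(2) by (intro bexI[of _ z]) auto
  qed
  then obtain x' where x': "x' \<in> ival p' q'" "d x x' \<le> 2 * \<delta> + M" by auto
  have x'P: "x' \<in> P" using x' ivalD by auto
  have e: "d p x + d x q = d p q" "d p' y + d y q' = d p' q'" "d p' x' + d x' q' = d p' q'"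
    using x y x' ivalD by auto
  have tri: "d p' x' \<le> d p' p + d p x'" "d p x' \<le> d p x + d x x'" "d p x \<le> d p p' + d p' x"
    "d p' x \<le> d p' x' + d x' x" "d x y \<le> d x x' + d x' y"
    "d p' q' \<le> d p' p + d p q'" "d p q' \<le> d p q + d q q'" "d p q \<le> d p p' + d p' q" "d p' q \<le> d p' q' + d q' q"
    using d_tri assms P x'P by auto
  have s: "d p' p = d p p'" "d x' x = d x x'" "d q' q = d q q'" using d_sym assms P x'P by auto
  have thin: "d x' y \<le> 2 * \<delta> + (if d p' x' \<le> d p' y then d p' y - d p' x' else d p' x' - d p' y)"
    using ival_thin[of \<delta> p' q' x' y] assms x' by auto
  have dq: "d q q = 0" "d q' q' = 0" using d_refl assms by auto
  have "d p' x' \<le> d p' y + (2 * \<delta> + 4 * M) \<and> d p' y \<le> d p' x' + (2 * \<delta> + 4 * M)"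
    using t e tri s x'(2) assms(6,7) dq by auto
  then have "d x' y \<le> 4 * \<delta> + 4 * M" using thin by (auto split: if_splits)
  then show ?thesis using tri x'(2) by auto
qed

text \<open>Bisection of the path: each halving replaces q by a point on a geodesic over one half,
  at the cost of one \<open>\<delta>\<close>. After n halvings at most one step of length J is
  left.\<close>

lemma log_lemma:
  assumes "slim \<delta>"
  shows "m \<le> 2 ^ n \<Longrightarrow> (\<And>i. i \<le> m \<Longrightarrow> c (k + i) \<in> P) \<Longrightarrow> (\<And>i. i < m \<Longrightarrow> d (c (k + i)) (c (Suc (k + i))) \<le> J)
    \<Longrightarrow> q \<in> ival (c k) (c (k + m)) \<Longrightarrow> \<exists>i\<le>m. d q (c (k + i)) \<le> \<delta> * n + J"
proof (induction n arbitrary: m k q)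
  case 0
  then have qP: "q \<in> P" and c: "c k \<in> P" using ivalD 0(2)[of 0] by auto
  have "d (c k) (c (k + m)) \<le> J"
  proof (cases "m = 0")
    case True then show ?thesis using d_refl c by auto
  next
    case False then have "m = 1" using 0 by auto
    then show ?thesis using 0(3)[of 0] by auto
  qed
  moreover have "d (c k) q + d q (c (k + m)) = d (c k) (c (k + m))" using 0 ivalD by auto
  ultimately have "d (c k) q \<le> J" by auto
  then show ?case using d_sym qP c by (intro exI[of _ 0]) auto
next
  case (Suc n)
  let ?h = "m div 2"
  have P: "c k \<in> P" "c (k + m) \<in> P" "c (k + ?h) \<in> P" using Suc.prems(2)[of 0] Suc.prems(2)[of m] Suc.prems(2)[of ?h] by auto
  obtain q' where q': "q' \<in> ival (c k) (c (k + ?h)) \<or> q' \<in> ival (c (k + ?h)) (c (k + m))" "d q q' \<le> \<delta>" "q' \<in> P"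
    using slimD[OF assms P(1,2,3) Suc.prems(4)] by metis
  have "\<exists>i\<le>m. d q' (c (k + i)) \<le> \<delta> * n + J"
    using q'(1)
  proof
    assume "q' \<in> ival (c k) (c (k + ?h))"
    moreover have "?h \<le> 2 ^ n" using Suc.prems(1) by auto
    ultimately have "\<exists>i\<le>?h. d q' (c (k + i)) \<le> \<delta> * n + J"
      using Suc.IH[of ?h k q'] Suc.prems by auto
    then show ?thesis by (metis div_le_dividend le_trans)
  next
    assume a: "q' \<in> ival (c (k + ?h)) (c (k + m))"
    have "m - ?h \<le> 2 ^ n" using Suc.prems(1) by (auto)
    moreover have "k + ?h + (m - ?h) = k + m" by auto
    moreover have "c (k + ?h + i) \<in> P" if "i \<le> m - ?h" for i
      using Suc.prems(2)[of "?h + i"] that by (auto simp: add.assoc)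
    moreover have "d (c (k + ?h + i)) (c (Suc (k + ?h + i))) \<le> J" if "i < m - ?h" for i
      using Suc.prems(3)[of "?h + i"] that by (auto simp: add.assoc)
    ultimately have "\<exists>i\<le>m - ?h. d q' (c (k + ?h + i)) \<le> \<delta> * n + J"
      using Suc.IH[of "m - ?h" "k + ?h" q'] a by auto
    then obtain i where i: "i \<le> m - ?h" "d q' (c (k + ?h + i)) \<le> \<delta> * n + J" by auto
    have "?h + i \<le> m" using i by auto
    then show ?thesis using i by (intro exI[of _ "?h + i"]) (auto simp: add.assoc)
  qed
  then obtain i where i: "i \<le> m" "d q' (c (k + i)) \<le> \<delta> * n + J" by auto
  have "q \<in> P" using Suc.prems ivalD by auto
  then have "d q (c (k + i)) \<le> d q q' + d q' (c (k + i))" using d_tri q' Suc.prems(2)[OF i(1)] by auto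
  then show ?case using q' i by (intro exI[of _ i]) auto
qed

text \<open>Only the bound against shortcuts compares distant points; the opposite estimate follows
  from the step length J (\<open>quasi_d\<close>).\<close>

definition quasi :: "nat \<Rightarrow> nat \<Rightarrow> (nat \<Rightarrow> 'p) \<Rightarrow> nat \<Rightarrow> bool" where
  "quasi J L c m \<longleftrightarrow> (\<forall>i\<le>m. c i \<in> P) \<and> (\<forall>i<m. d (c i) (c (Suc i)) \<le> J)
     \<and> (\<forall>i\<le>m. \<forall>j\<le>m. i \<le> j \<longrightarrow> j - i \<le> L * d (c i) (c j) + L)"

lemma exp_beats_linear: "\<exists>n0::nat. \<forall>n\<ge>n0. a * n + b < 2 ^ n"
proof -
  have sq: "n * n < 2 ^ n" if "n \<ge> 5" for n :: nat
    using that
  proof (induction n rule: nat_induct_at_least)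
    case (Suc n)
    have "Suc n * Suc n = n * n + 2 * n + 1" by auto
    moreover have "2 * n + 1 \<le> n * n"
      using Suc(1) mult_le_mono1[of 5 n n] by linarith
    ultimately show ?case using Suc by auto
  qed auto
  show ?thesis
  proof (intro exI allI impI)
    fix n assume n: "a + b + 5 \<le> n"
    have "a * n + b \<le> a * n + b * n" using n by (cases n) auto
    also have "\<dots> = (a + b) * n" by (simp add: algebra_simps)
    also have "\<dots> \<le> n * n" using n by (intro mult_le_mono1) auto
    also have "\<dots> < 2 ^ n" using sq n by auto
    finally show "a * n + b < 2 ^ n" .
  qed
qed

text \<open>A quantity bounded by a logarithm of itself is bounded. For the least n with
  \<open>a * D + b \<le> 2 ^ n\<close> the preceding power of two is below a linear function of n,
  so n stays below the point where powers overtake it.\<close>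

lemma log_bound: "\<exists>D0. \<forall>D. (\<forall>n. a * D + b \<le> 2 ^ n \<longrightarrow> D \<le> \<delta> * n + J) \<longrightarrow> (D::nat) \<le> D0"
proof -
  obtain n0 where n0: "\<forall>n\<ge>n0. (a * \<delta>) * n + (a * \<delta> + a * J + b) < 2 ^ n" using exp_beats_linear by blast
  show ?thesis
  proof (intro exI allI impI)
    fix D assume h: "\<forall>n. a * D + b \<le> 2 ^ n \<longrightarrow> D \<le> \<delta> * n + J"
    let ?Q = "\<lambda>n. a * D + b \<le> 2 ^ n"
    obtain n where n: "?Q n" using exp_beats_linear[of 0 "a * D + b"] by (auto intro: less_imp_le)
    define k where "k = (LEAST n. ?Q n)"
    have k: "?Q k" unfolding k_def using n by (rule LeastI)
    have "k \<le> n0"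
    proof (rule ccontr)
      assume "\<not> k \<le> n0"
      then obtain k' where k': "k = Suc k'" "k' \<ge> n0" by (cases k) auto
      have "\<not> ?Q k'" using not_less_Least[of k' ?Q] k' k_def by auto
      then have "2 ^ k' < a * D + b" by auto
      also have "D \<le> \<delta> * Suc k' + J" using h k k' by blast
      then have "a * D + b \<le> a * (\<delta> * Suc k' + J) + b" by (intro add_right_mono mult_le_mono2)
      finally have "2 ^ k' < a * (\<delta> * Suc k' + J) + b" .
      moreover have "(a * \<delta>) * k' + (a * \<delta> + a * J + b) < 2 ^ k'" using n0 k' by auto
      ultimately show False by (simp add: algebra_simps)
    qed
    then have "D \<le> \<delta> * n0 + J" using h k by (meson add_le_mono1 le_trans mult_le_mono2)
    then show "D \<le> \<delta> * n0 + J" .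
  qed
qed

lemma quasi_d: "quasi J L c m \<Longrightarrow> i + k \<le> m \<Longrightarrow> d (c i) (c (i + k)) \<le> J * k"
proof (induction k)
  case 0
  then show ?case by (auto simp: quasi_def d_refl)
next
  case (Suc k)
  have "d (c (i + k)) (c (Suc (i + k))) \<le> J" "c i \<in> P" "c (i + k) \<in> P" "c (Suc (i + k)) \<in> P"
    using Suc.prems by (auto simp: quasi_def)
  then show ?case using d_tri[of "c i" "c (i + k)" "c (Suc (i + k))"] Suc by auto
qed

lemma quasi_P: "quasi J L c m \<Longrightarrow> i \<le> m \<Longrightarrow> c i \<in> P"
  by (auto simp: quasi_def)

text \<open>Take the point q0 of the interval that is farthest from the path, at distance D. From
  points about 2D before and after q0 one reaches the path within D; the two path points are at most
  6D apart, so the quasi-geodesic between them has length linear in D. By \<open>log_lemma\<close>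
  it comes within a logarithm of D of q0, and \<open>log_bound\<close> applies.\<close>

lemma morse1:
  assumes sl: "slim \<delta>"
  shows "\<exists>D. \<forall>c m q. quasi J L c m \<longrightarrow> q \<in> ival (c 0) (c m) \<longrightarrow> (\<exists>i\<le>m. d q (c i) \<le> D)"
proof -
  obtain D0 where D0: "\<And>D. (\<forall>n. (6 * L) * D + L \<le> 2 ^ n \<longrightarrow> D \<le> \<delta> * n + (J + 2 * \<delta>)) \<Longrightarrow> D \<le> D0"
    using log_bound[of "6 * L" L \<delta> "J + 2 * \<delta>"] by blast
  have main: "\<exists>i\<le>m. d q (c i) \<le> D0" if qs: "quasi J L c m" and q: "q \<in> ival (c 0) (c m)" for c m q
  proof -
    have cP: "\<And>i. i \<le> m \<Longrightarrow> c i \<in> P" using qs quasi_P by blast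
    define f where "f q = Min ((\<lambda>i. d q (c i)) ` {..m})" for q
    have f_le: "f q \<le> d q (c i)" if "i \<le> m" for q i unfolding f_def using that by auto
    have f_at: "\<exists>i\<le>m. d q (c i) = f q" for q
    proof -
      have "f q \<in> (\<lambda>i. d q (c i)) ` {..m}" unfolding f_def by (intro Min_in) auto
      then show ?thesis by auto
    qed
    have bd: "\<forall>q. q \<in> ival (c 0) (c m) \<longrightarrow> f q < Suc (d (c 0) (c m))"
    proof (intro allI impI)
      fix q assume q: "q \<in> ival (c 0) (c m)"
      have "f q \<le> d q (c 0)" using f_le[of 0 q] by auto
      then show "f q < Suc (d (c 0) (c m))" using ivalD[OF q] d_sym[of q "c 0"] cP[of 0] by auto
    qed
    obtain q0 where q0: "q0 \<in> ival (c 0) (c m)" "\<And>q. q \<in> ival (c 0) (c m) \<Longrightarrow> f q \<le> f q0"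
      using ex_has_greatest_nat[OF q bd] by blast
    define D where "D = f q0"
    have q0P: "q0 \<in> P" using q0 ivalD by auto
    have far: "D \<le> d q0 (c i)" if "i \<le> m" for i using f_le that D_def by auto
    have P0: "c 0 \<in> P" "c m \<in> P" using cP by auto
    \<comment> \<open>The distance 2D leaves room: a jump of length at most D from y to the path
      stays at least D away from q0. If the end e is not farther than 2D, it lies on the path itself
      and no jump is made.\<close>
    have pick: "\<exists>y i. y \<in> ival e q0 \<and> i \<le> m \<and> d y (c i) \<le> D \<and> d y q0 \<le> 2 * D \<and> y \<in> P
        \<and> (y = c i \<or> d y q0 = 2 * D)" if e: "e = c 0 \<or> e = c m" for e
    proof -
      have eP: "e \<in> P" using e P0 by auto
      have sub: "ival e q0 \<subseteq> ival (c 0) (c m)"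
        using e ival_left[OF P0 q0(1)] ival_right[OF P0 q0(1)] ival_sym[OF P0(2) q0P] by auto
      show ?thesis
      proof (cases "d e q0 \<le> 2 * D")
        case True
        then show ?thesis using e ival_ends eP q0P d_refl
          by (intro exI[of _ e] exI[of _ "if e = c 0 then 0 else m"]) auto
      next
        case False
        obtain y where y: "y \<in> P" "d e y = d e q0 - 2 * D" "d y q0 = d e q0 - (d e q0 - 2 * D)"
          using d_mid[OF eP q0P, of "d e q0 - 2 * D"] by auto
        have yi: "y \<in> ival e q0" using y False by (auto simp: ival_def)
        obtain i where i: "i \<le> m" "d y (c i) = f y" using f_at by blast
        have "f y \<le> D" using q0(2) sub yi D_def by blast
        then show ?thesis using y yi i False by (intro exI[of _ y] exI[of _ i]) auto
      qed
    qed
    obtain y i where y: "y \<in> ival (c 0) q0" "i \<le> m" "d y (c i) \<le> D" "d y q0 \<le> 2 * D" "y \<in> P"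
        "y = c i \<or> d y q0 = 2 * D" using pick[of "c 0"] by auto
    obtain z j where z: "z \<in> ival (c m) q0" "j \<le> m" "d z (c j) \<le> D" "d z q0 \<le> 2 * D" "z \<in> P"
        "z = c j \<or> d z q0 = 2 * D" using pick[of "c m"] by auto
    have z': "z \<in> ival q0 (c m)" using z ival_sym q0P P0 by auto
    have q0yz: "q0 \<in> ival y z" using ival_both[OF P0 q0(1) y(1) z'] .
    obtain q' where q': "q' \<in> ival y (c i) \<or> q' \<in> ival (c i) (c j) \<or> q' \<in> ival (c j) z"
        "d q0 q' \<le> 2 * \<delta>" "q' \<in> P"
      using slim_quad[OF sl y(5) z(5) cP[OF y(2)] cP[OF z(2)] q0yz] by metis
    \<comment> \<open>A point q' on one of the two jumps is within \<open>2 * \<delta>\<close> of q0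
      and at distance at least D from it.\<close>
    have side: "D \<le> 2 * \<delta>" if "q' \<in> ival u (c k)" "k \<le> m" "d u (c k) \<le> D" "u \<in> P" "u = c k \<or> d u q0 = 2 * D" for u k
    proof -
      have e: "d u q' + d q' (c k) = d u (c k)" using that ivalD by auto
      show ?thesis using that(5)
      proof
        assume "u = c k"
        then have "q' = c k" using e d_refl d_eq[of u q'] q'(3) that by auto
        then show ?thesis using far that q' by fastforce
      next
        assume "d u q0 = 2 * D"
        moreover have "d u q0 \<le> d u q' + d q' q0" using d_tri that q' q0P by auto
        moreover have "d q' q0 = d q0 q'" using d_sym q' q0P by auto
        ultimately show ?thesis using e that q' by auto
      qed
    qed
    have bound: "D \<le> \<delta> * n + (J + 2 * \<delta>)" if n: "(6 * L) * D + L \<le> 2 ^ n" for n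
    proof -
      have mid: "D \<le> \<delta> * n + (J + 2 * \<delta>)"
        if k: "q' \<in> ival (c k) (c l)" "k \<le> l" "l \<le> m" "d (c k) (c l) \<le> 6 * D" for k l
      proof -
        have "l - k \<le> L * d (c k) (c l) + L" using qs k by (auto simp: quasi_def)
        also have "\<dots> \<le> 2 ^ n" using order_trans[OF add_right_mono[OF mult_le_mono2[OF k(4), of L]], of L] n by (simp add: ac_simps)
        finally have ln: "l - k \<le> 2 ^ n" .
        have "\<exists>i\<le>l - k. d q' (c (k + i)) \<le> \<delta> * n + J"
          using log_lemma[OF sl ln, of c k J q'] k qs by (auto simp: quasi_def)
        then obtain i where i: "i \<le> l - k" "d q' (c (k + i)) \<le> \<delta> * n + J" by auto
        have "d q0 (c (k + i)) \<le> d q0 q' + d q' (c (k + i))" using d_tri q0P q' cP i k by auto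
        moreover have "D \<le> d q0 (c (k + i))" using far i k by auto
        ultimately show ?thesis using i q' by auto
      qed
      have cd: "d (c i) (c j) \<le> 6 * D"
      proof -
        have "d (c i) (c j) \<le> d (c i) y + d y (c j)" "d y (c j) \<le> d y z + d z (c j)" "d y z \<le> d y q0 + d q0 z"
          using d_tri y z cP q0P by auto
        moreover have "d (c i) y = d y (c i)" "d q0 z = d z q0" using d_sym y z cP q0P by auto
        ultimately show ?thesis using y z by auto
      qed
      have sym: "ival (c i) (c j) = ival (c j) (c i)" "d (c i) (c j) = d (c j) (c i)"
          "ival (c j) z = ival z (c j)" using ival_sym d_sym cP y z by auto
      show ?thesis using q'(1)
      proof (elim disjE)
        assume "q' \<in> ival y (c i)" then show ?thesis using side[of y i] y by auto
      next
        assume "q' \<in> ival (c j) z" then show ?thesis using side[of z j] z sym by auto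
      next
        assume "q' \<in> ival (c i) (c j)"
        then show ?thesis using mid[of i j] mid[of j i] y(2) z(2) cd sym by (cases "i \<le> j") auto
      qed
    qed
    then have "D \<le> D0" using D0 by blast
    moreover have "f q \<le> D" using q0(2)[OF q] D_def by simp
    ultimately show ?thesis using f_at[of q] by (metis le_trans)
  qed
  then show ?thesis by blast
qed

text \<open>Connectedness of the geodesic: walk along it as long as the path up to time k comes
  within D. The next point can only be within D of a later part, so two path points on either side
  of \<open>c k\<close> are at most 2D + 1 apart, and the shortcut bound keeps the time k close to
  that of the first one.\<close>

lemma morse2:
  assumes sl: "slim \<delta>"
  shows "\<exists>D. \<forall>c m k. quasi J L c m \<longrightarrow> k \<le> m \<longrightarrow> (\<exists>q\<in>ival (c 0) (c m). d (c k) q \<le> D)"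
proof -
  obtain D where D: "\<And>c m q. quasi J L c m \<Longrightarrow> q \<in> ival (c 0) (c m) \<Longrightarrow> \<exists>i\<le>m. d q (c i) \<le> D"
    using morse1[OF sl] by metis
  define D2 where "D2 = J * (L * (2 * D + 1) + L) + D"
  have main: "\<exists>q\<in>ival (c 0) (c m). d (c k) q \<le> D2" if qs: "quasi J L c m" and k: "k \<le> m" for c m k
  proof -
    have cP: "\<And>i. i \<le> m \<Longrightarrow> c i \<in> P" using qs quasi_P by blast
    have P0: "c 0 \<in> P" "c m \<in> P" using cP by auto
    let ?R = "\<lambda>t. \<exists>q\<in>ival (c 0) (c m). d (c 0) q = t \<and> (\<exists>i\<le>k. d q (c i) \<le> D)"
    have "?R 0" using P0 ival_ends d_refl by (intro bexI[of _ "c 0"]) auto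
    moreover have bd: "\<forall>t. ?R t \<longrightarrow> t < Suc (d (c 0) (c m))"
      using ivalD(2) by fastforce
    ultimately obtain t where t: "?R t" "\<And>t'. ?R t' \<Longrightarrow> t' \<le> t"
      using ex_has_greatest_nat[of ?R 0 "\<lambda>t. t"] by blast
    then obtain q i where q: "q \<in> ival (c 0) (c m)" "d (c 0) q = t" "i \<le> k" "d q (c i) \<le> D" by auto
    have qP: "q \<in> P" using q ivalD by auto
    have "\<exists>i'\<le>m. k \<le> i' \<and> d q (c i') \<le> D + 1"
    proof (cases "d q (c m) = 0")
      case True
      then show ?thesis using k by (intro exI[of _ m]) auto
    next
      case False
      obtain q' where q': "q' \<in> P" "d q q' = 1" "d q' (c m) = d q (c m) - 1"
        using d_mid[OF qP P0(2), of 1] False by auto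
      have qi: "q' \<in> ival q (c m)" using q' False by (auto simp: ival_def)
      have r: "q' \<in> ival (c 0) (c m)" "q \<in> ival (c 0) q'" using ival_right[OF P0 q(1) qi] by auto
      then have "d (c 0) q' = Suc t" using q q' ivalD(2)[OF r(2)] by auto
      then have nk: "\<not> (\<exists>i\<le>k. d q' (c i) \<le> D)" using t(2)[of "Suc t"] r(1) by fastforce
      obtain i' where i': "i' \<le> m" "d q' (c i') \<le> D" using D[OF qs r(1)] by auto
      moreover have "d q (c i') \<le> d q q' + d q' (c i')" using d_tri[OF qP q'(1) cP[OF i'(1)]] .
      moreover have "k \<le> i'" using nk i' by (meson nat_le_linear)
      ultimately show ?thesis using q' by (intro exI[of _ i']) auto
    qed
    then obtain i' where i': "i' \<le> m" "k \<le> i'" "d q (c i') \<le> D + 1" by auto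
    have im: "i \<le> m" using q(3) k by auto
    have "d (c i) (c i') \<le> d (c i) q + d q (c i')" using d_tri cP im i' qP by auto
    then have "d (c i) (c i') \<le> 2 * D + 1" using d_sym[of "c i" q] cP[OF im] qP i' q by auto
    then have "L * d (c i) (c i') + L \<le> L * (2 * D + 1) + L" by (intro add_right_mono mult_le_mono2)
    moreover have "i' - i \<le> L * d (c i) (c i') + L" using qs i' im q(3) k unfolding quasi_def by auto
    ultimately have "k - i \<le> L * (2 * D + 1) + L" using i' by linarith
    then have "J * (k - i) \<le> J * (L * (2 * D + 1) + L)" by (rule mult_le_mono2)
    moreover have "d (c i) (c k) \<le> J * (k - i)" using quasi_d[OF qs, of i "k - i"] q(3) k by auto
    moreover have "d (c k) q \<le> d (c k) (c i) + d (c i) q" using d_tri cP im k qP by auto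
    moreover have "d (c k) (c i) = d (c i) (c k)" "d (c i) q = d q (c i)" using d_sym cP im k qP by auto
    ultimately have "d (c k) q \<le> D2" unfolding D2_def using q by linarith
    then show ?thesis using q by auto
  qed
  then show ?thesis by blast
qed

lemma geodesic_seq:
  "a \<in> P \<Longrightarrow> b \<in> P \<Longrightarrow> d a b = n \<Longrightarrow>
    \<exists>c. c 0 = a \<and> c n = b \<and> (\<forall>i\<le>n. c i \<in> P) \<and> (\<forall>i j. i \<le> j \<longrightarrow> j \<le> n \<longrightarrow> d (c i) (c j) = j - i)"
proof (induction n arbitrary: a)
  case 0
  then show ?case using d_eq d_refl by (intro exI[of _ "\<lambda>_. a"]) auto
next
  case (Suc n)
  obtain a' where a': "a' \<in> P" "d a a' = 1" "d a' b = n" using d_mid[of a b 1] Suc.prems by auto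
  obtain c where c: "c 0 = a'" "c n = b" "\<forall>i\<le>n. c i \<in> P" "\<forall>i j. i \<le> j \<longrightarrow> j \<le> n \<longrightarrow> d (c i) (c j) = j - i"
    using Suc.IH[of a'] a' Suc.prems by blast
  let ?c = "case_nat a c"
  have P: "\<forall>i\<le>Suc n. ?c i \<in> P" using c Suc.prems by (auto split: nat.split)
  have "d (?c i) (?c j) = j - i" if ij: "i \<le> j" "j \<le> Suc n" for i j
  proof (cases i)
    case 0
    show ?thesis
    proof (cases j)
      case (Suc j')
      have "c j' \<in> P" using c ij Suc by auto
      then have "d a (c j') \<le> d a a' + d a' (c j')" "d a b \<le> d a (c j') + d (c j') b"
        using d_tri[OF Suc.prems(1) a'(1)] d_tri[OF Suc.prems(1) _ Suc.prems(2)] by auto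
      moreover have "d a' (c j') = j'" using c ij Suc by (metis Suc_le_mono diff_zero le0)
      moreover have "d (c j') b = n - j'" using c ij Suc by (metis Suc_le_mono le_refl)
      ultimately show ?thesis using 0 Suc a' Suc.prems ij by auto
    qed (use 0 d_refl Suc.prems in auto)
  next
    case (Suc i')
    then show ?thesis using ij c by (cases j) auto
  qed
  then show ?case using P c by (intro exI[of _ ?c]) auto
qed

lemma geodesic_seq_through:
  assumes "a \<in> P" "b \<in> P" "q \<in> ival a b"
  shows "\<exists>c. c 0 = a \<and> c (d a b) = b \<and> c (d a q) = q \<and> (\<forall>i\<le>d a b. c i \<in> P)
    \<and> (\<forall>i j. i \<le> j \<longrightarrow> j \<le> d a b \<longrightarrow> d (c i) (c j) = j - i)"
proof -
  have qP: "q \<in> P" and e: "d a q + d q b = d a b" using assms ivalD by auto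
  obtain c1 where c1: "c1 0 = a" "c1 (d a q) = q" "\<And>i. i \<le> d a q \<Longrightarrow> c1 i \<in> P"
    "\<And>i j. i \<le> j \<Longrightarrow> j \<le> d a q \<Longrightarrow> d (c1 i) (c1 j) = j - i" using geodesic_seq[OF assms(1) qP] by blast
  obtain c2 where c2: "c2 0 = q" "c2 (d q b) = b" "\<And>i. i \<le> d q b \<Longrightarrow> c2 i \<in> P"
    "\<And>i j. i \<le> j \<Longrightarrow> j \<le> d q b \<Longrightarrow> d (c2 i) (c2 j) = j - i" using geodesic_seq[OF qP assms(2)] by blast
  define c where "c i = (if i \<le> d a q then c1 i else c2 (i - d a q))" for i
  have P: "c i \<in> P" if "i \<le> d a b" for i using that c1 c2 e by (auto simp: c_def)
  have "d (c i) (c j) = j - i" if ij: "i \<le> j" "j \<le> d a b" for i j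
  proof -
    consider "j \<le> d a q" | "i > d a q" | "i \<le> d a q" "j > d a q" by linarith
    then show ?thesis
    proof cases
      case 3
      let ?j = "j - d a q"
      have jb: "?j \<le> d q b" using ij e by auto
      have PP: "c1 i \<in> P" "c2 ?j \<in> P" using c1 c2 3 jb by auto
      have "d (c1 i) (c2 ?j) \<le> d (c1 i) q + d q (c2 ?j)" "d a b \<le> d a (c1 i) + d (c1 i) b"
        "d (c1 i) b \<le> d (c1 i) (c2 ?j) + d (c2 ?j) b" using d_tri PP qP assms by auto
      moreover have "d (c1 i) q = d a q - i" using c1(4)[of i "d a q"] c1(2) 3 by auto
      moreover have "d a (c1 i) = i" using c1(4)[of 0 i] c1(1) 3 by auto
      moreover have "d q (c2 ?j) = ?j" using c2(4)[of 0 ?j] c2(1) jb by auto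
      moreover have "d (c2 ?j) b = d q b - ?j" using c2(4)[of ?j "d q b"] c2(2) jb by auto
      moreover obtain r where "d a q = i + r" using 3 le_Suc_ex by blast
      moreover have "d (c2 ?j) b + ?j = d q b" using calculation jb by simp
      ultimately have "d (c1 i) (c2 ?j) = r + ?j" "j - i = r + ?j" using e 3(2) by linarith+
      then have "d (c1 i) (c2 ?j) = j - i" by simp
      then show ?thesis using 3 by (auto simp: c_def)
    qed (use c1(4) c2(4) ij e in \<open>auto simp: c_def\<close>)
  qed
  moreover have "c 0 = a" "c (d a q) = q" using c1 by (auto simp: c_def)
  moreover have "c (d a b) = b"
  proof (cases "d a q = d a b")
    case True
    then have "q = b" using e d_eq qP assms by auto
    then show ?thesis using c1 by (auto simp: c_def)
  next
    case False
    then have "d a q < d a b" using e by auto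
    moreover have "d a b - d a q = d q b" using e by auto
    ultimately show ?thesis using c2 by (auto simp: c_def)
  qed
  ultimately show ?thesis using P by (intro exI[of _ c]) auto
qed

end

text \<open>Geodesics for one metric are quasi-geodesics for the other, so the Morse lemma applies to them.\<close>

lemma slim_change:
  assumes g1: "geodesic_space P d1" and g2: "geodesic_space P d2" and sl: "geodesic_space.slim P d1 \<delta>"
    and J1: "\<And>a b. a \<in> P \<Longrightarrow> b \<in> P \<Longrightarrow> d1 a b \<le> J * d2 a b"
    and J2: "\<And>a b. a \<in> P \<Longrightarrow> b \<in> P \<Longrightarrow> d2 a b \<le> J * d1 a b"
  shows "\<exists>\<delta>'. geodesic_space.slim P d2 \<delta>'"
proof -
  interpret A: geodesic_space P d1 by fact
  interpret B: geodesic_space P d2 by fact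
  obtain D where D: "\<And>c m q. A.quasi J J c m \<Longrightarrow> q \<in> A.ival (c 0) (c m) \<Longrightarrow> \<exists>i\<le>m. d1 q (c i) \<le> D"
    using A.morse1[OF sl] by metis
  obtain D' where D': "\<And>c m k. A.quasi J J c m \<Longrightarrow> k \<le> m \<Longrightarrow> \<exists>q\<in>A.ival (c 0) (c m). d1 (c k) q \<le> D'"
    using A.morse2[OF sl] by metis
  have qs: "A.quasi J J c n" if "\<forall>i\<le>n. c i \<in> P" "\<forall>i j. i \<le> j \<longrightarrow> j \<le> n \<longrightarrow> d2 (c i) (c j) = j - i" for c n
  proof -
    have "d1 (c i) (c (Suc i)) \<le> J" if "i < n" for i
      using J1[of "c i" "c (Suc i)"] that \<open>\<forall>i\<le>n. c i \<in> P\<close> \<open>\<forall>i j. i \<le> j \<longrightarrow> j \<le> n \<longrightarrow> d2 (c i) (c j) = j - i\<close> by auto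
    moreover have "j - i \<le> J * d1 (c i) (c j) + J" if "i \<le> j" "j \<le> n" for i j
    proof -
      have "d2 (c i) (c j) = j - i" using that \<open>\<forall>i j. i \<le> j \<longrightarrow> j \<le> n \<longrightarrow> d2 (c i) (c j) = j - i\<close> by blast
      moreover have "d2 (c i) (c j) \<le> J * d1 (c i) (c j)" using J2 that \<open>\<forall>i\<le>n. c i \<in> P\<close> by auto
      ultimately show ?thesis by linarith
    qed
    ultimately show ?thesis using that by (auto simp: A.quasi_def)
  qed
  have near: "\<exists>q'\<in>B.ival a b. d1 q q' \<le> D" if h: "a \<in> P" "b \<in> P" "q \<in> A.ival a b" for a b q
  proof -
    obtain c where c: "c 0 = a" "c (d2 a b) = b" "\<forall>i\<le>d2 a b. c i \<in> P"
      "\<forall>i j. i \<le> j \<longrightarrow> j \<le> d2 a b \<longrightarrow> d2 (c i) (c j) = j - i" using B.geodesic_seq[OF h(1,2) refl] by blast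
    have "q \<in> A.ival (c 0) (c (d2 a b))" using c h by simp
    from D[OF qs[OF c(3,4)] this] obtain i where i: "i \<le> d2 a b" "d1 q (c i) \<le> D" by blast
    have "d2 a (c i) = i" using c(4)[rule_format, of 0 i] c(1) i by simp
    moreover have "d2 (c i) b = d2 a b - i" using c(4)[rule_format, of i "d2 a b"] c(2) i by simp
    ultimately have "c i \<in> B.ival a b" using c i by (auto simp: B.ival_def)
    then show ?thesis using i by blast
  qed
  have "\<exists>q'\<in>B.ival a c \<union> B.ival c b. d2 q q' \<le> J * (D' + \<delta> + D)"
    if P: "a \<in> P" "b \<in> P" "c \<in> P" and q: "q \<in> B.ival a b" for a b c q
  proof -
    have qP: "q \<in> P" and e: "d2 a q + d2 q b = d2 a b" using q B.ivalD by auto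
    obtain s where s: "s 0 = a" "s (d2 a b) = b" "s (d2 a q) = q" "\<forall>i\<le>d2 a b. s i \<in> P"
      "\<forall>i j. i \<le> j \<longrightarrow> j \<le> d2 a b \<longrightarrow> d2 (s i) (s j) = j - i"
      using B.geodesic_seq_through[OF P(1,2) q] by blast
    obtain q1 where q1: "q1 \<in> A.ival a b" "d1 q q1 \<le> D'"
      using D'[OF qs[OF s(4,5)], of "d2 a q"] s e by auto
    obtain q2 where q2: "q2 \<in> A.ival a c \<or> q2 \<in> A.ival c b" "d1 q1 q2 \<le> \<delta>" "q2 \<in> P"
      using A.slimD[OF sl P q1(1)] by metis
    obtain q3 where q3: "q3 \<in> B.ival a c \<union> B.ival c b" "d1 q2 q3 \<le> D"
      using q2(1) near[of a c q2] near[of c b q2] P by blast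
    have PP: "q1 \<in> P" "q3 \<in> P" using q1 q3 A.ivalD B.ivalD by auto
    have "d1 q q3 \<le> d1 q q1 + d1 q1 q3" "d1 q1 q3 \<le> d1 q1 q2 + d1 q2 q3"
      using A.d_tri PP q2 qP by auto
    then have "d1 q q3 \<le> D' + \<delta> + D" using q1 q2 q3 by auto
    then have "J * d1 q q3 \<le> J * (D' + \<delta> + D)" by (rule mult_le_mono2)
    then have "d2 q q3 \<le> J * (D' + \<delta> + D)" using J2[OF qP PP(2)] by linarith
    then show ?thesis using q3 by blast
  qed
  then show ?thesis unfolding B.slim_def by blast
qed

section \<open>Finitely generated abelian groups with a finite group action\<close>

definition zs :: "int \<Rightarrow> 'a::ab_group_add \<Rightarrow> 'a" where
  "zs n a = (if 0 \<le> n then ((+) a ^^ nat n) 0 else - (((+) a ^^ nat (- n)) 0))"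

lemma zs_succ: "zs (n + 1) a = zs n a + a"
proof (cases "0 \<le> n")
  case True
  then have "nat (n + 1) = Suc (nat n)" by auto
  then show ?thesis using True by (simp add: zs_def add.commute)
next
  case False
  then obtain k where k: "n = - int (Suc k)" by (metis int_cases nat_int not_le of_nat_0_le_iff)
  then have "nat (- n) = Suc k" "nat (- (n + 1)) = k" "n + 1 \<ge> 0 \<longleftrightarrow> k = 0" by auto
  then show ?thesis using False by (simp add: zs_def)
qed

lemma zs_zero [simp]: "zs 0 a = 0" by (simp add: zs_def)

lemma zs_pred: "zs (n - 1) a = zs n a - a"
  using zs_succ[of "n - 1" a] by (simp add: algebra_simps)

text \<open>The integers act on every abelian group. This makes span, independence and coordinates
  of modules available, although a maximal independent set spans only up to finite index.\<close>

interpretation ZM: module zs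
proof
  show add: "zs (x + y) a = zs x a + zs y a" for x y and a :: 'a
  proof (induction y rule: int_induct[of _ 0])
    case (step1 i)
    then show ?case using zs_succ[of "x + i" a] zs_succ[of i a] by (simp add: ac_simps)
  next
    case (step2 i)
    then show ?case using zs_pred[of "x + i" a] zs_pred[of i a] by (simp add: add_diff_eq)
  qed simp
  show "zs x (a + b) = zs x a + zs x b" for x and a b :: 'a
    by (induction x rule: int_induct[of _ 0]) (simp_all add: zs_succ zs_pred algebra_simps)
  have diff: "zs (x - y) a = zs x a - zs y a" for x y and a :: 'a
    using add[of "x - y" y a] by (simp add: algebra_simps)
  have one: "zs 1 a = a" for a :: 'a using zs_succ[of 0 a] by simp
  show "zs x (zs y a) = zs (x * y) a" for x y and a :: 'a
    by (induction x rule: int_induct[of _ 0]) (simp_all add: zs_succ zs_pred add diff algebra_simps one)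
  show "zs 1 a = a" for a :: 'a using zs_succ[of 0 a] by simp
qed

definition add_hom :: "('a::ab_group_add \<Rightarrow> 'b::ab_group_add) \<Rightarrow> bool" where
  "add_hom f \<longleftrightarrow> (\<forall>a b. f (a + b) = f a + f b)"

lemma add_hom_add: "add_hom f \<Longrightarrow> f (a + b) = f a + f b" by (simp add: add_hom_def)

lemma add_hom_0: "add_hom f \<Longrightarrow> f 0 = 0"
  using add_hom_add[of f 0 0] by simp

lemma add_hom_minus: "add_hom f \<Longrightarrow> f (- a) = - f a"
  using add_hom_add[of f a "- a"] add_hom_0[of f] by (simp add: add_eq_0_iff)

lemma add_hom_diff: "add_hom f \<Longrightarrow> f (a - b) = f a - f b"
  using add_hom_add[of f a "- b"] add_hom_minus[of f b] by simp

lemma add_hom_zs: "add_hom f \<Longrightarrow> f (zs n a) = zs n (f a)"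
  by (induction n rule: int_induct[of _ 0]) (simp_all add: add_hom_0 zs_succ zs_pred add_hom_add add_hom_diff)

lemma add_hom_sum: "add_hom f \<Longrightarrow> f (sum g I) = (\<Sum>i\<in>I. f (g i))"
  by (induction I rule: infinite_finite_induct) (simp_all add: add_hom_0 add_hom_add)

lemma add_hom_comp: "add_hom f \<Longrightarrow> add_hom g \<Longrightarrow> add_hom (f \<circ> g)"
  by (simp add: add_hom_def)

lemma zs_int: "zs n (k::int) = n * k"
  by (induction n rule: int_induct[of _ 0]) (simp_all add: zs_succ zs_pred algebra_simps)

lemma finite_bounded_combos:
  assumes "finite I"
  shows "finite ((\<lambda>c. \<Sum>i\<in>I. zs (c i) (v i)) ` {c. \<forall>i\<in>I. \<bar>c i\<bar> \<le> (C::int)})" (is "finite (?f ` _)")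
proof -
  have "?f ` {c. \<forall>i\<in>I. \<bar>c i\<bar> \<le> C} \<subseteq> ?f ` (PiE I (\<lambda>_. {-C..C}))"
  proof (rule image_subsetI)
    fix c assume "c \<in> {c. \<forall>i\<in>I. \<bar>c i\<bar> \<le> C}"
    then have r: "restrict c I \<in> PiE I (\<lambda>_. {-C..C})" by (auto simp: abs_le_iff)
    have e: "?f c = ?f (restrict c I)" by auto
    show "?f c \<in> ?f ` (PiE I (\<lambda>_. {-C..C}))" unfolding e using r by (rule imageI)
  qed
  moreover have "finite (?f ` (PiE I (\<lambda>_. {-C..C})))"
    by (rule finite_imageI, rule finite_PiE[OF assms], rule finite_atLeastAtMost_int)
  ultimately show ?thesis by (rule finite_subset)
qed

lemma zgen_span: "zgen S \<subseteq> ZM.span S"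
proof
  fix x assume "x \<in> zgen S"
  then show "x \<in> ZM.span S"
    by induction (auto intro: ZM.span_zero ZM.span_base ZM.span_diff)
qed

lemma fin_gen_quot:
  assumes "fin_gen_ab TYPE('a::ab_group_add)" "n > 0"
  shows "\<exists>R::'a set. finite R \<and> (\<forall>a. \<exists>x. a - zs n x \<in> R)"
proof -
  obtain S :: "'a set" where S: "finite S" "zgen S = UNIV" using assms by (auto simp: fin_gen_ab_def)
  define R where "R = (\<lambda>c. \<Sum>i\<in>S. zs (c i) i) ` {c. \<forall>i\<in>S. \<bar>c i\<bar> \<le> n}"
  have "\<exists>x. a - zs n x \<in> R" for a
  proof -
    have "a \<in> ZM.span S" using zgen_span S by blast
    then obtain u where u: "a = (\<Sum>i\<in>S. zs (u i) i)" using ZM.span_finite[OF S(1)] by auto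
    have e: "a - zs n (\<Sum>i\<in>S. zs (u i div n) i) = (\<Sum>i\<in>S. zs (u i mod n) i)"
      unfolding u ZM.scale_sum_right ZM.scale_scale sum_subtractf[symmetric] ZM.scale_left_diff_distrib[symmetric]
      by (simp add: minus_mult_div_eq_mod)
    have "\<forall>i\<in>S. \<bar>u i mod n\<bar> \<le> n" using assms(2) by (auto simp: abs_le_iff less_imp_le)
    then have "(\<Sum>i\<in>S. zs (u i mod n) i) \<in> R" unfolding R_def by (intro image_eqI[of _ _ "\<lambda>i. u i mod n"]) auto
    then show ?thesis using e by metis
  qed
  moreover have "finite R" unfolding R_def by (rule finite_bounded_combos[OF S(1)])
  ultimately show ?thesis by blast
qed

text \<open>A substitute for the structure theorem. B is a maximal independent set among the
  generators, so each generator s has a positive multiple \<open>k s\<close> in its span, and the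
  product m of these multipliers carries all of A into the span. The functional \<open>lam b\<close>
  reads off the coordinate of \<open>zs m a\<close> at b; torsion elements have all coordinates 0,
  hence are killed by m.\<close>

lemma fin_gen_coords:
  assumes fg: "fin_gen_ab TYPE('a::ab_group_add)"
  shows "\<exists>(B::'a set) m lam. finite B \<and> m > 0 \<and> (\<forall>b. add_hom (lam b)) \<and> (\<forall>a. zs m a = (\<Sum>b\<in>B. zs (lam b a) b))
    \<and> (\<forall>n>0. finite {a::'a. zs n a = 0})"
proof -
  obtain S :: "'a set" where S: "finite S" "zgen S = UNIV" using assms by (auto simp: fin_gen_ab_def)
  have spS: "ZM.span S = UNIV" using zgen_span S by blast
  let ?I = "\<lambda>B. B \<subseteq> S \<and> \<not> ZM.dependent B"
  have "?I {}" using ZM.independent_empty by auto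
  moreover have "\<forall>B. ?I B \<longrightarrow> card B < Suc (card S)" using S by (auto simp: less_Suc_eq_le intro: card_mono)
  ultimately obtain B where B: "?I B" "\<And>B'. ?I B' \<Longrightarrow> card B' \<le> card B"
    using ex_has_greatest_nat[of ?I "{}" card "Suc (card S)"] by blast
  have finB: "finite B" using B S finite_subset by blast
  have one: "\<exists>k>0. zs k s \<in> ZM.span B" if s: "s \<in> S" for s
  proof (cases "s \<in> B")
    case True
    then show ?thesis using ZM.span_base by (intro exI[of _ 1]) auto
  next
    case False
    have "ZM.dependent (insert s B)"
    proof (rule ccontr)
      assume "\<not> ?thesis"
      then have "card (insert s B) \<le> card B" using B s by auto
      then show False using finB False by auto
    qed
    then obtain u where u: "(\<Sum>v\<in>insert s B. zs (u v) v) = 0" "\<exists>v\<in>insert s B. u v \<noteq> 0"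
      using ZM.dependent_finite[of "insert s B"] finB by auto
    have e: "zs (u s) s + (\<Sum>v\<in>B. zs (u v) v) = 0" using u finB False by simp
    have us: "u s \<noteq> 0"
    proof
      assume z: "u s = 0"
      then have "(\<Sum>v\<in>B. zs (u v) v) = 0" using e by simp
      then have "\<forall>v\<in>B. u v = 0" using ZM.independentD[of B B u] B finB by auto
      then show False using u z by auto
    qed
    have sp: "(\<Sum>v\<in>B. zs (u v) v) \<in> ZM.span B" by (intro ZM.span_sum ZM.span_scale ZM.span_base)
    have e': "zs (u s) s = - (\<Sum>v\<in>B. zs (u v) v)" using e by (simp add: eq_neg_iff_add_eq_0)
    have "zs (u s) s \<in> ZM.span B" unfolding e' using sp by (rule ZM.span_neg)
    moreover have "zs (- u s) s \<in> ZM.span B" using calculation ZM.span_neg by (auto simp: ZM.scale_minus_left)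
    ultimately show ?thesis using us by (cases "u s > 0") (auto intro: exI[of _ "u s"] exI[of _ "- u s"])
  qed
  then obtain k where k: "\<And>s. s \<in> S \<Longrightarrow> k s > (0::int) \<and> zs (k s) s \<in> ZM.span B" by metis
  define m where "m = (\<Prod>s\<in>S. k s)"
  have m0: "m > 0" unfolding m_def using k by (intro prod_pos) auto
  have mS: "zs m s \<in> ZM.span B" if "s \<in> S" for s
  proof -
    have "m = (\<Prod>s\<in>S-{s}. k s) * k s" unfolding m_def using S that by (simp add: prod.remove mult.commute)
    then have "zs m s = zs (\<Prod>s\<in>S-{s}. k s) (zs (k s) s)" by simp
    then show ?thesis using k[OF that] ZM.span_scale by metis
  qed
  have ma: "zs m a \<in> ZM.span B" for a :: 'a
  proof -
    have "a \<in> range (\<lambda>u. \<Sum>i\<in>S. zs (u i) i)" using ZM.span_finite[OF S(1)] spS by simp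
    then obtain u where u: "a = (\<Sum>i\<in>S. zs (u i) i)" by (rule rangeE)
    have "zs m a = (\<Sum>i\<in>S. zs (u i) (zs m i))" unfolding u by (simp add: ZM.scale_sum_right mult.commute)
    then show ?thesis using mS by (metis (no_types, lifting) ZM.span_sum ZM.span_scale)
  qed
  define lam where "lam b a = ZM.representation B (zs m a) b" for b a
  have indB: "\<not> ZM.dependent B" using B by auto
  have hom: "add_hom (lam b)" for b :: 'a
    unfolding add_hom_def lam_def by (simp add: ZM.scale_right_distrib ZM.representation_add[OF indB ma ma])
  have rep: "zs m a = (\<Sum>b\<in>B. zs (lam b a) b)" for a :: 'a
    unfolding lam_def using ZM.sum_representation_eq[OF indB ma finB] by auto
  have tor: "zs m a = 0" if "zs n a = 0" "n > 0" for n and a :: 'a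
  proof -
    have "n * lam b a = 0" for b :: 'a using add_hom_zs[OF hom, of b n a] add_hom_0[OF hom] that by (simp add: zs_int)
    then show ?thesis using that rep[of a] by simp
  qed
  \<comment> \<open>The torsion killed by m embeds into A modulo m: two such elements with the same
    residue differ by an element of the span of B, which is torsion-free.\<close>
  have fin: "finite {a::'a. zs m a = 0}"
  proof -
    obtain R :: "'a set" where R: "finite R" "\<forall>a. \<exists>x. a - zs m x \<in> R" using fin_gen_quot[OF fg m0] by auto
    then obtain x where x: "\<And>a. a - zs m (x a) \<in> R" by metis
    have "inj_on (\<lambda>a. a - zs m (x a)) {a. zs m a = 0}"
    proof (rule inj_onI, clarsimp)
      fix a b assume a: "zs m a = 0" "zs m b = 0" "a - zs m (x a) = b - zs m (x b)"
      have e: "a - b = zs m (x a - x b)" using a by (simp add: ZM.scale_right_diff_distrib algebra_simps)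
      have s: "a - b \<in> ZM.span B" unfolding e by (rule ma)
      have "zs m (a - b) = 0" using a by (simp add: ZM.scale_right_diff_distrib)
      then have "m * ZM.representation B (a - b) v = 0" for v
        using ZM.representation_scale[OF indB s, of m] ZM.representation_zero[of B] by (metis)
      then have "ZM.representation B (a - b) v = 0" for v using m0 by auto
      then have "a - b = 0" using ZM.sum_representation_eq[OF indB s finB order_refl] by simp
      then show "a = b" by simp
    qed
    moreover have "finite ((\<lambda>a. a - zs m (x a)) ` {a. zs m a = 0})" using x R by (auto intro: finite_subset)
    ultimately show ?thesis by (rule finite_imageD[rotated])
  qed
  have "finite {a::'a. zs n a = 0}" if "n > 0" for n
    using tor that by (intro finite_subset[OF _ fin]) auto
  then show ?thesis using finB m0 hom rep by (intro exI[of _ B] exI[of _ m] exI[of _ lam]) simp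
qed

text \<open>Induction on the number of coordinates. T0 deals with the other coordinates, and since k
  bounds its entries in coordinate i, it is enough for every tuple with \<open>c i \<ge> k\<close>;
  the remaining tuples lie in finitely many slices on which coordinate i is constant.\<close>

lemma dickson:
  assumes "finite I"
  shows "\<exists>T\<subseteq>S. finite T \<and> (\<forall>c\<in>S. \<exists>t\<in>T. \<forall>i\<in>I. t i \<le> (c i :: nat))"
  using assms
proof (induction I arbitrary: S rule: finite_induct)
  case empty
  show ?case
  proof (cases "S = {}")
    case False
    then obtain t where "t \<in> S" by auto
    then show ?thesis by (intro exI[of _ "{t}"]) auto
  qed auto
next
  case (insert i I)
  obtain T0 where T0: "T0 \<subseteq> S" "finite T0" "\<forall>c\<in>S. \<exists>t\<in>T0. \<forall>i\<in>I. t i \<le> c i" using insert.IH[of S] by auto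
  define k where "k = Max (insert 0 ((\<lambda>t. t i) ` T0))"
  have k: "t i \<le> k" if "t \<in> T0" for t unfolding k_def using that T0 by auto
  define Tp where "Tp j T \<longleftrightarrow> T \<subseteq> {c \<in> S. c i = j} \<and> finite T
      \<and> (\<forall>c\<in>{c \<in> S. c i = j}. \<exists>t\<in>T. \<forall>i\<in>I. t i \<le> c i)" for j T
  have "\<exists>T. Tp j T" for j
    using insert.IH[of "{c \<in> S. c i = j}"] unfolding Tp_def .
  then obtain T where T': "\<And>j. Tp j (T j)" by metis
  have T1: "T j \<subseteq> {c \<in> S. c i = j}" for j using T'[of j] unfolding Tp_def by simp
  have T2: "finite (T j)" for j using T'[of j] unfolding Tp_def by simp
  have T3: "\<exists>t\<in>T (c i). \<forall>i\<in>I. t i \<le> c i" if "c \<in> S" for c using T'[of "c i"] that unfolding Tp_def by simp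
  let ?T = "T0 \<union> (\<Union>j<k. T j)"
  have "\<exists>t\<in>?T. \<forall>i\<in>insert i I. t i \<le> c i" if c: "c \<in> S" for c
  proof (cases "c i < k")
    case True
    obtain t where "t \<in> T (c i)" "\<forall>i\<in>I. t i \<le> c i" using T3[OF c] by auto
    moreover then have "t i = c i" using T1 by blast
    ultimately show ?thesis using True by (intro bexI[of _ t]) auto
  next
    case False
    obtain t where "t \<in> T0" "\<forall>i\<in>I. t i \<le> c i" using T0 c by auto
    moreover then have "t i \<le> c i" using k False by fastforce
    ultimately show ?thesis by (intro bexI[of _ t]) auto
  qed
  moreover have "?T \<subseteq> S" "finite ?T" using T0 T1 T2 by (fast, simp)
  ultimately show ?case by (intro exI[of _ ?T]) auto
qed

section \<open>Equivariant coordinates on A\<close>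

abbreviation hinv :: "('a \<Rightarrow> 'b) \<Rightarrow> 'b \<Rightarrow> 'a" where "hinv \<equiv> inv_into UNIV"

locale fg_lattice =
  fixes H :: "('a::ab_group_add \<Rightarrow> 'a) set" and B :: "'a set" and m :: int and lam :: "'a \<Rightarrow> 'a \<Rightarrow> int"
  assumes finH: "finite H" and H_id: "id \<in> H"
    and H_comp: "\<eta> \<in> H \<Longrightarrow> \<theta> \<in> H \<Longrightarrow> \<eta> \<circ> \<theta> \<in> H"
    and H_bij: "\<eta> \<in> H \<Longrightarrow> bij \<eta>" and H_inv: "\<eta> \<in> H \<Longrightarrow> hinv \<eta> \<in> H"
    and H_hom: "\<eta> \<in> H \<Longrightarrow> add_hom \<eta>"
    and finB: "finite B" and m_pos: "m > 0" and lam_hom: "add_hom (lam b)"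
    and coords: "zs m a = (\<Sum>b\<in>B. zs (lam b a) b)"
    and fin_tor: "n > 0 \<Longrightarrow> finite {a::'a. zs n a = 0}"
    and fin_quot: "n > 0 \<Longrightarrow> \<exists>R::'a set. finite R \<and> (\<forall>a. \<exists>x. a - zs n x \<in> R)"
begin

lemma H_inv_simps [simp]:
  "\<eta> \<in> H \<Longrightarrow> \<eta> (hinv \<eta> a) = a" "\<eta> \<in> H \<Longrightarrow> hinv \<eta> (\<eta> a) = a"
  "\<eta> \<in> H \<Longrightarrow> \<eta> \<circ> hinv \<eta> = id" "\<eta> \<in> H \<Longrightarrow> hinv \<eta> \<circ> \<eta> = id"
  using H_bij by (auto simp: bij_is_surj surj_f_inv_f bij_is_inj inv_f_f fun_eq_iff)

lemma H_comp_inv: "\<eta> \<in> H \<Longrightarrow> f \<circ> \<eta> \<circ> hinv \<eta> = f" "\<eta> \<in> H \<Longrightarrow> f \<circ> hinv \<eta> \<circ> \<eta> = f"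
  by (simp_all add: fun_eq_iff)

definition Lam :: "('a \<Rightarrow> int) set" where "Lam = (\<lambda>(b, \<eta>). lam b \<circ> \<eta>) ` (B \<times> H)"

lemma finite_Lam: "finite Lam" unfolding Lam_def using finB finH by auto

lemma Lam_hom: "l \<in> Lam \<Longrightarrow> add_hom l" unfolding Lam_def using lam_hom H_hom add_hom_comp by fastforce

lemma Lam_H: "l \<in> Lam \<Longrightarrow> \<eta> \<in> H \<Longrightarrow> l \<circ> \<eta> \<in> Lam"
  unfolding Lam_def using H_comp by (auto simp: comp_assoc image_iff) blast

lemma lam_Lam: "b \<in> B \<Longrightarrow> \<eta> \<in> H \<Longrightarrow> lam b \<circ> \<eta> \<in> Lam" unfolding Lam_def by auto

text \<open>A left inverse, up to the factor \<open>mm\<close>, of sending an element of A to its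
  values on \<open>Lam\<close> (\<open>psi_eval\<close>). It is defined for arbitrary F because it
  will be applied to \<open>Phi\<close>, which is not linear; the average over H makes it
  equivariant (\<open>psi_act\<close>).\<close>

definition psi :: "(('a \<Rightarrow> int) \<Rightarrow> int) \<Rightarrow> 'a" where
  "psi F = (\<Sum>b\<in>B. \<Sum>\<eta>\<in>H. zs (F (lam b \<circ> \<eta>)) (hinv \<eta> b))"

definition mm :: int where "mm = int (card H) * m"

lemma mm_pos: "mm > 0" unfolding mm_def using m_pos finH H_id by (intro mult_pos_pos) (auto simp: card_gt_0_iff)

lemma psi_add: "psi (\<lambda>l. F l + G l) = psi F + psi G"
  unfolding psi_def by (simp add: ZM.scale_left_distrib sum.distrib)

lemma psi_diff: "psi (\<lambda>l. F l - G l) = psi F - psi G"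
  unfolding psi_def by (simp add: ZM.scale_left_diff_distrib sum_subtractf)

lemma psi_cong: "(\<And>l. l \<in> Lam \<Longrightarrow> F l = G l) \<Longrightarrow> psi F = psi G"
  unfolding psi_def using lam_Lam by (intro sum.cong refl) auto

lemma psi_eval: "psi (\<lambda>l. l a) = zs mm a"
proof -
  have "psi (\<lambda>l. l a) = (\<Sum>\<eta>\<in>H. hinv \<eta> (\<Sum>b\<in>B. zs (lam b (\<eta> a)) b))"
    unfolding psi_def
  proof (subst sum.swap, rule sum.cong[OF refl])
    fix \<eta> assume h: "\<eta> \<in> H"
    note hm = H_hom[OF H_inv[OF h]]
    show "(\<Sum>b\<in>B. zs ((lam b \<circ> \<eta>) a) (hinv \<eta> b)) = hinv \<eta> (\<Sum>b\<in>B. zs (lam b (\<eta> a)) b)"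
      by (simp add: add_hom_sum[OF hm] add_hom_zs[OF hm])
  qed
  also have "\<dots> = (\<Sum>\<eta>\<in>H. zs m a)"
  proof (rule sum.cong[OF refl])
    fix \<eta> assume h: "\<eta> \<in> H"
    show "hinv \<eta> (\<Sum>b\<in>B. zs (lam b (\<eta> a)) b) = zs m a"
      using h by (simp add: add_hom_zs[OF H_hom[OF H_inv[OF h]]] flip: coords)
  qed
  finally show ?thesis by (simp add: ZM.sum_constant_scale mm_def)
qed

text \<open>Right translation by \<open>\<theta>\<close> permutes H, so the average absorbs it; the
  action on the value becomes precomposition of the functionals.\<close>

lemma psi_act:
  assumes t: "\<theta> \<in> H"
  shows "\<theta> (psi F) = psi (\<lambda>l. F (l \<circ> \<theta>))"
proof -
  have "\<theta> (psi F) = (\<Sum>b\<in>B. \<Sum>\<eta>\<in>H. zs (F (lam b \<circ> \<eta>)) (\<theta> (hinv \<eta> b)))"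
    unfolding psi_def by (simp add: add_hom_sum[OF H_hom[OF t]] add_hom_zs[OF H_hom[OF t]])
  also have "\<dots> = (\<Sum>b\<in>B. \<Sum>\<eta>\<in>H. zs (F (lam b \<circ> \<eta> \<circ> \<theta>)) (hinv \<eta> b))"
  proof (rule sum.cong[OF refl], rule sum.reindex_bij_witness[where i = "\<lambda>\<eta>. \<eta> \<circ> \<theta>" and j = "\<lambda>\<eta>. \<eta> \<circ> hinv \<theta>"])
    fix b \<eta> assume h: "\<eta> \<in> H"
    have "hinv (\<eta> \<circ> hinv \<theta>) = hinv (hinv \<theta>) \<circ> hinv \<eta>" using o_inv_distrib H_bij h t H_inv by blast
    also have "hinv (hinv \<theta>) = \<theta>" using inv_inv_eq H_bij t by blast
    finally have i: "hinv (\<eta> \<circ> hinv \<theta>) = \<theta> \<circ> hinv \<eta>" .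
    show "zs (F (lam b \<circ> (\<eta> \<circ> hinv \<theta>) \<circ> \<theta>)) (hinv (\<eta> \<circ> hinv \<theta>) b) = zs (F (lam b \<circ> \<eta>)) (\<theta> (hinv \<eta> b))"
      using t i by (simp add: comp_assoc)
  qed (use t H_comp H_inv in \<open>auto simp: H_comp_inv\<close>)
  finally show ?thesis unfolding psi_def by (simp add: comp_assoc)
qed

lemma psi_finite: "finite (psi ` {F. \<forall>l\<in>Lam. \<bar>F l\<bar> \<le> C})"
proof -
  let ?f = "\<lambda>c. \<Sum>i\<in>B \<times> H. zs (c i) (case i of (b, \<eta>) \<Rightarrow> hinv \<eta> b)"
  have "psi ` {F. \<forall>l\<in>Lam. \<bar>F l\<bar> \<le> C} \<subseteq> ?f ` {c. \<forall>i\<in>B\<times>H. \<bar>c i\<bar> \<le> C}"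
  proof (rule image_subsetI)
    fix F assume F: "F \<in> {F. \<forall>l\<in>Lam. \<bar>F l\<bar> \<le> C}"
    let ?c = "\<lambda>(b, \<eta>). F (lam b \<circ> \<eta>)"
    have "psi F = ?f ?c"
      unfolding psi_def by (simp add: sum.cartesian_product case_prod_beta)
    moreover have "?c \<in> {c. \<forall>i\<in>B\<times>H. \<bar>c i\<bar> \<le> C}" using F lam_Lam by auto
    ultimately show "psi F \<in> ?f ` {c. \<forall>i\<in>B\<times>H. \<bar>c i\<bar> \<le> C}" by (rule image_eqI)
  qed
  moreover have "finite (?f ` {c. \<forall>i\<in>B\<times>H. \<bar>c i\<bar> \<le> C})" using finB finH by (intro finite_bounded_combos) auto
  ultimately show ?thesis by (rule finite_subset)
qed

lemma finite_zs_preimage: "n > 0 \<Longrightarrow> finite K \<Longrightarrow> finite {a::'a. zs n a \<in> K}"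
proof -
  assume n: "n > 0" and K: "finite K"
  have "finite {a::'a. zs n a = k}" for k
  proof (cases "\<exists>a0. zs n a0 = k")
    case True
    then obtain a0 where a0: "zs n a0 = k" by auto
    have "{a. zs n a = k} \<subseteq> (\<lambda>t. a0 + t) ` {a. zs n a = 0}"
    proof
      fix a assume "a \<in> {a. zs n a = k}"
      then have "zs n (a - a0) = 0" "a = a0 + (a - a0)" using a0 by (auto simp: ZM.scale_right_diff_distrib)
      then show "a \<in> (\<lambda>t. a0 + t) ` {a. zs n a = 0}" by blast
    qed
    then show ?thesis by (rule finite_subset) (intro finite_imageI fin_tor n)
  next
    case False
    then have "{a. zs n a = k} = {}" by blast
    then show ?thesis by (rule ssubst) (rule finite.emptyI)
  qed
  then have U: "finite (\<Union>k\<in>K. {a. zs n a = k})" using K by (intro finite_UN_I)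
  have e: "{a. zs n a \<in> K} = (\<Union>k\<in>K. {a. zs n a = k})" by blast
  show ?thesis unfolding e by (rule U)
qed

end

section \<open>An invariant simplicial fan\<close>

context fg_lattice begin

text \<open>The inequality N \<le> 1 defines an H-invariant polytope (up to torsion). The set F a of functionals that are maximal at a
  encodes the face whose open cone contains a, with larger sets for smaller faces; ray f is an equivariantly chosen vector
  in the open cone of f, and the combinations with chain support are the cones of the barycentric subdivision.\<close>

definition Lams :: "('a \<Rightarrow> int) set" where "Lams = insert (\<lambda>_. 0) (Lam \<union> (\<lambda>l a. - l a) ` Lam)"
definition N :: "'a \<Rightarrow> int" where "N a = Max ((\<lambda>l. l a) ` Lams)"
definition F :: "'a \<Rightarrow> ('a \<Rightarrow> int) set" where "F a = {l \<in> Lams. l a = N a}"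
definition faces :: "('a \<Rightarrow> int) set set" where "faces = F ` {a. N a > 0}"
definition hF :: "('a \<Rightarrow> 'a) \<Rightarrow> ('a \<Rightarrow> int) set \<Rightarrow> ('a \<Rightarrow> int) set" where "hF \<eta> f = {l \<in> Lams. l \<circ> \<eta> \<in> f}"

lemma finite_Lams: "finite Lams" unfolding Lams_def using finite_Lam by auto

lemma Lams_hom: "l \<in> Lams \<Longrightarrow> add_hom l"
  unfolding Lams_def by (auto simp: add_hom_def dest!: Lam_hom)

lemma Lams_H: "l \<in> Lams \<Longrightarrow> \<eta> \<in> H \<Longrightarrow> l \<circ> \<eta> \<in> Lams"
  unfolding Lams_def using Lam_H by (auto simp: comp_def fun_eq_iff image_iff)

lemma N_ge: "l \<in> Lams \<Longrightarrow> l a \<le> N a"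
  unfolding N_def using finite_Lams by auto

lemma N_nonneg: "N a \<ge> 0"
  using N_ge[of "\<lambda>_. 0" a] by (auto simp: Lams_def)

lemma N_at: "\<exists>l\<in>Lams. l a = N a"
proof -
  have "N a \<in> (\<lambda>l. l a) ` Lams" unfolding N_def using finite_Lams by (intro Max_in) (auto simp: Lams_def)
  then show ?thesis by auto
qed

lemma F_ne: "F a \<noteq> {}" using N_at by (auto simp: F_def)

lemma N_eqI: "(\<And>l. l \<in> Lams \<Longrightarrow> l a \<le> n) \<Longrightarrow> l0 \<in> Lams \<Longrightarrow> l0 a = n \<Longrightarrow> N a = n"
  using N_at[of a] N_ge[of l0 a] by force

lemma Lam_abs: "l \<in> Lam \<Longrightarrow> \<bar>l a\<bar> \<le> N a"
  using N_ge[of l a] N_ge[of "\<lambda>a. - l a" a] by (auto simp: Lams_def abs_le_iff)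

text \<open>A functional that is maximal at both x and y shows that they lie in a common closed
  cone, where N is linear. Equality in the sum forces equality in each summand, whence the
  intersection.\<close>

lemma N_add:
  assumes "F x \<inter> F y \<noteq> {}"
  shows "N (x + y) = N x + N y" "F (x + y) = F x \<inter> F y"
proof -
  obtain l0 where l0: "l0 \<in> Lams" "l0 x = N x" "l0 y = N y" using assms by (auto simp: F_def)
  have add: "l (x + y) = l x + l y" if "l \<in> Lams" for l using Lams_hom[OF that] by (rule add_hom_add)
  have "l (x + y) \<le> N x + N y" if "l \<in> Lams" for l
    unfolding add[OF that] by (intro add_mono N_ge that)
  then show e: "N (x + y) = N x + N y"
    using add[OF l0(1)] l0 by (intro N_eqI[of _ _ l0]) auto
  have "l (x + y) = N x + N y \<longleftrightarrow> l x = N x \<and> l y = N y" if "l \<in> Lams" for l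
    using N_ge[OF that, of x] N_ge[OF that, of y] add[OF that] by auto
  then show "F (x + y) = F x \<inter> F y" unfolding F_def e by blast
qed

lemma N_zs:
  assumes "n > 0"
  shows "N (zs n a) = n * N a" "F (zs n a) = F a"
proof -
  have l: "l (zs n a) = n * l a" if "l \<in> Lams" for l using add_hom_zs[OF Lams_hom[OF that]] by (simp add: zs_int)
  obtain l0 where l0: "l0 \<in> Lams" "l0 a = N a" using N_at by auto
  have "l (zs n a) \<le> n * N a" if "l \<in> Lams" for l
    unfolding l[OF that] using N_ge[OF that] assms by simp
  then show e: "N (zs n a) = n * N a" using l0 l[OF l0(1)] by (intro N_eqI[of _ _ l0]) auto
  have "l (zs n a) = n * N a \<longleftrightarrow> l a = N a" if "l \<in> Lams" for l
    unfolding l[OF that] using assms by simp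
  then show "F (zs n a) = F a" unfolding F_def e by blast
qed

lemma N_0 [simp]: "N 0 = 0"
  using N_at[of 0] Lams_hom add_hom_0 by metis

lemma N_act: 
  assumes "\<eta> \<in> H"
  shows "N (\<eta> a) = N a" "F (\<eta> a) = hF \<eta> (F a)"
proof -
  have le: "N (\<theta> a) \<le> N a" if "\<theta> \<in> H" for \<theta> a
  proof -
    obtain l where "l \<in> Lams" "l (\<theta> a) = N (\<theta> a)" using N_at by auto
    then show ?thesis using N_ge[of "l \<circ> \<theta>" a] Lams_H that by auto
  qed
  show e: "N (\<eta> a) = N a" using le[OF assms, of a] le[OF H_inv[OF assms], of "\<eta> a"] assms by simp
  show "F (\<eta> a) = hF \<eta> (F a)" unfolding F_def hF_def e using Lams_H assms by auto
qed

lemma hF_comp: "\<eta> \<in> H \<Longrightarrow> \<theta> \<in> H \<Longrightarrow> hF (\<eta> \<circ> \<theta>) f = hF \<eta> (hF \<theta> f)"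
  unfolding hF_def using Lams_H by (auto simp: comp_assoc)

lemma hF_id: "f \<subseteq> Lams \<Longrightarrow> hF id f = f" by (auto simp: hF_def)

lemma hF_mono: "f \<subseteq> g \<Longrightarrow> hF \<eta> f \<subseteq> hF \<eta> g" by (auto simp: hF_def)

lemma faces_sub: "f \<in> faces \<Longrightarrow> f \<subseteq> Lams" by (auto simp: faces_def F_def)

lemma faces_ne: "f \<in> faces \<Longrightarrow> f \<noteq> {}" using F_ne by (auto simp: faces_def)

lemma finite_faces: "finite faces"
  by (rule finite_subset[of _ "Pow Lams"]) (use faces_sub finite_Lams in auto)

lemma hF_faces: "\<eta> \<in> H \<Longrightarrow> f \<in> faces \<Longrightarrow> hF \<eta> f \<in> faces"
proof -
  assume h: "\<eta> \<in> H" and "f \<in> faces"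
  then obtain a where a: "f = F a" "N a > 0" by (auto simp: faces_def)
  then have "hF \<eta> f = F (\<eta> a)" "N (\<eta> a) > 0" using N_act h by auto
  then show ?thesis by (auto simp: faces_def)
qed

lemma hF_inv: "\<eta> \<in> H \<Longrightarrow> f \<in> faces \<Longrightarrow> hF \<eta> (hF (hinv \<eta>) f) = f" "\<eta> \<in> H \<Longrightarrow> f \<in> faces \<Longrightarrow> hF (hinv \<eta>) (hF \<eta> f) = f"
  using hF_comp[of \<eta> "hinv \<eta>" f] hF_comp[of "hinv \<eta>" \<eta> f] H_inv hF_id[OF faces_sub] by auto

lemma N_sum:
  assumes "finite I" "I \<noteq> {}" "\<And>i. i \<in> I \<Longrightarrow> l0 \<in> F (x i)"
  shows "N (sum x I) = (\<Sum>i\<in>I. N (x i)) \<and> F (sum x I) = (\<Inter>i\<in>I. F (x i))"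
  using assms
proof (induction I rule: finite_ne_induct)
  case (insert i I)
  have IH: "N (sum x I) = (\<Sum>i\<in>I. N (x i))" "F (sum x I) = (\<Inter>i\<in>I. F (x i))" using insert by auto
  have "l0 \<in> F (x i) \<inter> F (sum x I)" using IH insert by auto
  then have "F (x i) \<inter> F (sum x I) \<noteq> {}" by blast
  from N_add[OF this] show ?case using IH insert by simp
qed simp

section \<open>Equivariant rays in the faces\<close>

definition face_pt :: "('a \<Rightarrow> int) set \<Rightarrow> 'a" where "face_pt f = (SOME a. F a = f \<and> N a > 0)"
definition face_P :: int where "face_P = (\<Prod>f\<in>faces. N (face_pt f))"
definition face_pt1 :: "('a \<Rightarrow> int) set \<Rightarrow> 'a" where "face_pt1 f = zs (face_P div N (face_pt f)) (face_pt f)"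
text \<open>\<open>face_pt\<close> is an arbitrary choice that need not be fixed by the stabiliser
  of f. Summing the transported choices over H repairs this without leaving the open cone, which is
  closed under addition. The rescaling in \<open>face_pt1\<close> gives all summands the same
  height, so that every ray ends at the height \<open>Mb\<close>.\<close>

definition ray :: "('a \<Rightarrow> int) set \<Rightarrow> 'a" where "ray f = (\<Sum>\<eta>\<in>H. \<eta> (face_pt1 (hF (hinv \<eta>) f)))"
definition Mb :: int where "Mb = int (card H) * face_P"

lemma face_pt: "f \<in> faces \<Longrightarrow> F (face_pt f) = f \<and> N (face_pt f) > 0"
  unfolding face_pt_def faces_def by (rule someI_ex) auto

lemma face_P_pos: "face_P > 0" unfolding face_P_def using face_pt by (intro prod_pos) auto

lemma face_pt1: assumes "f \<in> faces" shows "F (face_pt1 f) = f" "N (face_pt1 f) = face_P"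
proof -
  have p: "N (face_pt f) > 0" using face_pt assms by auto
  have d: "N (face_pt f) dvd face_P" unfolding face_P_def using assms finite_faces by (intro dvd_prodI) auto
  then have "face_P div N (face_pt f) > 0" using p face_P_pos by (meson pos_imp_zdiv_pos_iff zdvd_imp_le)
  then show "F (face_pt1 f) = f" "N (face_pt1 f) = face_P"
    unfolding face_pt1_def using N_zs face_pt assms d by auto
qed

lemma ray: assumes f: "f \<in> faces" shows "F (ray f) = f" "N (ray f) = Mb"
proof -
  let ?x = "\<lambda>\<eta>. \<eta> (face_pt1 (hF (hinv \<eta>) f))"
  have x: "F (?x \<eta>) = f" "N (?x \<eta>) = face_P" if "\<eta> \<in> H" for \<eta>
    using N_act[OF that] face_pt1[OF hF_faces[OF H_inv[OF that] f]] hF_inv[OF that f] by auto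
  obtain l0 where "l0 \<in> f" using faces_ne f by auto
  then have "N (sum ?x H) = (\<Sum>i\<in>H. N (?x i)) \<and> F (sum ?x H) = (\<Inter>i\<in>H. F (?x i))"
    using x finH H_id by (intro N_sum[of _ l0]) auto
  moreover have "(\<Inter>i\<in>H. F (?x i)) = f" using x H_id by blast
  moreover have "(\<Sum>i\<in>H. N (?x i)) = Mb" using x unfolding Mb_def by simp
  ultimately show "F (ray f) = f" "N (ray f) = Mb" by (simp_all add: ray_def)
qed

lemma Mb_pos: "Mb > 0" unfolding Mb_def using face_P_pos finH H_id by (intro mult_pos_pos) (auto simp: card_gt_0_iff)

lemma ray_act: assumes t: "\<theta> \<in> H" and f: "f \<in> faces" shows "ray (hF \<theta> f) = \<theta> (ray f)"
proof -
  have "\<theta> (ray f) = (\<Sum>\<eta>\<in>H. \<theta> (\<eta> (face_pt1 (hF (hinv \<eta>) f))))"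
    unfolding ray_def by (simp add: add_hom_sum[OF H_hom[OF t]])
  also have "\<dots> = (\<Sum>\<eta>\<in>H. \<eta> (face_pt1 (hF (hinv \<eta>) (hF \<theta> f))))"
  proof (rule sum.reindex_bij_witness[where i = "\<lambda>\<eta>. hinv \<theta> \<circ> \<eta>" and j = "\<lambda>\<eta>. \<theta> \<circ> \<eta>"])
    fix \<eta> assume h: "\<eta> \<in> H"
    have "hinv (\<theta> \<circ> \<eta>) = hinv \<eta> \<circ> hinv \<theta>" using o_inv_distrib H_bij h t by blast
    then have "hF (hinv (\<theta> \<circ> \<eta>)) (hF \<theta> f) = hF (hinv \<eta>) f"
      using hF_comp[OF H_inv[OF h] H_inv[OF t]] hF_inv[OF t f] by simp
    then show "(\<theta> \<circ> \<eta>) (face_pt1 (hF (hinv (\<theta> \<circ> \<eta>)) (hF \<theta> f))) = \<theta> (\<eta> (face_pt1 (hF (hinv \<eta>) f)))" by simp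
    show "hinv \<theta> \<circ> (\<theta> \<circ> \<eta>) = \<eta>" "\<theta> \<circ> (hinv \<theta> \<circ> \<eta>) = \<eta>" using t by (simp_all add: fun_eq_iff)
    show "hinv \<theta> \<circ> \<eta> \<in> H" "\<theta> \<circ> \<eta> \<in> H" using H_comp H_inv t h by auto
  qed
  finally show ?thesis by (simp add: ray_def)
qed

section \<open>Combinations of rays supported on flags of faces\<close>

definition cmb :: "(('a \<Rightarrow> int) set \<Rightarrow> nat) \<Rightarrow> 'a" where
  "cmb c = (\<Sum>f\<in>faces. zs (int (c f)) (ray f))"

definition chain :: "(('a \<Rightarrow> int) set \<Rightarrow> nat) \<Rightarrow> bool" where
  "chain c \<longleftrightarrow> (\<forall>f. c f \<noteq> 0 \<longrightarrow> f \<in> faces) \<and> (\<forall>f g. c f \<noteq> 0 \<longrightarrow> c g \<noteq> 0 \<longrightarrow> f \<subseteq> g \<or> g \<subseteq> f)"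

lemma chain_mono: "chain c \<Longrightarrow> (\<And>f. c' f \<noteq> 0 \<Longrightarrow> c f \<noteq> 0) \<Longrightarrow> chain c'"
  unfolding chain_def by blast

text \<open>The rays in the support share the functionals of the smallest set of the chain, so N is
  additive on them and F of the sum is the intersection, which is that smallest set. Thus the value
  of the combination reveals one face of its support.\<close>

lemma chain_face:
  assumes ch: "chain c" and nz: "c f1 \<noteq> 0"
  shows "N (cmb c) = Mb * int (\<Sum>f\<in>faces. c f)" "c (F (cmb c)) > 0" "F (cmb c) \<in> faces"
    "\<And>f. c f \<noteq> 0 \<Longrightarrow> F (cmb c) \<subseteq> f" "N (cmb c) > 0"
proof -
  define S where "S = {f \<in> faces. c f \<noteq> 0}"
  have finS: "finite S" using finite_faces by (simp add: S_def)
  have f1: "f1 \<in> S" using ch nz by (auto simp: S_def chain_def)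
  obtain f0 where f0: "f0 \<in> S" "\<And>f. f \<in> S \<Longrightarrow> card f0 \<le> card f"
    using ex_has_least_nat[of "\<lambda>f. f \<in> S" f1 card] f1 by blast
  have min: "f0 \<subseteq> f" if "f \<in> S" for f
  proof -
    have "f0 \<subseteq> f \<or> f \<subseteq> f0" using ch f0 that by (auto simp: S_def chain_def)
    moreover have "finite f0" using f0 faces_sub finite_Lams finite_subset by (metis (no_types, lifting) S_def mem_Collect_eq)
    ultimately show ?thesis using f0(2)[OF that] card_seteq[of f0 f] by blast
  qed
  obtain l0 where l0: "l0 \<in> f0" using f0 faces_ne by (auto simp: S_def)
  let ?x = "\<lambda>f. zs (int (c f)) (ray f)"
  have cS: "cmb c = sum ?x S" unfolding cmb_def S_def using finite_faces
    by (intro sum.mono_neutral_right) auto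
  have x: "F (?x f) = f" "N (?x f) = int (c f) * Mb" if "f \<in> S" for f
    using that N_zs[of "int (c f)"] ray[of f] by (auto simp: S_def)
  have "N (sum ?x S) = (\<Sum>i\<in>S. N (?x i)) \<and> F (sum ?x S) = (\<Inter>i\<in>S. F (?x i))"
    using finS f1 x(1) min l0 by (intro N_sum[of _ l0]) (blast, blast, metis subsetD)
  moreover have "(\<Inter>i\<in>S. F (?x i)) = f0"
  proof -
    have "(\<Inter>i\<in>S. F (?x i)) = (\<Inter>i\<in>S. i)" using x(1) by (intro INF_cong) auto
    then show ?thesis using min f0 by blast
  qed
  moreover have "(\<Sum>i\<in>S. N (?x i)) = (\<Sum>i\<in>S. Mb * int (c i))" using x by (intro sum.cong) auto
  moreover have "(\<Sum>i\<in>S. Mb * int (c i)) = Mb * int (\<Sum>f\<in>S. c f)" by (simp add: sum_distrib_left)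
  moreover have sS: "(\<Sum>f\<in>S. c f) = (\<Sum>f\<in>faces. c f)" unfolding S_def using finite_faces
    by (intro sum.mono_neutral_left) auto
  ultimately have r: "N (cmb c) = Mb * int (\<Sum>f\<in>faces. c f)" "F (cmb c) = f0" using cS by auto
  show "N (cmb c) = Mb * int (\<Sum>f\<in>faces. c f)" by (rule r(1))
  show "c (F (cmb c)) > 0" "F (cmb c) \<in> faces" using r f0 by (auto simp: S_def)
  show "F (cmb c) \<subseteq> f" if "c f \<noteq> 0" for f using min[of f] r that ch by (auto simp: S_def chain_def)
  have "c f0 \<le> (\<Sum>f\<in>faces. c f)" using f0 finite_faces by (intro member_le_sum) (auto simp: S_def)
  moreover have "c f0 > 0" using f0 by (simp add: S_def)
  ultimately have "int (\<Sum>f\<in>faces. c f) > 0" by linarith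
  then show "N (cmb c) > 0" unfolding r(1) using Mb_pos by (rule mult_pos_pos[rotated])
qed

lemma cmb_upd:
  assumes "f \<in> faces"
  shows "cmb (c(f := c f + k)) = cmb c + zs (int k) (ray f)"
proof -
  have "cmb (c(f := c f + k)) = (\<Sum>g\<in>faces. zs (int (c g)) (ray g) + (if g = f then zs (int k) (ray f) else 0))"
    unfolding cmb_def by (intro sum.cong refl) (auto simp: ZM.scale_left_distrib)
  then show ?thesis using assms finite_faces by (simp add: sum.distrib cmb_def)
qed

lemma cmb_zero: "(\<And>f. c f = 0) \<Longrightarrow> cmb c = 0" by (simp add: cmb_def)

text \<open>Equal values have the same F, so both combinations contain the ray of that face. One
  copy of it is removed from each, and the induction runs over the total coefficient.\<close>

lemma chain_unique: "chain c \<Longrightarrow> chain c' \<Longrightarrow> cmb c = cmb c' \<Longrightarrow> c = c'"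
proof (induction "\<Sum>f\<in>faces. c f" arbitrary: c c')
  case 0
  have "c f = 0" for f using 0 finite_faces unfolding chain_def by (cases "f \<in> faces") auto
  moreover have "c' f = 0" for f
  proof (rule ccontr)
    assume "c' f \<noteq> 0"
    then have "N (cmb c') > 0" using chain_face[OF 0(3)] by blast
    moreover have "cmb c = 0" using \<open>\<And>f. c f = 0\<close> by (rule cmb_zero)
    ultimately show False using 0(4) by (metis N_0 less_irrefl)
  qed
  ultimately show ?case by (simp add: fun_eq_iff)
next
  case (Suc n)
  have "\<exists>f1. c f1 \<noteq> 0"
  proof (rule ccontr)
    assume "\<not> ?thesis" then show False using Suc by simp
  qed
  then obtain f1 where f1: "c f1 \<noteq> 0" by auto
  note A = chain_face[OF Suc.prems(1) f1]
  have "\<exists>f1. c' f1 \<noteq> 0"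
  proof (rule ccontr)
    assume "\<not> ?thesis" then show False using A(5) Suc.prems(3) cmb_zero[of c'] by simp
  qed
  then obtain f2 where f2: "c' f2 \<noteq> 0" by auto
  note A' = chain_face[OF Suc.prems(2) f2]
  define f where "f = F (cmb c)"
  have f: "f \<in> faces" "c f > 0" "c' f > 0" using A A' Suc.prems(3) by (auto simp: f_def)
  let ?d = "c(f := c f - 1)" and ?d' = "c'(f := c' f - 1)"
  have e: "c = ?d(f := ?d f + 1)" "c' = ?d'(f := ?d' f + 1)" using f by (auto simp: fun_eq_iff)
  have "cmb c = cmb ?d + ray f" "cmb c' = cmb ?d' + ray f"
    using cmb_upd[OF f(1), of ?d 1] cmb_upd[OF f(1), of ?d' 1] e by auto
  then have cc: "cmb ?d = cmb ?d'" using Suc.prems(3) by simp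
  have "(\<Sum>g\<in>faces. c g) = (\<Sum>g\<in>faces. ?d g) + 1"
  proof -
    have "(\<Sum>g\<in>faces. c g) = (\<Sum>g\<in>faces. ?d g + (if g = f then 1 else 0))"
      using f by (intro sum.cong) auto
    then show ?thesis using f finite_faces by (simp add: sum.distrib)
  qed
  then have "n = (\<Sum>g\<in>faces. ?d g)" using Suc.hyps(2) by simp
  moreover have "chain ?d" "chain ?d'"
    by (rule chain_mono[OF Suc.prems(1)], use f in \<open>auto split: if_splits\<close>)
       (rule chain_mono[OF Suc.prems(2)], use f in \<open>auto split: if_splits\<close>)
  ultimately have "?d = ?d'" using Suc.hyps(1)[of ?d ?d'] cc by blast
  then show ?case using e by metis
qed

lemma N_zero_torsion: "N a = 0 \<Longrightarrow> zs m a = 0"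
proof -
  assume a: "N a = 0"
  have "lam b a = 0" if "b \<in> B" for b
    using Lam_abs[OF lam_Lam[OF that H_id], of a] a by simp
  then show ?thesis by (simp add: coords)
qed

text \<open>Projection from a barycentre: start at a and move against the ray of its own face until
  a further functional becomes maximal. The point reached lies on the boundary of the cone of a, has
  a larger set F and is decomposed by induction. Integrality is restored by the multiplier
  D.\<close>

lemma rational_cover: "\<exists>D>0. \<exists>c. chain c \<and> zs D a = cmb c \<and> (\<forall>f. c f \<noteq> 0 \<longrightarrow> F a \<subseteq> f)"
proof (induction "card (Lams - F a)" arbitrary: a rule: less_induct)
  case less
  show ?case
  proof (cases "N a = 0")
    case True
    then show ?thesis using N_zero_torsion m_pos
      by (intro exI[of _ m] conjI exI[of _ "\<lambda>_. 0"]) (auto simp: chain_def cmb_zero)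
  next
    case False
    then have pos: "N a > 0" using N_nonneg[of a] by auto
    define f where "f = F a"
    have f: "f \<in> faces" using pos by (auto simp: f_def faces_def)
    let ?b = "ray f"
    have Fb: "F ?b = f" and Nb: "N ?b = Mb" using ray f by auto
    have off: "N a - l a > 0" "Mb - l ?b > 0" if "l \<in> Lams - f" for l
    proof -
      have "l a \<noteq> N a" using that by (auto simp: f_def F_def)
      then show "N a - l a > 0" using that N_ge[of l a] by auto
      have "l \<notin> F ?b" using that Fb by auto
      then have "l ?b \<noteq> Mb" using that Nb by (auto simp: F_def)
      then show "Mb - l ?b > 0" using that N_ge[of l ?b] Nb by auto
    qed
    have on: "N a = l a" "Mb = l ?b" if "l \<in> f" for l
    proof -
      show "N a = l a" using that by (auto simp: f_def F_def)
      have "l \<in> F ?b" using that Fb by auto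
      then show "Mb = l ?b" using Nb by (auto simp: F_def)
    qed
    \<comment> \<open>The functional 0 is not maximal where N is positive, so the minimum below is
      taken over a nonempty set and the half-line does meet the boundary.\<close>
    have z: "(\<lambda>_. 0) \<in> Lams - f" using pos by (auto simp: f_def F_def Lams_def)
    \<comment> \<open>The parameter t at which l becomes maximal when t times \<open>ray f\<close>
      is subtracted from a.\<close>
    define rt where "rt l = rat_of_int (N a - l a) / rat_of_int (Mb - l ?b)" for l
    define l0 where "l0 = arg_min_on rt (Lams - f)"
    have "finite (Lams - f)" "Lams - f \<noteq> {}" using z finite_Lams by auto
    from arg_min_if_finite[OF this, of rt]
    have l0: "l0 \<in> Lams - f" "\<And>l. l \<in> Lams - f \<Longrightarrow> rt l0 \<le> rt l"
      unfolding l0_def by (auto simp: not_less)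
    define D where "D = Mb - l0 ?b"
    define k where "k = N a - l0 a"
    have Dk: "D > 0" "k > 0" using off[OF l0(1)] by (auto simp: D_def k_def)
    define a' where "a' = zs D a - zs k ?b"
    have la': "l a' = D * l a - k * l ?b" if "l \<in> Lams" for l
      using Lams_hom[OF that] by (simp add: a'_def add_hom_diff add_hom_zs zs_int)
    have ineq: "l a' \<le> D * N a - k * Mb" if "l \<in> Lams" for l
    proof (cases "l \<in> f")
      case True
      then show ?thesis using on[of l] la'[OF that] by simp
    next
      case False
      then have lf: "l \<in> Lams - f" using that by auto
      have "rt l0 \<le> rt l" using l0 lf by auto
      then have "rat_of_int k * rat_of_int (Mb - l ?b) \<le> rat_of_int D * rat_of_int (N a - l a)"
        unfolding rt_def D_def[symmetric] k_def[symmetric] using Dk off[OF lf] by (simp add: field_simps)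
      then have "k * (Mb - l ?b) \<le> D * (N a - l a)" by (simp only: of_int_mult[symmetric] of_int_le_iff)
      then show ?thesis using la'[OF that] by (simp add: algebra_simps)
    qed
    have eq0: "l0 a' = D * N a - k * Mb"
      using la'[of l0] l0 by (simp add: D_def k_def algebra_simps)
    have Na': "N a' = D * N a - k * Mb" using ineq eq0 l0 by (intro N_eqI[of _ _ l0]) auto
    have "f \<subseteq> F a'" unfolding F_def[of a'] using on la' faces_sub[OF f] Na' by auto
    moreover have "l0 \<in> F a'" using l0 eq0 Na' by (auto simp: F_def)
    ultimately have sub: "f \<subseteq> F a'" "l0 \<in> F a'" "l0 \<notin> f" using l0 by auto
    have "Lams - F a' \<subset> Lams - F a" using sub l0 by (auto simp: f_def)
    then have "card (Lams - F a') < card (Lams - F a)" using finite_Lams by (intro psubset_card_mono) auto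
    then obtain D' c where c: "D' > 0" "chain c" "zs D' a' = cmb c" "\<And>g. c g \<noteq> 0 \<Longrightarrow> F a' \<subseteq> g"
      using less[of a'] by blast
    \<comment> \<open>Every face set in the support of c contains l0 and f does not, so f is a new
      member of the flag, below all others.\<close>
    have cf: "c f = 0" using c(4)[of f] sub by auto
    let ?c = "c(f := c f + nat (D' * k))"
    have "zs (D' * D) a = zs D' (a' + zs k ?b)" by (simp add: a'_def)
    also have "\<dots> = cmb c + zs (D' * k) ?b" using c by (simp add: ZM.scale_right_distrib)
    also have "\<dots> = cmb ?c" using cmb_upd[OF f, of c "nat (D' * k)"] c Dk by simp
    finally have z: "zs (D' * D) a = cmb ?c" .
    have "chain ?c" using c(2,4) f sub cf by (auto simp: chain_def split: if_splits)
    moreover have "\<forall>g. ?c g \<noteq> 0 \<longrightarrow> F a \<subseteq> g" using c(4) sub by (auto simp: f_def split: if_splits)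
    moreover have "D' * D > 0" using c Dk by simp
    ultimately show ?thesis using z by blast
  qed
qed

definition rems :: "'a set" where "rems = {a. N a \<le> int (card faces) * Mb}"

lemma finite_rems: "finite rems"
proof -
  let ?C = "int (card faces) * Mb"
  let ?K = "(\<lambda>c. \<Sum>b\<in>B. zs (c b) b) ` {c. \<forall>b\<in>B. \<bar>c b\<bar> \<le> ?C}"
  have "rems \<subseteq> {a. zs m a \<in> ?K}"
  proof
    fix a assume "a \<in> rems"
    then have "\<bar>lam b a\<bar> \<le> ?C" if "b \<in> B" for b
      using Lam_abs[OF lam_Lam[OF that H_id], of a] by (simp add: rems_def)
    then have "zs m a \<in> ?K" unfolding coords by (intro image_eqI[of _ _ "\<lambda>b. lam b a"]) auto
    then show "a \<in> {a. zs m a \<in> ?K}" by simp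
  qed
  moreover have "finite {a. zs m a \<in> ?K}"
    by (rule finite_zs_preimage[OF m_pos finite_bounded_combos[OF finB]])
  ultimately show ?thesis by (rule finite_subset)
qed

lemma rems_act: "\<eta> \<in> H \<Longrightarrow> a \<in> rems \<Longrightarrow> \<eta> a \<in> rems"
  using N_act by (simp add: rems_def)

text \<open>Division of the coefficients by D with remainder. The remainder of \<open>zs D a\<close>
  has coefficients below D, so its height is at most D times the bound in \<open>rems\<close>; it
  equals D times the part of a that is left over.\<close>

lemma cover: "\<exists>c. chain c \<and> a - cmb c \<in> rems"
proof -
  obtain D c where c: "D > 0" "chain c" "zs D a = cmb c" using rational_cover[of a] by blast
  define n where "n = nat D"
  have n: "D = int n" "n > 0" using c by (auto simp: n_def)
  let ?q = "\<lambda>f. c f div n" and ?r = "\<lambda>f. c f mod n"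
  have q: "chain ?q" "chain ?r" by (rule chain_mono[OF c(2)], auto intro: ccontr)+ 
  have "cmb c = zs D (cmb ?q) + cmb ?r"
    unfolding cmb_def ZM.scale_sum_right sum.distrib[symmetric] ZM.scale_scale ZM.scale_left_distrib[symmetric] n
    by (intro sum.cong refl arg_cong2[of _ _ _ _ zs]) (simp flip: of_nat_mult of_nat_add)
  then have r: "zs D (a - cmb ?q) = cmb ?r" using c by (simp add: ZM.scale_right_diff_distrib)
  have "N (cmb ?r) \<le> Mb * (int (card faces) * D)"
  proof (cases "\<exists>f. ?r f \<noteq> 0")
    case True
    have "(\<Sum>f\<in>faces. ?r f) \<le> (\<Sum>f\<in>faces. n)" using n by (intro sum_mono) (simp add: less_imp_le)
    then have "(\<Sum>f\<in>faces. ?r f) \<le> card faces * n" by simp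
    then have "int (\<Sum>f\<in>faces. ?r f) \<le> int (card faces) * D" by (metis n(1) of_nat_le_iff of_nat_mult)
    then show ?thesis using True chain_face(1)[OF q(2)] Mb_pos by (metis mult_le_cancel_left_pos)
  next
    case False
    then have "cmb ?r = 0" by (intro cmb_zero) auto
    then show ?thesis using Mb_pos c by simp
  qed
  moreover have "N (cmb ?r) = D * N (a - cmb ?q)" using r N_zs[OF c(1)] by metis
  ultimately have "D * N (a - cmb ?q) \<le> D * (int (card faces) * Mb)" by (simp add: ac_simps)
  then have "a - cmb ?q \<in> rems" using c(1) by (simp add: rems_def)
  then show ?thesis using q by blast
qed

lemma cmb_act:
  assumes h: "\<eta> \<in> H"
  shows "\<eta> (cmb c) = cmb (\<lambda>f. c (hF (hinv \<eta>) f))"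
proof -
  have "\<eta> (cmb c) = (\<Sum>f\<in>faces. zs (int (c f)) (ray (hF \<eta> f)))"
    unfolding cmb_def add_hom_sum[OF H_hom[OF h]] add_hom_zs[OF H_hom[OF h]]
    using ray_act h by (intro sum.cong refl) auto
  also have "\<dots> = cmb (\<lambda>f. c (hF (hinv \<eta>) f))" unfolding cmb_def
    by (rule sum.reindex_bij_witness[where i = "hF (hinv \<eta>)" and j = "hF \<eta>"])
       (use h hF_inv hF_faces H_inv in auto)
  finally show ?thesis .
qed

lemma chain_act:
  assumes h: "\<eta> \<in> H" and c: "chain c"
  shows "chain (\<lambda>f. if f \<in> faces then c (hF (hinv \<eta>) f) else 0)"
proof -
  have "f \<subseteq> g \<or> g \<subseteq> f" if "f \<in> faces" "g \<in> faces" "c (hF (hinv \<eta>) f) \<noteq> 0" "c (hF (hinv \<eta>) g) \<noteq> 0" for f g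
  proof -
    have "hF (hinv \<eta>) f \<subseteq> hF (hinv \<eta>) g \<or> hF (hinv \<eta>) g \<subseteq> hF (hinv \<eta>) f"
      using c that by (simp add: chain_def)
    then show ?thesis using hF_mono[of _ _ \<eta>] hF_inv[OF h] that by metis
  qed
  then show ?thesis by (auto simp: chain_def)
qed

text \<open>By Dickson's lemma, pairs of chain combinations with prescribed difference s arise from finitely
  many minimal pairs by adding a pair of combinations with equal values, and such a pair is diagonal by uniqueness.\<close>

lemma chain_close:
  assumes "finite S"
  shows "\<exists>C. \<forall>c c'. chain c \<longrightarrow> chain c' \<longrightarrow> cmb c - cmb c' \<in> S \<longrightarrow> (\<forall>f. \<bar>int (c f) - int (c' f)\<bar> \<le> C)"
proof -
  let ?I = "faces <+> faces"
  let ?pr = "\<lambda>(p::('a \<Rightarrow> int) set + ('a \<Rightarrow> int) set \<Rightarrow> nat). chain (p \<circ> Inl) \<and> chain (p \<circ> Inr)"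
  have one: "\<exists>C. \<forall>c c'. chain c \<longrightarrow> chain c' \<longrightarrow> cmb c - cmb c' = s \<longrightarrow> (\<forall>f. \<bar>int (c f) - int (c' f)\<bar> \<le> C)" for s
  proof -
    define Q where "Q = {p. ?pr p \<and> cmb (p \<circ> Inl) - cmb (p \<circ> Inr) = s}"
    obtain T where T: "T \<subseteq> Q" "finite T" "\<forall>p\<in>Q. \<exists>t\<in>T. \<forall>i\<in>?I. t i \<le> p i"
      using dickson[of ?I Q] finite_faces by auto
    define C where "C = Max (insert 0 ((\<lambda>(t, f). \<bar>int (t (Inl f)) - int (t (Inr f))\<bar>) ` (T \<times> faces)))"
    have C: "\<bar>int (t (Inl f)) - int (t (Inr f))\<bar> \<le> C" if "t \<in> T" "f \<in> faces" for t f
      unfolding C_def using T finite_faces that by (intro Max_ge) auto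
    have C0: "0 \<le> C" unfolding C_def using T finite_faces by (intro Max_ge) auto
    have "\<bar>int (c f) - int (c' f)\<bar> \<le> C" if c: "chain c" "chain c'" "cmb c - cmb c' = s" for c c' f
    proof (cases "f \<in> faces")
      case False
      then have "c f = 0" "c' f = 0" using c unfolding chain_def by auto
      then show ?thesis using C0 by simp
    next
      case True
      have oi: "case_sum c c' \<circ> Inl = c" "case_sum c c' \<circ> Inr = c'" by (auto simp: fun_eq_iff)
      have "case_sum c c' \<in> Q" unfolding Q_def using c oi by simp
      then obtain t where t: "t \<in> T" "\<forall>i\<in>?I. t i \<le> case_sum c c' i" using T by blast
      define d where "d = t \<circ> Inl"
      define d' where "d' = t \<circ> Inr"
      have d: "chain d" "chain d'" "cmb d - cmb d' = s" using t T(1) by (auto simp: Q_def d_def d'_def)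
      have le: "d g \<le> c g" "d' g \<le> c' g" for g
      proof -
        have "d g \<le> c g \<and> d' g \<le> c' g"
        proof (cases "g \<in> faces")
          case True
          then show ?thesis using t(2)[rule_format, of "Inl g"] t(2)[rule_format, of "Inr g"]
            by (auto simp: d_def d'_def)
        next
          case False
          then have "d g = 0" "d' g = 0" using d unfolding chain_def by auto
          then show ?thesis by simp
        qed
        then show "d g \<le> c g" "d' g \<le> c' g" by auto
      qed
      have sub: "cmb (\<lambda>g. c g - d g) = cmb c - cmb d" "cmb (\<lambda>g. c' g - d' g) = cmb c' - cmb d'"
        unfolding cmb_def sum_subtractf[symmetric] ZM.scale_left_diff_distrib[symmetric]
        using le by (intro sum.cong refl, simp add: of_nat_diff)+
      have "(\<lambda>g. c g - d g) = (\<lambda>g. c' g - d' g)"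
      proof (rule chain_unique)
        show "chain (\<lambda>g. c g - d g)" by (rule chain_mono[OF c(1)]) simp
        show "chain (\<lambda>g. c' g - d' g)" by (rule chain_mono[OF c(2)]) simp
        show "cmb (\<lambda>g. c g - d g) = cmb (\<lambda>g. c' g - d' g)" unfolding sub using c(3) d(3)
          by (simp add: algebra_simps)
      qed
      then have "c f - d f = c' f - d' f" by meson
      then have "int (c f) - int (c' f) = int (d f) - int (d' f)" using le(1)[of f] le(2)[of f] by linarith
      then show ?thesis using C[OF t(1) True] by (simp add: d_def d'_def)
    qed
    then show ?thesis by blast
  qed
  then obtain C where C: "\<And>s c c' f. chain c \<Longrightarrow> chain c' \<Longrightarrow> cmb c - cmb c' = s \<Longrightarrow> \<bar>int (c f) - int (c' f)\<bar> \<le> C s" by metis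
  have "\<bar>int (c f) - int (c' f)\<bar> \<le> Max (insert 0 (C ` S))" if "chain c" "chain c'" "cmb c - cmb c' \<in> S" for c c' f
  proof -
    have "C (cmb c - cmb c') \<le> Max (insert 0 (C ` S))" using assms that(3) by (intro Max_ge) auto
    then show ?thesis using C[OF that(1,2) refl, of f] by linarith
  qed
  then show ?thesis by blast
qed

definition trunc :: "(('a \<Rightarrow> int) set \<Rightarrow> nat) \<Rightarrow> nat \<Rightarrow> 'a" where
  "trunc c j = cmb (\<lambda>f. min (c f) j)"

text \<open>An element of H permutes the coefficients of a chain combination. By
  \<open>chain_close\<close> the coefficients of two combinations with close values differ by a
  bounded amount, and cutting off at nearby times j and j' preserves this because the minimum is
  Lipschitz in both arguments.\<close>

lemma trunc_fellow:
  assumes "finite S"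
  shows "finite {\<eta> (trunc c j) - trunc c' j' | \<eta> c c' j j'. \<eta> \<in> H \<and> chain c \<and> chain c' \<and>
     \<eta> (cmb c) - cmb c' \<in> S \<and> j \<le> j' + k \<and> j' \<le> j + k}" (is "finite ?X")
proof -
  obtain C where C: "\<And>c c' f. chain c \<Longrightarrow> chain c' \<Longrightarrow> cmb c - cmb c' \<in> S \<Longrightarrow> \<bar>int (c f) - int (c' f)\<bar> \<le> C"
    using chain_close[OF assms] by metis
  let ?K = "(\<lambda>c. \<Sum>f\<in>faces. zs (c f) (ray f)) ` {c. \<forall>f\<in>faces. \<bar>c f\<bar> \<le> C + int k}"
  have "?X \<subseteq> ?K"
  proof
    fix x assume "x \<in> ?X"
    then obtain \<eta> c c' j j' where x: "x = \<eta> (trunc c j) - trunc c' j'" "\<eta> \<in> H" "chain c" "chain c'"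
      "\<eta> (cmb c) - cmb c' \<in> S" "j \<le> j' + k" "j' \<le> j + k" by auto
    define e where "e f = (if f \<in> faces then c (hF (hinv \<eta>) f) else 0)" for f
    have e: "chain e" unfolding e_def by (rule chain_act[OF x(2,3)])
    have e1: "\<eta> (cmb c) = cmb e" unfolding cmb_act[OF x(2)] unfolding cmb_def e_def by (intro sum.cong) auto
    have e2: "\<eta> (trunc c j) = cmb (\<lambda>f. min (e f) j)"
    proof -
      have "\<eta> (trunc c j) = cmb (\<lambda>f. min (c (hF (hinv \<eta>) f)) j)" unfolding trunc_def by (rule cmb_act[OF x(2)])
      also have "\<dots> = cmb (\<lambda>f. min (e f) j)" unfolding cmb_def e_def by (intro sum.cong) auto
      finally show ?thesis .
    qed
    have b: "\<bar>int (e f) - int (c' f)\<bar> \<le> C" for f using C[OF e x(4)] x(5) e1 by simp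
    have "x = (\<Sum>f\<in>faces. zs (int (min (e f) j) - int (min (c' f) j')) (ray f))"
      unfolding x(1) e2 unfolding trunc_def cmb_def by (simp add: ZM.scale_left_diff_distrib sum_subtractf)
    moreover have "\<bar>int (min (e f) j) - int (min (c' f) j')\<bar> \<le> C + int k" for f
      using b[of f] x(6,7) by linarith
    ultimately show "x \<in> ?K" by (intro image_eqI[of _ _ "\<lambda>f. int (min (e f) j) - int (min (c' f) j')"]) auto
  qed
  then show ?thesis using finite_bounded_combos[OF finite_faces] by (rule finite_subset)
qed

end

section \<open>Regular languages and Cayley graphs\<close>

text \<open>The residuals of L, that is, its Myhill-Nerode classes.\<close>

definition derivs :: "'x list set \<Rightarrow> 'x list set set" where
  "derivs L = range (\<lambda>u. {z. u @ z \<in> L})"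

text \<open>The residuals themselves serve as states of the automaton; the injection f codes them as
  natural numbers, which \<open>regular_lang\<close> demands.\<close>

lemma regular_langI:
  assumes L: "L \<subseteq> lists X" and fin: "finite (derivs L)"
  shows "regular_lang X L"
proof -
  obtain f :: "'a list set \<Rightarrow> nat" where f: "inj_on f (derivs L)"
    using finite_imp_inj_to_nat_seg[OF fin] by blast
  define g where "g = the_inv_into (derivs L) f"
  have gf: "g (f D) = D" if "D \<in> derivs L" for D unfolding g_def using the_inv_into_f_f[OF f that] .
  define \<delta> where "\<delta> q x = f {z. x # z \<in> g q}" for q x
  let ?D = "\<lambda>u. {z. u @ z \<in> L}"
  have D: "?D u \<in> derivs L" for u by (simp add: derivs_def)
  have step: "\<delta> (f (?D u)) x = f (?D (u @ [x]))" for u x by (simp add: \<delta>_def gf[OF D])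
  have run: "fold (\<lambda>x q. \<delta> q x) w (f (?D u)) = f (?D (u @ w))" for u w
    by (induction w arbitrary: u) (simp_all only: fold_simps step append_Nil2, simp)
  let ?Q = "f ` derivs L" and ?F = "{q \<in> f ` derivs L. [] \<in> g q}"
  show ?thesis unfolding regular_lang_def
  proof (intro exI conjI ballI)
    show "finite ?Q" using fin by simp
    show "f (?D []) \<in> ?Q" using D by blast
    show "\<delta> q x \<in> ?Q" if q: "q \<in> ?Q" for q x
    proof -
      obtain u where "q = f (?D u)" using q by (auto simp: derivs_def)
      then have "\<delta> q x = f (?D (u @ [x]))" using step by simp
      then show ?thesis using D[of "u @ [x]"] by (simp only: imageI)
    qed
    show "?F \<subseteq> ?Q" by auto
    show "L = {w \<in> lists X. fold (\<lambda>x q. \<delta> q x) w (f (?D [])) \<in> ?F}"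
    proof -
      have "w \<in> L \<longleftrightarrow> fold (\<lambda>x q. \<delta> q x) w (f (?D [])) \<in> ?F" for w
      proof -
        have "fold (\<lambda>x q. \<delta> q x) w (f (?D [])) = f (?D w)" using run[of w "[]"] by simp
        moreover have "f (?D w) \<in> ?Q" using D by (rule imageI)
        ultimately show ?thesis using gf[OF D[of w]] by simp
      qed
      then show ?thesis using L by blast
    qed
  qed
qed

text \<open>The invariant g has to determine the residual only on the set P of possible prefixes;
  every other word has the empty residual.\<close>

lemma finite_derivsI:
  assumes fin: "finite (g ` P)"
    and out: "\<And>u z. u @ z \<in> L \<Longrightarrow> u \<in> P"
    and eq: "\<And>u v z. u \<in> P \<Longrightarrow> v \<in> P \<Longrightarrow> g u = g v \<Longrightarrow> u @ z \<in> L \<Longrightarrow> v @ z \<in> L"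
  shows "finite (derivs L)"
proof -
  let ?D = "\<lambda>u. {z. u @ z \<in> L}"
  define h where "h s = ?D (SOME u. u \<in> P \<and> g u = s)" for s
  have "?D u \<in> insert {} (h ` g ` P)" for u
  proof (cases "u \<in> P")
    case True
    define v where "v = (SOME v. v \<in> P \<and> g v = g u)"
    have v: "v \<in> P \<and> g v = g u" unfolding v_def by (rule someI[of _ u]) (simp add: True)
    have "?D u = h (g u)" unfolding h_def v_def[symmetric] using eq[of u v] eq[of v u] v True by auto
    then show ?thesis using True by auto
  next
    case False
    then have "?D u = {}" using out by auto
    then show ?thesis by simp
  qed
  then have "derivs L \<subseteq> insert {} (h ` g ` P)" unfolding derivs_def by (rule image_subsetI)
  then show ?thesis by (rule finite_subset) (use fin in simp)
qed

definition conc :: "'x list set \<Rightarrow> 'x list set \<Rightarrow> 'x list set" where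
  "conc L1 L2 = {a @ b | a b. a \<in> L1 \<and> b \<in> L2}"

text \<open>The subset construction: remember the residual of L1 and, for each prefix of u that lies
  in L1, the residual of L2 after the rest of u.\<close>

lemma finite_derivs_conc:
  assumes "finite (derivs L1)" "finite (derivs L2)"
  shows "finite (derivs (conc L1 L2))"
proof (rule finite_derivsI[where P = UNIV
      and g = "\<lambda>u. ({z. u @ z \<in> L1}, {{z. us @ z \<in> L2} | a us. u = a @ us \<and> a \<in> L1})"])
  let ?g = "\<lambda>u. ({z. u @ z \<in> L1}, {{z. us @ z \<in> L2} | a us. u = a @ us \<and> a \<in> L1})"
  have "range ?g \<subseteq> derivs L1 \<times> Pow (derivs L2)" by (auto simp: derivs_def)
  then show "finite (range ?g)" by (rule finite_subset) (use assms in simp)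
  fix u v z assume e: "?g u = ?g v" and "u @ z \<in> conc L1 L2"
  then obtain a b where ab: "u @ z = a @ b" "a \<in> L1" "b \<in> L2" by (auto simp: conc_def)
  then obtain us where "(u = a @ us \<and> us @ z = b) \<or> (u @ us = a \<and> z = us @ b)"
    using append_eq_append_conv2[of u z a b] by blast
  then show "v @ z \<in> conc L1 L2"
  proof
    assume h: "u = a @ us \<and> us @ z = b"
    then have "{z. us @ z \<in> L2} \<in> snd (?g u)" using ab by auto
    then have "{z. us @ z \<in> L2} \<in> snd (?g v)" using e by (simp only:)
    then obtain a' us' where "{z. us @ z \<in> L2} = {z. us' @ z \<in> L2}" "v = a' @ us'" "a' \<in> L1" by auto
    moreover then have "us' @ z \<in> L2" using h ab by auto
    ultimately show ?thesis by (auto simp: conc_def)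
  next
    assume h: "u @ us = a \<and> z = us @ b"
    then have "v @ us \<in> L1" using e ab by auto
    then show ?thesis using h ab unfolding conc_def by (auto intro: exI[of _ "v @ us"])
  qed
qed auto

lemma finite_derivs_finite: "finite L \<Longrightarrow> finite (derivs L)"
proof -
  assume L: "finite L"
  let ?P = "\<Union>w\<in>L. (\<lambda>n. take n w) ` {..length w}"
  have fin: "finite ?P" using L by auto
  have "u \<in> ?P" if "u @ z \<in> L" for u z
    by (rule UN_I[OF that], rule image_eqI[of _ _ "length u"]) auto
  then show ?thesis using fin by (intro finite_derivsI[where g = "\<lambda>u. u" and P = ?P]) simp_all
qed

section \<open>Closed local geodesics in a hyperbolic space\<close>

context geodesic_space begin

text \<open>Look at the point p of the loop that is farthest from the start, and at the points
  \<open>2 * \<delta> + 1\<close> steps before and after it. The piece between these is a geodesic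
  of length \<open>4 * \<delta> + 2\<close>; slimness puts p within \<open>\<delta>\<close> of a
  geodesic from the start to one of the two, which would then be farther away than p.\<close>

lemma local_geodesic_loop:
  assumes sl: "slim \<delta>" and cP: "\<And>i. i \<le> n \<Longrightarrow> c i \<in> P" and loop: "c 0 = c n"
    and loc: "\<And>i j. i \<le> j \<Longrightarrow> j \<le> n \<Longrightarrow> j - i \<le> 4 * \<delta> + 2 \<Longrightarrow> d (c i) (c j) = j - i"
  shows "n = 0"
proof (rule ccontr)
  assume n0: "n \<noteq> 0"
  define k where "k = arg_max_on (\<lambda>i. d (c 0) (c i)) {..n}"
  have k: "k \<le> n" "\<And>i. i \<le> n \<Longrightarrow> d (c 0) (c i) \<le> d (c 0) (c k)"
  proof -
    have "\<exists>k\<le>n. \<forall>i\<le>n. d (c 0) (c i) \<le> d (c 0) (c k)"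
      using ex_has_greatest_nat[of "\<lambda>i. i \<le> n" 0 "\<lambda>i. d (c 0) (c i)" "Suc (Max ((\<lambda>i. d (c 0) (c i)) ` {..n}))"]
      by (auto simp: less_Suc_eq_le)
    then have "\<exists>k. is_arg_max (\<lambda>i. d (c 0) (c i)) (\<lambda>x. x \<in> {..n}) k" by (auto simp: is_arg_max_linorder)
    then have "is_arg_max (\<lambda>i. d (c 0) (c i)) (\<lambda>x. x \<in> {..n}) k" unfolding k_def arg_max_on_def arg_max_def by (rule someI_ex)
    then show "k \<le> n" "\<And>i. i \<le> n \<Longrightarrow> d (c 0) (c i) \<le> d (c 0) (c k)" by (auto simp: is_arg_max_linorder)
  qed
  have n_big: "\<not> n \<le> 4 * \<delta> + 2"
    using loc[of 0 n] n0 loop d_refl[OF cP[of 0]] by auto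
  have "d (c 0) (c (2 * \<delta> + 1)) = 2 * \<delta> + 1" using loc[of 0 "2 * \<delta> + 1"] n_big by auto
  then have far: "2 * \<delta> + 1 \<le> d (c 0) (c k)" using k(2)[of "2 * \<delta> + 1"] n_big by auto
  have k1: "2 * \<delta> + 1 \<le> k" using loc[of 0 k] k(1) far by (cases "k \<le> 4 * \<delta> + 2") auto
  have k2: "k + (2 * \<delta> + 1) \<le> n"
  proof (rule ccontr)
    assume a: "\<not> ?thesis"
    then have "d (c k) (c n) = n - k" using loc[of k n] k(1) by auto
    then show False using a far loop d_sym[of "c 0" "c k"] cP k(1) by auto
  qed
  let ?y = "c (k - (2 * \<delta> + 1))" and ?z = "c (k + (2 * \<delta> + 1))" and ?p = "c k"
  have P: "?y \<in> P" "?z \<in> P" "?p \<in> P" "c 0 \<in> P" using cP k(1) k2 by auto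
  have dy: "d ?y ?p = 2 * \<delta> + 1" using loc[of "k - (2 * \<delta> + 1)" k] k1 k(1) by auto
  have dz: "d ?p ?z = 2 * \<delta> + 1" using loc[of k "k + (2 * \<delta> + 1)"] k2 by auto
  have dyz: "d ?y ?z = 4 * \<delta> + 2" using loc[of "k - (2 * \<delta> + 1)" "k + (2 * \<delta> + 1)"] k1 k2 by auto
  have "?p \<in> ival ?y ?z" using P dy dz dyz by (auto simp: ival_def)
  then obtain q where q: "q \<in> ival ?y (c 0) \<or> q \<in> ival (c 0) ?z" "d ?p q \<le> \<delta>" "q \<in> P"
    using slimD[OF sl P(1,2,4)] by metis
  have no: False if u: "u \<in> P" "d (c 0) q + d q u = d (c 0) u" "d u ?p = 2 * \<delta> + 1" "d (c 0) u \<le> d (c 0) ?p" for u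
  proof -
    have "d u ?p \<le> d u q + d q ?p" "d (c 0) ?p \<le> d (c 0) q + d q ?p" using d_tri[OF u(1) q(3) P(3)] d_tri[OF P(4) q(3) P(3)] by auto
    moreover have "d q ?p = d ?p q" "d u q = d q u" using d_sym u P q by auto
    ultimately show False using u q by linarith
  qed
  show False using q(1)
  proof
    assume "q \<in> ival ?y (c 0)"
    then have "d ?y q + d q (c 0) = d ?y (c 0)" using ivalD by auto
    moreover have "d ?y q = d q ?y" "d q (c 0) = d (c 0) q" "d ?y (c 0) = d (c 0) ?y" using d_sym P q by auto
    ultimately show False using no[of ?y] P dy k(2)[of "k - (2 * \<delta> + 1)"] k(1) by auto
  next
    assume "q \<in> ival (c 0) ?z"
    then have "d (c 0) q + d q ?z = d (c 0) ?z" using ivalD by auto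
    moreover have "d ?z ?p = d ?p ?z" using d_sym P by auto
    ultimately show False using no[of ?z] P dz k(2)[of "k + (2 * \<delta> + 1)"] k2 by auto
  qed
qed

end

section \<open>Word metrics and Cayley graphs\<close>

context group begin

lemma word_eval_Nil [simp]: "word_eval G [] = \<one>" by (simp add: word_eval_def)
lemma word_eval_Cons [simp]: "word_eval G (x # w) = x \<otimes> word_eval G w" by (simp add: word_eval_def)

lemma word_eval_closed [simp]: "set w \<subseteq> carrier G \<Longrightarrow> word_eval G w \<in> carrier G"
  by (induction w) auto

lemma word_eval_append: "set u \<subseteq> carrier G \<Longrightarrow> set v \<subseteq> carrier G \<Longrightarrow> word_eval G (u @ v) = word_eval G u \<otimes> word_eval G v"
  by (induction u) (auto simp: m_assoc)

end

locale cayley = group G for G :: "('g, 'm) monoid_scheme" (structure) +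
  fixes X :: "'g set"
  assumes gen: "fin_sym_gen G X"
begin

abbreviation ln :: "'g \<Rightarrow> nat" where "ln \<equiv> word_len G X"
abbreviation dd :: "'g \<Rightarrow> 'g \<Rightarrow> nat" where "dd \<equiv> word_dist G X"
abbreviation ev :: "'g list \<Rightarrow> 'g" where "ev \<equiv> word_eval G"

lemma finX: "finite X" and X_sub: "X \<subseteq> carrier G" and X_inv: "x \<in> X \<Longrightarrow> inv x \<in> X"
  and X_gen: "g \<in> carrier G \<Longrightarrow> \<exists>w\<in>lists X. ev w = g"
  using gen by (auto simp: fin_sym_gen_def)

lemma lists_sub: "w \<in> lists X \<Longrightarrow> set w \<subseteq> carrier G" using X_sub by (auto simp: in_lists_conv_set)

lemma ev_closed [simp]: "w \<in> lists X \<Longrightarrow> ev w \<in> carrier G" using lists_sub by simp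

lemma ev_append: "u \<in> lists X \<Longrightarrow> v \<in> lists X \<Longrightarrow> ev (u @ v) = ev u \<otimes> ev v"
  using lists_sub word_eval_append by simp

lemma ln_word: "g \<in> carrier G \<Longrightarrow> \<exists>w\<in>lists X. length w = ln g \<and> ev w = g"
proof -
  assume "g \<in> carrier G"
  then have "\<exists>n. \<exists>w\<in>lists X. length w = n \<and> ev w = g" using X_gen by blast
  then show ?thesis unfolding word_len_def by (rule LeastI_ex)
qed

lemma ln_le: "w \<in> lists X \<Longrightarrow> ln (ev w) \<le> length w"
  unfolding word_len_def by (rule Least_le) auto

lemma ln_one [simp]: "ln \<one> = 0" using ln_le[of "[]"] by simp

lemma ln_eq_0: "g \<in> carrier G \<Longrightarrow> ln g = 0 \<Longrightarrow> g = \<one>" using ln_word[of g] by auto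

lemma ln_mult: "g \<in> carrier G \<Longrightarrow> h \<in> carrier G \<Longrightarrow> ln (g \<otimes> h) \<le> ln g + ln h"
proof -
  assume "g \<in> carrier G" "h \<in> carrier G"
  then obtain u v where "u \<in> lists X" "length u = ln g" "ev u = g" "v \<in> lists X" "length v = ln h" "ev v = h"
    using ln_word by meson
  then show ?thesis using ln_le[of "u @ v"] ev_append by auto
qed

lemma ln_gen: "x \<in> X \<Longrightarrow> ln x \<le> 1" using ln_le[of "[x]"] X_sub by auto

definition winv :: "'g list \<Rightarrow> 'g list" where "winv w = rev (map (\<lambda>x. inv x) w)"

lemma winv: "w \<in> lists X \<Longrightarrow> winv w \<in> lists X" "length (winv w) = length w"
  unfolding winv_def using X_inv by (auto simp: in_lists_conv_set)

lemma ev_winv: "w \<in> lists X \<Longrightarrow> ev (winv w) = inv (ev w)"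
proof (induction w)
  case (Cons x w)
  then have x: "x \<in> X" "w \<in> lists X" by auto
  have "winv (x # w) = winv w @ [inv x]" by (simp add: winv_def)
  moreover have "x \<in> carrier G" "ev w \<in> carrier G" "[inv x] \<in> lists X" using x X_sub X_inv by auto
  ultimately show ?case using Cons.IH[OF x(2)] winv(1)[OF x(2)] by (simp add: ev_append inv_mult_group)
qed (simp add: winv_def)

lemma ln_inv: "g \<in> carrier G \<Longrightarrow> ln (inv g) = ln g"
proof -
  have le: "ln (inv g) \<le> ln g" if g: "g \<in> carrier G" for g
  proof -
    obtain w where "w \<in> lists X" "length w = ln g" "ev w = g" using ln_word g by blast
    then show ?thesis using ln_le[of "winv w"] winv ev_winv by fastforce
  qed
  assume g: "g \<in> carrier G"
  show ?thesis using le[OF g] le[of "inv g"] g by simp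
qed

lemma dd_left: "k \<in> carrier G \<Longrightarrow> g \<in> carrier G \<Longrightarrow> h \<in> carrier G \<Longrightarrow> dd (k \<otimes> g) (k \<otimes> h) = dd g h"
  unfolding word_dist_def by (simp add: inv_mult_group m_assoc) (metis inv_closed l_inv l_one m_assoc)

lemma dd_one: "g \<in> carrier G \<Longrightarrow> dd \<one> g = ln g" by (simp add: word_dist_def)

lemma dd_mult: "g \<in> carrier G \<Longrightarrow> h \<in> carrier G \<Longrightarrow> dd g (g \<otimes> h) = ln h"
  unfolding word_dist_def by (simp add: m_assoc[symmetric])

lemma inv_solve: "g \<in> carrier G \<Longrightarrow> h \<in> carrier G \<Longrightarrow> g \<otimes> (inv g \<otimes> h) = h"
  by (simp add: m_assoc[symmetric])

sublocale gs: geodesic_space "carrier G" dd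
proof
  fix a b c t assume a: "a \<in> carrier G"
  show "dd a a = 0" using a by (simp add: word_dist_def)
  assume b: "b \<in> carrier G"
  show "dd a b = 0 \<Longrightarrow> a = b"
    using ln_eq_0[of "inv a \<otimes> b"] a b by (simp add: word_dist_def) (metis inv_solve r_one)
  show "dd a b = dd b a" using ln_inv[of "inv a \<otimes> b"] a b by (simp add: word_dist_def inv_mult_group)
  show "t \<le> dd a b \<Longrightarrow> \<exists>q\<in>carrier G. dd a q = t \<and> dd q b = dd a b - t"
  proof -
    assume t: "t \<le> dd a b"
    obtain w where w: "w \<in> lists X" "length w = ln (inv a \<otimes> b)" "ev w = inv a \<otimes> b" using ln_word[of "inv a \<otimes> b"] a b by auto
    have wl: "length w = dd a b" using w by (simp add: word_dist_def)
    have tk: "take t w \<in> lists X" "drop t w \<in> lists X" using w by (auto simp: in_lists_conv_set dest: in_set_takeD in_set_dropD)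
    have e: "ev (take t w) \<otimes> ev (drop t w) = inv a \<otimes> b"
      using ev_append[OF tk] unfolding append_take_drop_id w(3) by (rule sym)
    let ?q = "a \<otimes> ev (take t w)"
    have q: "?q \<in> carrier G" using a tk by simp
    have b': "b = ?q \<otimes> ev (drop t w)" using e a b tk by (simp add: m_assoc inv_solve)
    have l1: "dd a ?q \<le> t" using dd_mult[OF a ev_closed[OF tk(1)]] ln_le[OF tk(1)] by simp
    have "dd ?q b = ln (ev (drop t w))" using dd_mult[OF q ev_closed[OF tk(2)]] unfolding b'[symmetric] .
    then have l2: "dd ?q b \<le> dd a b - t" using ln_le[OF tk(2)] unfolding length_drop wl by (rule ord_eq_le_trans)
    have "dd a b \<le> dd a ?q + dd ?q b"
    proof -
      have "inv a \<otimes> b = (inv a \<otimes> ?q) \<otimes> (inv ?q \<otimes> b)" using a b q by (metis inv_closed inv_solve m_assoc m_closed)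
      then show ?thesis unfolding word_dist_def using ln_mult[of "inv a \<otimes> ?q" "inv ?q \<otimes> b"] a b q by simp
    qed
    then have "dd a ?q = t" "dd ?q b = dd a b - t" using l1 l2 t by auto
    then show ?thesis using q by blast
  qed
  assume c: "c \<in> carrier G"
  have "inv a \<otimes> c = (inv a \<otimes> b) \<otimes> (inv b \<otimes> c)" using a b c by (metis inv_closed inv_solve m_assoc m_closed)
  then show "dd a c \<le> dd a b + dd b c" unfolding word_dist_def using ln_mult[of "inv a \<otimes> b" "inv b \<otimes> c"] a b c by simp
qed

lemma finite_ball: "finite {g \<in> carrier G. ln g \<le> n}"
proof -
  have "{g \<in> carrier G. ln g \<le> n} \<subseteq> ev ` {w. set w \<subseteq> X \<and> length w \<le> n}"
  proof
    fix g assume "g \<in> {g \<in> carrier G. ln g \<le> n}"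
    then obtain w where "w \<in> lists X" "length w \<le> n" "ev w = g" using ln_word by fastforce
    then show "g \<in> ev ` {w. set w \<subseteq> X \<and> length w \<le> n}" by auto
  qed
  then show ?thesis using finite_lists_length_le[OF finX] by (rule finite_subset[OF _ finite_imageI])
qed

lemma take_lists: "w \<in> lists X \<Longrightarrow> take n w \<in> lists X" "w \<in> lists X \<Longrightarrow> drop n w \<in> lists X"
  by (auto simp: in_lists_conv_set dest: in_set_takeD in_set_dropD)

lemma split3: "w = take i w @ take n (drop i w) @ drop n (drop i w)"
  by (metis append_take_drop_id)

lemma path_closed [simp]: "w \<in> lists X \<Longrightarrow> path_pt G w t \<in> carrier G"
  by (simp add: path_pt_def take_lists)

lemma path_0 [simp]: "path_pt G w 0 = \<one>" by (simp add: path_pt_def)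

lemma path_end: "length w \<le> t \<Longrightarrow> path_pt G w t = ev w" by (simp add: path_pt_def)

lemma path_diff:
  assumes "w \<in> lists X" "i \<le> j"
  shows "path_pt G w j = path_pt G w i \<otimes> ev (take (j - i) (drop i w))"
proof -
  have "take j w = take i w @ take (j - i) (drop i w)" using assms by (metis le_add_diff_inverse take_add)
  then show ?thesis unfolding path_pt_def using ev_append assms take_lists by metis
qed

lemma path_dd:
  assumes "w \<in> lists X" "i \<le> j"
  shows "dd (path_pt G w i) (path_pt G w j) = ln (ev (take (j - i) (drop i w)))"
  unfolding path_diff[OF assms] using assms by (intro dd_mult) (auto simp: take_lists)

lemma path_step: "w \<in> lists X \<Longrightarrow> dd (path_pt G w i) (path_pt G w (Suc i)) \<le> 1"
proof -
  assume w: "w \<in> lists X"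
  have "ln (ev (take 1 (drop i w))) \<le> length (take 1 (drop i w))" using w by (intro ln_le take_lists)
  then show ?thesis using path_dd[OF w, of i "Suc i"] by simp
qed

lemma geod_lists: "w \<in> geodesics G X \<Longrightarrow> w \<in> lists X" by (simp add: geodesics_def)
lemma geod_len: "w \<in> geodesics G X \<Longrightarrow> length w = ln (ev w)" by (simp add: geodesics_def)

lemma geod_factor: 
  assumes "u @ v \<in> geodesics G X"
  shows "u \<in> geodesics G X" "v \<in> geodesics G X" "ln (ev (u @ v)) = ln (ev u) + ln (ev v)"
proof -
  have l: "u \<in> lists X" "v \<in> lists X" using geod_lists[OF assms] by auto
  have "length u + length v = ln (ev (u @ v))" using geod_len[OF assms] by simp
  moreover have "ln (ev (u @ v)) \<le> ln (ev u) + ln (ev v)" using ln_mult l ev_append by simp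
  ultimately show "u \<in> geodesics G X" "v \<in> geodesics G X" "ln (ev (u @ v)) = ln (ev u) + ln (ev v)"
    using ln_le[OF l(1)] ln_le[OF l(2)] l by (auto simp: geodesics_def)
qed

lemma geod_path:
  assumes w: "w \<in> geodesics G X" and ij: "i \<le> j" "j \<le> length w"
  shows "dd (path_pt G w i) (path_pt G w j) = j - i"
proof -
  have "w = take i w @ (take (j - i) (drop i w) @ drop (j - i) (drop i w))" by (rule split3)
  then have "take (j - i) (drop i w) \<in> geodesics G X" using geod_factor w by metis
  then show ?thesis using path_dd[OF geod_lists[OF w] ij(1)] geod_len ij by fastforce
qed

lemma geod_ex: "g \<in> carrier G \<Longrightarrow> \<exists>w\<in>geodesics G X. ev w = g"
  using ln_word by (fastforce simp: geodesics_def)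

lemma geod_ival:
  assumes w: "w \<in> geodesics G X" and a: "a \<in> carrier G"
  shows "a \<otimes> path_pt G w t \<in> gs.ival a (a \<otimes> ev w)"
    and "dd a (a \<otimes> path_pt G w t) = min t (length w)"
proof -
  define s where "s = min t (length w)"
  have l: "w \<in> lists X" using geod_lists[OF w] .
  have p: "path_pt G w t = path_pt G w s" unfolding s_def path_pt_def by (simp add: min_def)
  have "dd \<one> (path_pt G w s) = s" "dd (path_pt G w s) (ev w) = length w - s"
    using geod_path[OF w, of 0 s] geod_path[OF w, of s "length w"] path_end[of w "length w"] by (auto simp: s_def)
  moreover have "dd \<one> (ev w) = length w" using geod_len[OF w] dd_one l by simp
  ultimately have e: "dd a (a \<otimes> path_pt G w s) = s" "dd (a \<otimes> path_pt G w s) (a \<otimes> ev w) = length w - s"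
    "dd a (a \<otimes> ev w) = length w"
    using dd_left[of a \<one>] dd_left[of a "path_pt G w s" "ev w"] a l by auto
  then show "a \<otimes> path_pt G w t \<in> gs.ival a (a \<otimes> ev w)" using a l p by (auto simp: gs.ival_def s_def)
  show "dd a (a \<otimes> path_pt G w t) = min t (length w)" using e p by (simp add: s_def)
qed

text \<open>A geodesic word through q is the concatenation of geodesic words for the two halves of
  the interval, and translation by a moves the triangle away from 1. So triangles based at 1 control
  all intervals.\<close>

lemma slim_of_triangles:
  assumes "slim_triangles G X \<delta>"
  shows "gs.slim \<delta>"
  unfolding gs.slim_def
proof (intro ballI)
  fix a b c q assume P: "a \<in> carrier G" "b \<in> carrier G" "c \<in> carrier G" and q: "q \<in> gs.ival a b"
  have qP: "q \<in> carrier G" and qe: "dd a q + dd q b = dd a b" using q gs.ivalD by auto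
  obtain w1 where w1: "w1 \<in> geodesics G X" "ev w1 = inv a \<otimes> q" using geod_ex[of "inv a \<otimes> q"] P qP by auto
  obtain w2 where w2: "w2 \<in> geodesics G X" "ev w2 = inv q \<otimes> b" using geod_ex[of "inv q \<otimes> b"] P qP by auto
  obtain u where u: "u \<in> geodesics G X" "ev u = inv a \<otimes> c" using geod_ex[of "inv a \<otimes> c"] P by auto
  obtain v where v: "v \<in> geodesics G X" "ev v = inv c \<otimes> b" using geod_ex[of "inv c \<otimes> b"] P by auto
  have e: "ev (w1 @ w2) = inv a \<otimes> b" using ev_append geod_lists w1 w2 P qP inv_solve by (simp add: m_assoc)
  have "length (w1 @ w2) = ln (ev (w1 @ w2))"
    unfolding e using geod_len[OF w1(1)] geod_len[OF w2(1)] w1 w2 qe by (simp add: word_dist_def)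
  then have w: "w1 @ w2 \<in> geodesics G X" using geod_lists w1 w2 by (auto simp: geodesics_def)
  have "ev u \<otimes> ev v = ev (w1 @ w2)" unfolding e u v using P by (simp add: m_assoc inv_solve)
  then obtain s where s: "dd (path_pt G (w1 @ w2) (length w1)) (path_pt G u s) \<le> \<delta>
     \<or> dd (path_pt G (w1 @ w2) (length w1)) (ev u \<otimes> path_pt G v s) \<le> \<delta>"
    using assms w u(1) v(1) unfolding slim_triangles_def by blast
  have wp: "a \<otimes> path_pt G (w1 @ w2) (length w1) = q" using w1 P qP by (simp add: path_pt_def inv_solve)
  have pc: "path_pt G (w1 @ w2) (length w1) \<in> carrier G" "path_pt G u s \<in> carrier G" "path_pt G v s \<in> carrier G"
    using geod_lists[OF w] geod_lists[OF u(1)] geod_lists[OF v(1)] path_closed by blast+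
  have au: "a \<otimes> ev u = c" "c \<otimes> ev v = b" using u v P by (auto simp: inv_solve)
  show "\<exists>q'\<in>gs.ival a c \<union> gs.ival c b. dd q q' \<le> \<delta>" using s
  proof
    assume "dd (path_pt G (w1 @ w2) (length w1)) (path_pt G u s) \<le> \<delta>"
    then have "dd q (a \<otimes> path_pt G u s) \<le> \<delta>" using dd_left[OF P(1) pc(1,2)] wp by simp
    moreover have "a \<otimes> path_pt G u s \<in> gs.ival a c" using geod_ival(1)[OF u(1) P(1)] au by simp
    ultimately show ?thesis by blast
  next
    assume "dd (path_pt G (w1 @ w2) (length w1)) (ev u \<otimes> path_pt G v s) \<le> \<delta>"
    then have "dd q (a \<otimes> (ev u \<otimes> path_pt G v s)) \<le> \<delta>" using dd_left[OF P(1) pc(1), of "ev u \<otimes> path_pt G v s"] wp pc ev_closed[OF geod_lists[OF u(1)]] by simp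
    then have "dd q (c \<otimes> path_pt G v s) \<le> \<delta>" using au(1) m_assoc[OF P(1) ev_closed[OF geod_lists[OF u(1)]] pc(3)] by simp
    moreover have "c \<otimes> path_pt G v s \<in> gs.ival c b" using geod_ival(1)[OF v(1) P(3)] au by simp
    ultimately show ?thesis by blast
  qed
qed

lemma ln_lipschitz:
  assumes "cayley G Y"
  shows "\<exists>J. \<forall>g\<in>carrier G. ln g \<le> J * word_len G Y g"
proof -
  interpret Y: cayley G Y by fact
  define J where "J = Max (insert 0 (ln ` Y))"
  have J: "ln y \<le> J" if "y \<in> Y" for y unfolding J_def using Y.finX that by auto
  have "ln (ev w) \<le> J * length w" if "w \<in> lists Y" for w
    using that
  proof (induction w)
    case (Cons y w)
    have "ln (y \<otimes> ev w) \<le> ln y + ln (ev w)" using Cons Y.X_sub Y.ev_closed by (intro ln_mult) auto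
    then show ?case using Cons J[of y] by auto
  qed simp
  then show ?thesis using Y.ln_word by (metis)
qed

end

text \<open>\<open>word_hyperbolic\<close> supplies slim triangles for some generating set only.
  Word metrics of two finite generating sets are bilipschitz, which is all that
  \<open>slim_change\<close> asks for.\<close>

lemma hyperbolic_slim:
  assumes "word_hyperbolic G" "fin_sym_gen G X"
  shows "\<exists>\<delta>. geodesic_space.slim (carrier G) (word_dist G X) \<delta>"
proof -
  obtain Y \<delta> where Y: "group G" "fin_sym_gen G Y" "slim_triangles G Y \<delta>" using assms by (auto simp: word_hyperbolic_def)
  interpret X: cayley G X using Y assms by (simp add: cayley_def cayley_axioms_def)
  interpret Y: cayley G Y using Y by (simp add: cayley_def cayley_axioms_def)
  obtain J1 where J1: "\<And>g. g \<in> carrier G \<Longrightarrow> X.ln g \<le> J1 * Y.ln g" using X.ln_lipschitz[OF Y.cayley_axioms] by blast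
  obtain J2 where J2: "\<And>g. g \<in> carrier G \<Longrightarrow> Y.ln g \<le> J2 * X.ln g" using Y.ln_lipschitz[OF X.cayley_axioms] by blast
  have a: "Y.ln g \<le> (J1 + J2) * X.ln g" "X.ln g \<le> (J1 + J2) * Y.ln g" if "g \<in> carrier G" for g
    using J1[OF that] J2[OF that] by (simp_all add: algebra_simps)
  show ?thesis
    by (rule slim_change[OF Y.gs.geodesic_space_axioms X.gs.geodesic_space_axioms Y.slim_of_triangles[OF Y(3)], of "J1 + J2"])
       (auto simp: word_dist_def intro: a)
qed

section \<open>Words in a hyperbolic group\<close>

locale hyp_cayley = cayley +
  fixes \<delta> :: nat
  assumes slim: "gs.slim \<delta>"
begin

text \<open>Without such a subword, the path of w would be a closed path whose pieces of length up
  to \<open>4 * \<delta> + 2\<close> are geodesic.\<close>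

lemma dehn:
  assumes w: "w \<in> lists X" "ev w = \<one>" "w \<noteq> []"
  shows "\<exists>p u r. w = p @ u @ r \<and> length u \<le> 4 * \<delta> + 2 \<and> ln (ev u) < length u"
proof (rule ccontr)
  assume no: "\<not> ?thesis"
  have "length w = 0"
  proof (rule gs.local_geodesic_loop[OF slim, where c = "path_pt G w"])
    show "path_pt G w 0 = path_pt G w (length w)" using w by (simp add: path_end)
    fix i j assume ij: "i \<le> j" "j \<le> length w" "j - i \<le> 4 * \<delta> + 2"
    let ?u = "take (j - i) (drop i w)"
    have "length ?u \<le> 4 * \<delta> + 2" using ij by simp
    then have "\<not> ln (ev ?u) < length ?u" using no split3[of w i "j - i"] by blast
    moreover have "ln (ev ?u) \<le> length ?u" using w by (intro ln_le take_lists)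
    ultimately show "dd (path_pt G w i) (path_pt G w j) = j - i" using path_dd[OF w(1) ij(1)] ij by simp
  qed (use w in auto)
  then show False using w by simp
qed

lemma geod_fellow:
  assumes u: "u \<in> geodesics G X" and v: "v \<in> geodesics G X" and k: "k1 \<in> carrier G" "k2 \<in> carrier G"
    and M: "ln k1 \<le> M" "ln k2 \<le> M" and e: "ev v = k1 \<otimes> ev u \<otimes> k2"
  shows "dd (k1 \<otimes> path_pt G u t) (path_pt G v t) \<le> 8 * \<delta> + 6 * M"
proof -
  have l: "u \<in> lists X" "v \<in> lists X" using u v geod_lists by auto
  have 1: "dd k1 (k1 \<otimes> path_pt G u t) = t \<or> dd k1 (k1 \<otimes> ev u) \<le> t \<and> k1 \<otimes> path_pt G u t = k1 \<otimes> ev u"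
    using geod_ival(2)[OF u k(1), of t] dd_mult[OF k(1), of "ev u"] geod_len[OF u] l path_end[of u t]
    by (cases "t \<le> length u") auto
  have 2: "dd \<one> (path_pt G v t) = t \<or> dd \<one> (ev v) \<le> t \<and> path_pt G v t = ev v"
    using geod_ival(2)[OF v one_closed, of t] dd_one[of "ev v"] geod_len[OF v] l path_end[of v t]
    by (cases "t \<le> length v") auto
  show ?thesis
  proof (rule gs.fellow[OF slim, of k1 "k1 \<otimes> ev u" \<one> "ev v"])
    show "dd k1 \<one> \<le> M" using M k ln_inv by (simp add: word_dist_def)
    show "dd (k1 \<otimes> ev u) (ev v) \<le> M" unfolding e using M k l by (simp add: dd_mult)
    show "k1 \<otimes> path_pt G u t \<in> gs.ival k1 (k1 \<otimes> ev u)" by (rule geod_ival(1)[OF u k(1)])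
    show "path_pt G v t \<in> gs.ival \<one> (ev v)" using geod_ival(1)[OF v one_closed, of t] l by simp
  qed (use k l 1 2 in auto)
qed

text \<open>Quasi-geodesic words, without additive constant: minimising words satisfy this by
  cutting and pasting (\<open>opt_wquasi\<close>).\<close>

definition wquasi :: "nat \<Rightarrow> 'a list \<Rightarrow> bool" where
  "wquasi L w \<longleftrightarrow> w \<in> lists X \<and> (\<forall>p u r. w = p @ u @ r \<longrightarrow> length u \<le> L * ln (ev u))"

text \<open>The word runs from 1 to a point within M of gz, and g lies on a geodesic from 1 to gz.
  Slimness moves g to a geodesic that ends where the word ends, or into the neighbourhood of that
  end; the Morse lemma passes from the geodesic to the word. What matters is that N does not depend
  on g and z.\<close>

lemma pass_near:
  "\<exists>N. \<forall>g\<in>carrier G. \<forall>z\<in>carrier G. \<forall>h\<in>carrier G. \<forall>w. ln (g \<otimes> z) = ln g + ln z \<longrightarrow> ln h \<le> M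
     \<longrightarrow> wquasi L w \<longrightarrow> ev w = g \<otimes> z \<otimes> h \<longrightarrow> (\<exists>p r. w = p @ r \<and> dd g (ev p) \<le> N)"
proof -
  obtain D where D: "\<And>c m q. gs.quasi 1 L c m \<Longrightarrow> q \<in> gs.ival (c 0) (c m) \<Longrightarrow> \<exists>i\<le>m. dd q (c i) \<le> D"
    using gs.morse1[OF slim, of 1 L] by metis
  have "\<exists>p r. w = p @ r \<and> dd g (ev p) \<le> \<delta> + D + M"
    if C: "g \<in> carrier G" "z \<in> carrier G" "h \<in> carrier G" and gz: "ln (g \<otimes> z) = ln g + ln z" and h: "ln h \<le> M"
      and w: "wquasi L w" and e: "ev w = g \<otimes> z \<otimes> h" for g z h w
  proof -
    have l: "w \<in> lists X" using w by (simp add: wquasi_def)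
    let ?k = "g \<otimes> z \<otimes> h"
    have K: "?k \<in> carrier G" "g \<otimes> z \<in> carrier G" using C by auto
    have g: "g \<in> gs.ival \<one> (g \<otimes> z)" using C gz by (simp add: gs.ival_def dd_one dd_mult)
    obtain q' where q': "q' \<in> gs.ival \<one> ?k \<or> q' \<in> gs.ival ?k (g \<otimes> z)" "dd g q' \<le> \<delta>" "q' \<in> carrier G"
      using gs.slimD[OF slim one_closed K(2,1) g] by metis
    have qs: "gs.quasi 1 L (path_pt G w) (length w)"
      unfolding gs.quasi_def
    proof (intro conjI allI impI)
      fix i j assume ij: "i \<le> length w" "j \<le> length w" "i \<le> j"
      have "w = take i w @ take (j - i) (drop i w) @ drop (j - i) (drop i w)" by (rule split3)
      then have "length (take (j - i) (drop i w)) \<le> L * ln (ev (take (j - i) (drop i w)))" using w unfolding wquasi_def by metis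
      then show "j - i \<le> L * dd (path_pt G w i) (path_pt G w j) + L" using path_dd[OF l ij(3)] ij by simp
    qed (use l path_step in auto)
    have "\<exists>i\<le>length w. dd g (path_pt G w i) \<le> \<delta> + D + M"
      using q'(1)
    proof
      assume "q' \<in> gs.ival \<one> ?k"
      then have "q' \<in> gs.ival (path_pt G w 0) (path_pt G w (length w))" using e by (simp add: path_end)
      from D[OF qs this] obtain i where i: "i \<le> length w" "dd q' (path_pt G w i) \<le> D" by blast
      have "dd g (path_pt G w i) \<le> dd g q' + dd q' (path_pt G w i)" using C q' l by (intro gs.d_tri) auto
      then show ?thesis using i q' by (intro exI[of _ i]) auto
    next
      assume "q' \<in> gs.ival ?k (g \<otimes> z)"
      then have "dd ?k q' + dd q' (g \<otimes> z) = dd ?k (g \<otimes> z)" using gs.ivalD by auto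
      moreover have "dd ?k (g \<otimes> z) = ln h" using gs.d_sym[OF K] dd_mult[OF K(2) C(3)] by simp
      moreover have "dd ?k q' = dd q' ?k" using gs.d_sym K q' by auto
      moreover have "dd g ?k \<le> dd g q' + dd q' ?k" using gs.d_tri C q' K by auto
      ultimately have "dd g ?k \<le> \<delta> + D + M" using q' h by linarith
      then show ?thesis using e by (intro exI[of _ "length w"]) (simp add: path_end)
    qed
    then obtain i where "dd g (path_pt G w i) \<le> \<delta> + D + M" by blast
    then show ?thesis unfolding path_pt_def by (metis append_take_drop_id)
  qed
  then show ?thesis by blast
qed

end

section \<open>Extensions and the minimising section\<close>

locale ext = hyp_cayley G X \<delta> + E: group E + fg_lattice H B m lam
  for G :: "('g, 'm) monoid_scheme" (structure) and X \<delta> and E :: "('e, 'n) monoid_scheme"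
    and H :: "('a::ab_group_add \<Rightarrow> 'a) set" and B m lam +
  fixes act :: "'g \<Rightarrow> 'a \<Rightarrow> 'a" and \<iota> :: "'a \<Rightarrow> 'e" and \<pi> :: "'e \<Rightarrow> 'g"
  assumes ra: "right_action G act" and H_act: "H = act ` carrier G"
    and exi: "extension_inducing E G act \<iota> \<pi>"
begin

abbreviation mulE :: "'e \<Rightarrow> 'e \<Rightarrow> 'e" (infixl "\<star>" 70) where "a \<star> b \<equiv> a \<otimes>\<^bsub>E\<^esub> b"
abbreviation "oneE \<equiv> \<one>\<^bsub>E\<^esub>"
abbreviation "invE \<equiv> m_inv E"

lemma act_H: "g \<in> carrier G \<Longrightarrow> act g \<in> H" using H_act by auto
lemma act_hom: "g \<in> carrier G \<Longrightarrow> add_hom (act g)" using act_H H_hom by auto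
lemma act_mult: "g \<in> carrier G \<Longrightarrow> h \<in> carrier G \<Longrightarrow> act (g \<otimes> h) a = act h (act g a)"
  using ra by (auto simp: right_action_def)
lemma act_one [simp]: "act \<one> a = a" using ra by (auto simp: right_action_def)
lemma act_inv [simp]: "g \<in> carrier G \<Longrightarrow> act g (act (inv g) a) = a" "g \<in> carrier G \<Longrightarrow> act (inv g) (act g a) = a"
  using act_mult[of "inv g" g a] act_mult[of g "inv g" a] by auto

lemma act_comp: "g \<in> carrier G \<Longrightarrow> h \<in> carrier G \<Longrightarrow> f \<circ> act h \<circ> act g = f \<circ> act (g \<otimes> h)"
  by (auto simp: act_mult)

lemma Lam_act: "l \<in> Lam \<Longrightarrow> g \<in> carrier G \<Longrightarrow> l \<circ> act g \<in> Lam" using Lam_H act_H by auto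

lemma iota_closed [simp]: "\<iota> a \<in> carrier E" using exi by (auto simp: extension_inducing_def)
lemma iota_add: "\<iota> (a + b) = \<iota> a \<star> \<iota> b" using exi by (auto simp: extension_inducing_def)
lemma iota_inj: "\<iota> a = \<iota> b \<Longrightarrow> a = b" using exi by (auto simp: extension_inducing_def inj_def)
lemma iota_0 [simp]: "\<iota> 0 = oneE"
  using iota_add[of 0 0] E.r_cancel_one'[of "\<iota> 0" "\<iota> 0"] by simp
lemma iota_minus: "\<iota> (- a) = invE (\<iota> a)"
  using iota_add[of "- a" a] by (intro E.inv_equality[symmetric]) auto

lemma pi_closed [simp]: "e \<in> carrier E \<Longrightarrow> \<pi> e \<in> carrier G" using exi by (auto simp: extension_inducing_def)
lemma pi_mult [simp]: "e \<in> carrier E \<Longrightarrow> e' \<in> carrier E \<Longrightarrow> \<pi> (e \<star> e') = \<pi> e \<otimes> \<pi> e'"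
  using exi by (auto simp: extension_inducing_def hom_def)
lemma pi_iota [simp]: "\<pi> (\<iota> a) = \<one>" using exi unfolding extension_inducing_def by blast
lemma pi_one [simp]: "\<pi> oneE = \<one>" using pi_iota[of 0] by simp
lemma pi_inv [simp]: "e \<in> carrier E \<Longrightarrow> \<pi> (invE e) = inv (\<pi> e)"
  using pi_mult[of "invE e" e] by (intro inv_equality[symmetric]) auto
lemma pi_surj: "g \<in> carrier G \<Longrightarrow> \<exists>e\<in>carrier E. \<pi> e = g" 
proof -
  assume "g \<in> carrier G"
  moreover have "\<pi> ` carrier E = carrier G" using exi by (simp only: extension_inducing_def)
  ultimately have "g \<in> \<pi> ` carrier E" by simp
  then show ?thesis by (rule imageE) (rule bexI, rule sym)
qed
lemma ker: "e \<in> carrier E \<Longrightarrow> \<pi> e = \<one> \<Longrightarrow> \<exists>a. e = \<iota> a"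
  using exi unfolding extension_inducing_def by blast

lemma E_cancel: "e \<in> carrier E \<Longrightarrow> e' \<in> carrier E \<Longrightarrow> e \<star> (invE e \<star> e') = e'"
  "e \<in> carrier E \<Longrightarrow> e' \<in> carrier E \<Longrightarrow> invE e \<star> (e \<star> e') = e'"
  by (simp_all flip: E.m_assoc)

lemma iota_move: "e \<in> carrier E \<Longrightarrow> \<iota> a \<star> e = e \<star> \<iota> (act (\<pi> e) a)"
proof -
  assume e: "e \<in> carrier E"
  have "invE e \<star> \<iota> a \<star> e = \<iota> (act (\<pi> e) a)" using exi e by (auto simp: extension_inducing_def)
  then show ?thesis using e E_cancel(1)[of e "\<iota> a \<star> e"] by (simp add: E.m_assoc)
qed

definition fd :: "'e \<Rightarrow> 'e \<Rightarrow> 'a" where "fd e e' = inv_into UNIV \<iota> (invE e \<star> e')"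

lemma fd: "e \<in> carrier E \<Longrightarrow> e' \<in> carrier E \<Longrightarrow> \<pi> e = \<pi> e' \<Longrightarrow> e \<star> \<iota> (fd e e') = e'"
proof -
  assume e: "e \<in> carrier E" "e' \<in> carrier E" "\<pi> e = \<pi> e'"
  then obtain a where a: "invE e \<star> e' = \<iota> a" using ker[of "invE e \<star> e'"] by auto
  then have "\<iota> (fd e e') = invE e \<star> e'" unfolding fd_def by (simp add: f_inv_into_f)
  then show ?thesis using e by (simp add: E_cancel)
qed

lemma iota_cancel: "e \<in> carrier E \<Longrightarrow> e \<star> \<iota> a = e \<star> \<iota> b \<Longrightarrow> a = b"
  using iota_inj by (simp)

lemma fd_iota [simp]: "e \<in> carrier E \<Longrightarrow> fd e (e \<star> \<iota> a) = a"
  using fd[of e "e \<star> \<iota> a"] iota_cancel[of e] by auto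

definition hat :: "'g \<Rightarrow> 'e" where "hat g = (SOME e. e \<in> carrier E \<and> \<pi> e = g)"

lemma hat [simp]: "g \<in> carrier G \<Longrightarrow> hat g \<in> carrier E" "g \<in> carrier G \<Longrightarrow> \<pi> (hat g) = g"
  using someI_ex[of "\<lambda>e. e \<in> carrier E \<and> \<pi> e = g"] pi_surj[of g] unfolding hat_def by blast+

definition lift :: "'g list \<Rightarrow> 'e" where "lift w = word_eval E (map hat w)"

lemma lift_Nil [simp]: "lift [] = oneE" by (simp add: lift_def)
lemma lift_Cons [simp]: "lift (x # w) = hat x \<star> lift w" by (simp add: lift_def)

lemma lift_closed [simp]: "w \<in> lists X \<Longrightarrow> lift w \<in> carrier E"
  using X_sub by (induction w) auto

lemma pi_lift [simp]: "w \<in> lists X \<Longrightarrow> \<pi> (lift w) = ev w"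
  using X_sub by (induction w) (auto simp: subset_iff)

lemma lift_append: "u \<in> lists X \<Longrightarrow> v \<in> lists X \<Longrightarrow> lift (u @ v) = lift u \<star> lift v"
proof (induction u)
  case (Cons x u)
  then show ?case using X_sub by (auto simp: E.m_assoc subset_iff)
qed simp

section \<open>A linear isoperimetric inequality with values in A\<close>

lemma N_triangle: "N (a + b) \<le> N a + N b"
proof -
  obtain l where "l \<in> Lams" "l (a + b) = N (a + b)" using N_at by auto
  then show ?thesis using N_ge[of l a] N_ge[of l b] add_hom_add[OF Lams_hom[of l]] by force
qed

lemma N_uminus: "N (- a) = N a"
proof -
  have le: "N (- a) \<le> N a" for a
  proof -
    obtain l where l: "l \<in> Lams" "l (- a) = N (- a)" using N_at by auto
    then have e: "N (- a) = - l a" using add_hom_minus[OF Lams_hom] by auto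
    have "\<bar>l a\<bar> \<le> N a" using l(1) Lam_abs[of _ a] N_nonneg[of a] by (auto simp: Lams_def)
    then show ?thesis using e by simp
  qed
  show ?thesis using le[of a] le[of "- a"] by simp
qed

lemma N_act': "g \<in> carrier G \<Longrightarrow> N (act g a) = N a" using N_act act_H by auto

text \<open>Dehn's algorithm in E. Replacing a subword u by a shorter geodesic v changes the lift by
  one of finitely many elements of A; carrying that element past the rest of the word applies the
  action, under which the seminorm N is invariant. Every step shortens the word, so there are at
  most \<open>length w\<close> of them.\<close>

lemma loop_bound: "\<exists>C\<ge>0. \<forall>w a. w \<in> lists X \<longrightarrow> lift w = \<iota> a \<longrightarrow> N a \<le> C * int (length w)"
proof -
  \<comment> \<open>A fixed choice of geodesics, so that the corrections range over a finite
    set.\<close>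
  define gd where "gd u = (SOME v. v \<in> geodesics G X \<and> ev v = ev u)" for u
  have gd: "gd u \<in> geodesics G X" "ev (gd u) = ev u" if "u \<in> lists X" for u
    using someI_ex[of "\<lambda>v. v \<in> geodesics G X \<and> ev v = ev u"] geod_ex[OF ev_closed[OF that]] unfolding gd_def by blast+
  define U where "U = {u. set u \<subseteq> X \<and> length u \<le> 4 * \<delta> + 2}"
  have U: "finite U" unfolding U_def by (rule finite_lists_length_le[OF finX])
  define C where "C = Max (insert 0 ((\<lambda>u. N (fd (lift (gd u)) (lift u))) ` U))"
  have C: "N (fd (lift (gd u)) (lift u)) \<le> C" if "u \<in> U" for u unfolding C_def using U that by (intro Max_ge) auto
  have C0: "0 \<le> C" unfolding C_def using U by (intro Max_ge) auto
  have main: "w \<in> lists X \<Longrightarrow> lift w = \<iota> a \<Longrightarrow> N a \<le> C * int (length w)" for w a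
  proof (induction "length w" arbitrary: w a rule: less_induct)
    case less
    show ?case
    proof (cases "w = []")
      case True
      then have "\<iota> a = \<iota> 0" using less.prems by simp
      then have "a = 0" by (rule iota_inj)
      then show ?thesis using True by simp
    next
      case False
      have "ev w = \<one>" using pi_lift[OF less.prems(1)] less.prems(2) by simp
      then obtain p u r where w: "w = p @ u @ r" "length u \<le> 4 * \<delta> + 2" "ln (ev u) < length u"
        using dehn[OF less.prems(1) _ False] by blast
      have l: "p \<in> lists X" "u \<in> lists X" "r \<in> lists X" using less.prems w by auto
      have uU: "u \<in> U" using l w by (auto simp: U_def)
      define v where "v = gd u"
      define b where "b = fd (lift v) (lift u)"
      have v: "v \<in> lists X" "ev v = ev u" "length v < length u"
        using gd[OF l(2)] geod_lists geod_len[of v] w by (auto simp: v_def)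
      have lu: "lift u = lift v \<star> \<iota> b" unfolding b_def using fd[of "lift v" "lift u"] v l by simp
      have rE: "lift r \<in> carrier E" "\<pi> (lift r) = ev r" using l by auto
      have "lift w = lift p \<star> (lift v \<star> (\<iota> b \<star> lift r))"
        unfolding w using l v lu by (simp add: lift_append E.m_assoc)
      also have "\<iota> b \<star> lift r = lift r \<star> \<iota> (act (ev r) b)" using iota_move[OF rE(1)] rE by simp
      finally have lw: "\<iota> a = lift (p @ v @ r) \<star> \<iota> (act (ev r) b)"
        using less.prems l v by (simp add: lift_append E.m_assoc)
      have "lift (p @ v @ r) \<star> \<iota> (act (ev r) b) \<star> \<iota> (- act (ev r) b) = lift (p @ v @ r)"
        using l v by (simp add: E.m_assoc flip: iota_add)
      then have "lift (p @ v @ r) = \<iota> (a - act (ev r) b)" unfolding lw[symmetric] by (simp flip: iota_add)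
      then have "N (a - act (ev r) b) \<le> C * int (length (p @ v @ r))"
        using less.hyps[of "p @ v @ r"] w v l by auto
      moreover have "N a \<le> N (a - act (ev r) b) + N (act (ev r) b)" using N_triangle[of "a - act (ev r) b" "act (ev r) b"] by simp
      moreover have "N (act (ev r) b) \<le> C" using N_act'[of "ev r" b] l C[OF uU] by (simp add: b_def v_def)
      ultimately have "N a \<le> C * int (length (p @ v @ r) + 1)" by (simp add: algebra_simps)
      also have "\<dots> \<le> C * int (length w)" using w v C0 by (intro mult_left_mono) auto
      finally show ?thesis .
    qed
  qed
  then show ?thesis using C0 by blast
qed

text \<open>The lifts of x and of its inverse need not be inverse in E. Each letter contributes one
  of finitely many errors, up to the action, which preserves N.\<close>

lemma inverse_bound: "\<exists>C\<ge>0. \<forall>v\<in>lists X. \<exists>b. lift v \<star> lift (winv v) = \<iota> b \<and> N b \<le> C * int (length v)"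
proof -
  define C where "C = Max (insert 0 ((\<lambda>x. N (fd oneE (hat x \<star> hat (inv x)))) ` X))"
  have C: "N (fd oneE (hat x \<star> hat (inv x))) \<le> C" if "x \<in> X" for x unfolding C_def using finX that by (intro Max_ge) auto
  have C0: "0 \<le> C" unfolding C_def using finX by (intro Max_ge) auto
  have "v \<in> lists X \<Longrightarrow> \<exists>b. lift v \<star> lift (winv v) = \<iota> b \<and> N b \<le> C * int (length v)" for v
  proof (induction v)
    case Nil
    show ?case by (intro exI[of _ 0]) (simp add: winv_def)
  next
    case (Cons x v)
    then have x: "x \<in> X" "v \<in> lists X" "x \<in> carrier G" "inv x \<in> X" using X_sub X_inv by auto
    obtain b where b: "lift v \<star> lift (winv v) = \<iota> b" "N b \<le> C * int (length v)" using Cons x by auto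
    let ?c = "fd oneE (hat x \<star> hat (inv x))"
    have c: "hat x \<star> hat (inv x) = \<iota> ?c" using fd[of oneE "hat x \<star> hat (inv x)"] x by simp
    have hc: "hat x \<in> carrier E" "hat (inv x) \<in> carrier E" "\<pi> (hat (inv x)) = inv x" using x by auto
    have wv: "winv v \<in> lists X" using winv x by auto
    have "winv (x # v) = winv v @ [inv x]" by (simp add: winv_def)
    then have "lift (x # v) \<star> lift (winv (x # v)) = hat x \<star> (lift v \<star> lift (winv v) \<star> hat (inv x))"
      using x hc wv by (simp add: lift_append E.m_assoc)
    also have "lift v \<star> lift (winv v) \<star> hat (inv x) = hat (inv x) \<star> \<iota> (act (inv x) b)"
      unfolding b using iota_move[OF hc(2)] hc by simp
    also have "hat x \<star> (hat (inv x) \<star> \<iota> (act (inv x) b)) = \<iota> (?c + act (inv x) b)"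
      using hc c by (simp add: iota_add flip: E.m_assoc)
    finally have e: "lift (x # v) \<star> lift (winv (x # v)) = \<iota> (?c + act (inv x) b)" .
    have "N (?c + act (inv x) b) \<le> C + C * int (length v)"
      using N_triangle[of ?c "act (inv x) b"] C[OF x(1)] b(2) N_act'[of "inv x" b] x by simp
    then show ?case using e by (intro exI[of _ "?c + act (inv x) b"]) (simp add: algebra_simps)
  qed
  then show ?thesis using C0 by blast
qed

lemma two_word_bound: "\<exists>C\<ge>0. \<forall>u v a. u \<in> lists X \<longrightarrow> v \<in> lists X \<longrightarrow> lift u = lift v \<star> \<iota> a
    \<longrightarrow> N a \<le> C * int (length u + length v)"
proof -
  obtain C where C: "C \<ge> 0" "\<And>w a. w \<in> lists X \<Longrightarrow> lift w = \<iota> a \<Longrightarrow> N a \<le> C * int (length w)"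
    using loop_bound by blast
  obtain C' where C': "C' \<ge> 0" "\<And>v. v \<in> lists X \<Longrightarrow> \<exists>b. lift v \<star> lift (winv v) = \<iota> b \<and> N b \<le> C' * int (length v)"
    using inverse_bound by blast
  have "N a \<le> (C + C') * int (length u + length v)"
    if l: "u \<in> lists X" "v \<in> lists X" and uv: "lift u = lift v \<star> \<iota> a" for u v a
  proof -
    obtain b where b: "lift v \<star> lift (winv v) = \<iota> b" "N b \<le> C' * int (length v)" using C' l by blast
    have wv: "winv v \<in> lists X" "length (winv v) = length v" using winv l by auto
    let ?h = "ev (winv v)"
    have "lift (u @ winv v) = lift v \<star> (\<iota> a \<star> lift (winv v))" using l wv uv by (simp add: lift_append E.m_assoc)
    also have "\<dots> = lift v \<star> (lift (winv v) \<star> \<iota> (act ?h a))" using iota_move[OF lift_closed[OF wv(1)]] wv by simp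
    also have "\<dots> = \<iota> (b + act ?h a)" using l wv b by (simp add: iota_add flip: E.m_assoc)
    finally have "N (b + act ?h a) \<le> C * int (length (u @ winv v))" using C(2)[of "u @ winv v"] l wv by simp
    moreover have "N (act ?h a) \<le> N (b + act ?h a) + N (- b)" using N_triangle[of "b + act ?h a" "- b"] by simp
    moreover have "N (act ?h a) = N a" using N_act' wv by simp
    moreover have "C' * int (length v) \<le> C' * int (length u + length v)" using C' by (intro mult_left_mono) auto
    ultimately show ?thesis using b wv N_uminus[of b] by (simp add: algebra_simps)
  qed
  then show ?thesis using C(1) C'(1) by (intro exI[of _ "C + C'"]) auto
qed

section \<open>The minimal cost of an element of the extension\<close>

definition C1 :: int where
  "C1 = (SOME C. C \<ge> 0 \<and> (\<forall>u v a. u \<in> lists X \<longrightarrow> v \<in> lists X \<longrightarrow> lift u = lift v \<star> \<iota> a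
    \<longrightarrow> N a \<le> C * int (length u + length v)))"

lemma C1: "C1 \<ge> 0" "u \<in> lists X \<Longrightarrow> v \<in> lists X \<Longrightarrow> lift u = lift v \<star> \<iota> a \<Longrightarrow> N a \<le> C1 * int (length u + length v)"
  using someI_ex[OF two_word_bound] unfolding C1_def by blast+

text \<open>Minimisers exist as soon as K is at least the isoperimetric constant; the factor 2 makes them quasi-geodesic.\<close>

definition K :: int where "K = 2 * C1 + 1"

definition opt :: "('a \<Rightarrow> int) \<Rightarrow> 'e \<Rightarrow> 'g list \<Rightarrow> 'a \<Rightarrow> bool" where
  "opt l e w a \<longleftrightarrow> w \<in> lists X \<and> e = lift w \<star> \<iota> a \<and>
     (\<forall>w' a'. w' \<in> lists X \<longrightarrow> e = lift w' \<star> \<iota> a' \<longrightarrow> l a + K * int (length w) \<le> l a' + K * int (length w'))"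

lemma opt_ex:
  assumes l: "l \<in> Lam" and e: "e \<in> carrier E"
  shows "\<exists>w a. opt l e w a"
proof -
  obtain w0 where w0: "w0 \<in> lists X" "ev w0 = \<pi> e" using X_gen[of "\<pi> e"] e by auto
  define a0 where "a0 = fd (lift w0) e"
  have a0: "e = lift w0 \<star> \<iota> a0" unfolding a0_def using fd[of "lift w0" e] w0 e by simp
  let ?P = "\<lambda>p. fst p \<in> lists X \<and> e = lift (fst p) \<star> \<iota> (snd p)"
  let ?v = "\<lambda>p. l (snd p) + K * int (length (fst p))"
  let ?lb = "l a0 - C1 * int (length w0)"
  \<comment> \<open>Comparison with the fixed word w0: l a can fall below l a0 at most linearly in
    the word lengths with slope C1, and K, being at least C1, compensates for w.\<close>
  have lb: "?lb \<le> ?v p" if p: "?P p" for p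
  proof -
    obtain w a where pw: "p = (w, a)" by force
    have w: "w \<in> lists X" "e = lift w \<star> \<iota> a" using p pw by auto
    have "lift w0 \<star> \<iota> a0 \<star> \<iota> (- a0) = lift w \<star> \<iota> a \<star> \<iota> (- a0)" using a0 w by simp
    then have "lift w0 = lift w \<star> \<iota> (a - a0)" using w w0 by (simp add: E.m_assoc flip: iota_add)
    then have "N (a - a0) \<le> C1 * int (length w0 + length w)" using C1(2)[OF w0(1) w(1)] by simp
    moreover have "\<bar>l (a - a0)\<bar> \<le> N (a - a0)" by (rule Lam_abs[OF l])
    moreover have "l (a - a0) = l a - l a0" by (rule add_hom_diff[OF Lam_hom[OF l]])
    ultimately have "l a0 - C1 * int (length w0) \<le> l a + C1 * int (length w)" by (simp add: algebra_simps)
    also have "\<dots> \<le> l a + K * int (length w)" unfolding K_def using C1(1) by (intro add_left_mono mult_right_mono) auto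
    finally show ?thesis using pw by simp
  qed
  have "?P (w0, a0)" using w0 a0 by simp
  then obtain p where p: "?P p" "\<And>q. ?P q \<Longrightarrow> nat (?v p - ?lb) \<le> nat (?v q - ?lb)"
    using ex_has_least_nat[of ?P "(w0, a0)" "\<lambda>p. nat (?v p - ?lb)"] by blast
  have "?v p \<le> ?v q" if "?P q" for q
    using p(2)[OF that] lb[OF that] lb[OF p(1)] by linarith
  then have "opt l e (fst p) (snd p)" unfolding opt_def using p(1) by fastforce
  then show ?thesis by blast
qed

definition Phi :: "('a \<Rightarrow> int) \<Rightarrow> 'e \<Rightarrow> int" where
  "Phi l e = (SOME v. \<exists>w a. opt l e w a \<and> v = l a + K * int (length w))"

lemma Phi_opt:
  assumes l: "l \<in> Lam" and e: "e \<in> carrier E"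
  shows "\<exists>w a. opt l e w a \<and> Phi l e = l a + K * int (length w)"
proof -
  have "\<exists>v. \<exists>w a. opt l e w a \<and> v = l a + K * int (length w)" using opt_ex[OF assms] by blast
  then show ?thesis unfolding Phi_def by (rule someI_ex)
qed

lemma Phi_le: "l \<in> Lam \<Longrightarrow> w \<in> lists X \<Longrightarrow> Phi l (lift w \<star> \<iota> a) \<le> l a + K * int (length w)"
proof -
  assume l: "l \<in> Lam" and w: "w \<in> lists X"
  then obtain v b where v: "opt l (lift w \<star> \<iota> a) v b" "Phi l (lift w \<star> \<iota> a) = l b + K * int (length v)"
    using Phi_opt[OF l, of "lift w \<star> \<iota> a"] by auto
  show ?thesis unfolding v(2) using v(1) w unfolding opt_def by blast
qed

lemma Phi_iota: "l \<in> Lam \<Longrightarrow> e \<in> carrier E \<Longrightarrow> Phi l (e \<star> \<iota> b) = Phi l e + l b"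
proof -
  have le: "Phi l (e \<star> \<iota> b) \<le> Phi l e + l b" if l: "l \<in> Lam" and e: "e \<in> carrier E" for e b
  proof -
    obtain w a where w: "opt l e w a" "Phi l e = l a + K * int (length w)" using Phi_opt[OF l e] by blast
    have "e \<star> \<iota> b = lift w \<star> \<iota> (a + b)" using w(1) by (auto simp: opt_def iota_add E.m_assoc)
    then show ?thesis using Phi_le[OF l, of w "a + b"] w add_hom_add[OF Lam_hom[OF l], of a b] by (auto simp: opt_def)
  qed
  assume l: "l \<in> Lam" and e: "e \<in> carrier E"
  have "e \<star> \<iota> b \<star> \<iota> (- b) = e" using e by (simp add: E.m_assoc flip: iota_add)
  then show ?thesis using le[OF l e, of b] le[OF l, of "e \<star> \<iota> b" "- b"] e add_hom_minus[OF Lam_hom[OF l], of b] by simp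
qed

text \<open>Concatenate minimising words of the two factors. The A-part of e1 has to pass e2, which
  twists it by the action; the twist is moved into the functional.\<close>

lemma Phi_mult:
  assumes l: "l \<in> Lam" and e: "e1 \<in> carrier E" "e2 \<in> carrier E"
  shows "Phi l (e1 \<star> e2) \<le> Phi (l \<circ> act (\<pi> e2)) e1 + Phi l e2"
proof -
  have l': "l \<circ> act (\<pi> e2) \<in> Lam" using Lam_act l e by auto
  obtain w a where w: "opt (l \<circ> act (\<pi> e2)) e1 w a" "Phi (l \<circ> act (\<pi> e2)) e1 = l (act (\<pi> e2) a) + K * int (length w)"
    using Phi_opt[OF l' e(1)] by auto
  obtain v b where v: "opt l e2 v b" "Phi l e2 = l b + K * int (length v)" using Phi_opt[OF l e(2)] by blast
  have wl: "w \<in> lists X" "e1 = lift w \<star> \<iota> a" "v \<in> lists X" "e2 = lift v \<star> \<iota> b" using w v by (auto simp: opt_def)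
  have "e1 \<star> e2 = lift w \<star> (\<iota> a \<star> e2)" using wl e by (simp add: E.m_assoc)
  also have "\<iota> a \<star> e2 = e2 \<star> \<iota> (act (\<pi> e2) a)" by (rule iota_move[OF e(2)])
  also have "lift w \<star> (e2 \<star> \<iota> (act (\<pi> e2) a)) = lift (w @ v) \<star> \<iota> (b + act (\<pi> e2) a)"
    unfolding wl(4) using wl(1,3) by (simp add: lift_append iota_add E.m_assoc)
  finally have "Phi l (e1 \<star> e2) \<le> l (b + act (\<pi> e2) a) + K * int (length (w @ v))"
    using Phi_le[OF l, of "w @ v"] wl by simp
  then show ?thesis using w v add_hom_add[OF Lam_hom[OF l]] by (simp add: algebra_simps)
qed

text \<open>Replace a subword u by a geodesic v. Minimality and \<open>C1\<close> show that K - C1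
  times the length of u is at most K + C1 times the length of v; these factors are C1 + 1 and 3 C1 +
  1, whence the constant 3.\<close>

lemma opt_wquasi:
  assumes l: "l \<in> Lam" and o: "opt l e w a"
  shows "wquasi 3 w"
  unfolding wquasi_def
proof (intro conjI allI impI)
  show wl: "w \<in> lists X" using o by (simp add: opt_def)
  fix p u r assume w: "w = p @ u @ r"
  have ll: "p \<in> lists X" "u \<in> lists X" "r \<in> lists X" using wl w by auto
  obtain v where v: "v \<in> geodesics G X" "ev v = ev u" using geod_ex[of "ev u"] ll by auto
  have vl: "v \<in> lists X" "length v = ln (ev u)" using geod_lists geod_len v by auto
  define b where "b = fd (lift v) (lift u)"
  have lu: "lift u = lift v \<star> \<iota> b" unfolding b_def using fd[of "lift v" "lift u"] v vl ll by simp
  have rE: "lift r \<in> carrier E" "\<pi> (lift r) = ev r" using ll by auto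
  have "e = lift p \<star> (lift v \<star> (\<iota> b \<star> lift r \<star> \<iota> a))" using o ll vl lu by (simp add: opt_def w lift_append E.m_assoc)
  also have "\<iota> b \<star> lift r = lift r \<star> \<iota> (act (ev r) b)" using iota_move[OF rE(1)] rE by simp
  finally have e: "e = lift (p @ v @ r) \<star> \<iota> (act (ev r) b + a)"
    using ll vl by (simp add: lift_append E.m_assoc iota_add)
  have min: "l a + K * int (length w) \<le> l a' + K * int (length w')" if "w' \<in> lists X" "e = lift w' \<star> \<iota> a'" for w' a'
    using o that unfolding opt_def by blast
  have "l a + K * int (length w) \<le> l (act (ev r) b + a) + K * int (length (p @ v @ r))"
    by (rule min[OF _ e]) (use ll vl in simp)
  then have "K * int (length u) \<le> l (act (ev r) b) + K * int (length v)"
    using add_hom_add[OF Lam_hom[OF l]] w by (simp add: algebra_simps)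
  moreover have "l (act (ev r) b) \<le> N b" using Lam_abs[OF l, of "act (ev r) b"] N_act'[of "ev r" b] ll by simp
  moreover have "N b \<le> C1 * int (length u + length v)" using C1(2)[OF ll(2) vl(1) lu] .
  ultimately have "(C1 + 1) * int (length u) \<le> (3 * C1 + 1) * int (length v)" by (simp add: K_def algebra_simps)
  also have "\<dots> \<le> (C1 + 1) * (3 * int (length v))" by (simp add: algebra_simps)
  finally have "int (length u) \<le> 3 * int (length v)" using C1(1) by (simp add: mult_le_cancel_left_pos)
  then show "length u \<le> 3 * ln (ev u)" using vl by simp
qed

text \<open>The two parts of a minimising word cost at most their shares of the total, and
  \<open>Phi_mult\<close> gives the other inequality. So \<open>Phi_mult\<close> is sharp along
  prefixes of minimising words.\<close>

lemma Phi_split: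
  assumes l: "l \<in> Lam" and e: "e \<in> carrier E" and o: "opt l e (p @ r) a" "Phi l e = l a + K * int (length (p @ r))"
  shows "Phi l e = Phi (l \<circ> act (\<pi> (invE (lift p) \<star> e))) (lift p) + Phi l (invE (lift p) \<star> e)"
proof -
  have ll: "p \<in> lists X" "r \<in> lists X" using o(1) by (auto simp: opt_def)
  have pE: "lift p \<in> carrier E" using ll by auto
  have le: "Phi l e \<le> Phi (l \<circ> act (\<pi> (invE (lift p) \<star> e))) (lift p) + Phi l (invE (lift p) \<star> e)"
    using Phi_mult[OF l pE, of "invE (lift p) \<star> e"] E_cancel(1)[OF pE e] e pE by simp
  let ?l = "l \<circ> act (\<pi> (invE (lift p) \<star> e))"
  have l': "?l \<in> Lam" using Lam_act l e pE by auto
  have "Phi ?l (lift p) \<le> K * int (length p)"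
    using Phi_le[OF l' ll(1), of 0] pE add_hom_0[OF Lam_hom[OF l']] by simp
  moreover have "invE (lift p) \<star> e = lift r \<star> \<iota> a"
    using o(1) ll E_cancel(2)[of "lift p" "lift r \<star> \<iota> a"] by (simp add: opt_def lift_append E.m_assoc)
  then have "Phi l (invE (lift p) \<star> e) \<le> l a + K * int (length r)" using Phi_le[OF l ll(2)] by simp
  ultimately show ?thesis using le o(2) by (simp add: algebra_simps)
qed

definition PB :: "'e \<Rightarrow> int" where "PB e = Max (insert 0 ((\<lambda>l. \<bar>Phi l e\<bar>) ` Lam))"

lemma PB: "l \<in> Lam \<Longrightarrow> \<bar>Phi l e\<bar> \<le> PB e" unfolding PB_def using finite_Lam by (intro Max_ge) auto

lemma Phi_right:
  assumes l: "l \<in> Lam" and e: "e \<in> carrier E" "e' \<in> carrier E"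
  shows "\<bar>Phi l (e \<star> e') - Phi (l \<circ> act (\<pi> e')) e\<bar> \<le> PB e' + PB (invE e')"
proof -
  let ?l = "l \<circ> act (\<pi> e')"
  have l': "?l \<in> Lam" using Lam_act l e by auto
  have "?l \<circ> act (\<pi> (invE e')) = l" using e by (auto simp: fun_eq_iff)
  moreover have "e \<star> e' \<star> invE e' = e" using e by (simp add: E.m_assoc)
  ultimately have "Phi ?l e \<le> Phi l (e \<star> e') + Phi ?l (invE e')"
    using Phi_mult[OF l', of "e \<star> e'" "invE e'"] e by simp
  moreover have "Phi l (e \<star> e') \<le> Phi ?l e + Phi l e'" using Phi_mult[OF l e] .
  ultimately show ?thesis using PB[OF l, of e'] PB[OF l', of "invE e'"] PB[OF l, of "invE e'"] PB[OF l', of e'] by linarith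
qed

lemma Phi_left:
  assumes l: "l \<in> Lam" and e: "e \<in> carrier E" "e' \<in> carrier E"
  shows "\<bar>Phi l (e' \<star> e) - Phi l e\<bar> \<le> PB e' + PB (invE e')"
proof -
  have "Phi l (e' \<star> e) \<le> Phi (l \<circ> act (\<pi> e)) e' + Phi l e" using Phi_mult[OF l e(2,1)] .
  moreover have "Phi l e \<le> Phi (l \<circ> act (\<pi> (e' \<star> e))) (invE e') + Phi l (e' \<star> e)"
    using Phi_mult[OF l, of "invE e'" "e' \<star> e"] e E_cancel by simp
  moreover have "l \<circ> act (\<pi> e) \<in> Lam" "l \<circ> act (\<pi> (e' \<star> e)) \<in> Lam" using Lam_act l e by auto
  ultimately show ?thesis using PB[of "l \<circ> act (\<pi> e)" e'] PB[of "l \<circ> act (\<pi> (e' \<star> e))" "invE e'"]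
    PB[OF l, of e'] PB[OF l, of "invE e'"] by linarith
qed

definition Psi :: "'e \<Rightarrow> 'a" where "Psi e = psi (\<lambda>l. Phi l e)"

lemma Psi_iota: "e \<in> carrier E \<Longrightarrow> Psi (e \<star> \<iota> a) = Psi e + zs mm a"
proof -
  assume e: "e \<in> carrier E"
  have "Psi (e \<star> \<iota> a) = psi (\<lambda>l. Phi l e + l a)" unfolding Psi_def using Phi_iota e by (intro psi_cong) auto
  then show ?thesis by (simp only: psi_add psi_eval Psi_def)
qed

lemma Psi_right: "e' \<in> carrier E \<Longrightarrow> finite {Psi (e \<star> e') - act (\<pi> e') (Psi e) | e. e \<in> carrier E}" (is "_ \<Longrightarrow> finite ?S")
proof -
  assume e': "e' \<in> carrier E"
  have "?S \<subseteq> psi ` {F. \<forall>l\<in>Lam. \<bar>F l\<bar> \<le> PB e' + PB (invE e')}"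
  proof
    fix x assume "x \<in> ?S"
    then obtain e where e: "e \<in> carrier E" "x = Psi (e \<star> e') - act (\<pi> e') (Psi e)" by auto
    have "x = psi (\<lambda>l. Phi l (e \<star> e') - Phi (l \<circ> act (\<pi> e')) e)"
      unfolding e(2) Psi_def psi_act[OF act_H[OF pi_closed[OF e']]] by (simp only: psi_diff)
    moreover have "(\<lambda>l. Phi l (e \<star> e') - Phi (l \<circ> act (\<pi> e')) e) \<in> {F. \<forall>l\<in>Lam. \<bar>F l\<bar> \<le> PB e' + PB (invE e')}"
      using Phi_right e e' by blast
    ultimately show "x \<in> psi ` {F. \<forall>l\<in>Lam. \<bar>F l\<bar> \<le> PB e' + PB (invE e')}" by (rule image_eqI)
  qed
  then show ?thesis by (rule finite_subset) (rule psi_finite)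
qed

lemma Psi_left: "e' \<in> carrier E \<Longrightarrow> finite {Psi (e' \<star> e) - Psi e | e. e \<in> carrier E}" (is "_ \<Longrightarrow> finite ?S")
proof -
  assume e': "e' \<in> carrier E"
  have "?S \<subseteq> psi ` {F. \<forall>l\<in>Lam. \<bar>F l\<bar> \<le> PB e' + PB (invE e')}"
  proof
    fix x assume "x \<in> ?S"
    then obtain e where e: "e \<in> carrier E" "x = Psi (e' \<star> e) - Psi e" by auto
    have "x = psi (\<lambda>l. Phi l (e' \<star> e) - Phi l e)" unfolding e(2) Psi_def by (simp only: psi_diff)
    moreover have "(\<lambda>l. Phi l (e' \<star> e) - Phi l e) \<in> {F. \<forall>l\<in>Lam. \<bar>F l\<bar> \<le> PB e' + PB (invE e')}"
      using Phi_left e e' by blast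
    ultimately show "x \<in> psi ` {F. \<forall>l\<in>Lam. \<bar>F l\<bar> \<le> PB e' + PB (invE e')}" by (rule image_eqI)
  qed
  then show ?thesis by (rule finite_subset) (rule psi_finite)
qed

section \<open>The section and its cocycle\<close>

definition Rset :: "'a set" where
  "Rset = insert (Psi oneE) (SOME R. finite R \<and> (\<forall>a. \<exists>x. a - zs mm x \<in> R))"
definition ch :: "'a \<Rightarrow> 'a" where "ch y = (SOME a. y + zs mm a \<in> Rset)"

lemma Rset: "finite Rset" "\<exists>a. y + zs mm a \<in> Rset" "Psi oneE \<in> Rset"
proof -
  let ?R = "SOME R. finite R \<and> (\<forall>a::'a. \<exists>x. a - zs mm x \<in> R)"
  have R: "finite ?R \<and> (\<forall>a. \<exists>x. a - zs mm x \<in> ?R)" using fin_quot[OF mm_pos] by (rule someI_ex)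
  then obtain x where "y - zs mm x \<in> ?R" by blast
  then have "y + zs mm (- x) \<in> Rset" by (simp add: Rset_def)
  then show "\<exists>a. y + zs mm a \<in> Rset" by blast
  show "finite Rset" "Psi oneE \<in> Rset" using R by (auto simp: Rset_def)
qed

lemma ch: "y + zs mm (ch y) \<in> Rset" unfolding ch_def using Rset(2) by (rule someI_ex)

text \<open>The letters in which geodesics for g can end. \<open>lastx\<close> depends on g only
  through this set, so elements with the same relative lengths of neighbours make the same
  choice.\<close>

definition Dset :: "'g \<Rightarrow> 'g set" where "Dset g = {x \<in> X. ln (g \<otimes> inv x) < ln g}"
definition lastx :: "'g \<Rightarrow> 'g" where "lastx g = (SOME x. x \<in> Dset g)"
definition nxt :: "'e \<Rightarrow> 'g \<Rightarrow> 'e" where "nxt e x = (e \<star> hat x) \<star> \<iota> (ch (Psi (e \<star> hat x)))"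

text \<open>The value at g depends only on the value one step back, the last letter and
  \<open>Psi\<close> after appending that letter. The argument n is the length of g and makes the
  recursion primitive.\<close>

primrec sn :: "nat \<Rightarrow> 'g \<Rightarrow> 'e" where
  "sn 0 g = oneE"
| "sn (Suc n) g = nxt (sn n (g \<otimes> inv (lastx g))) (lastx g)"

definition s :: "'g \<Rightarrow> 'e" where "s g = sn (ln g) g"

lemma inv_cancel_right: "g \<in> carrier G \<Longrightarrow> x \<in> carrier G \<Longrightarrow> g \<otimes> inv x \<otimes> x = g" "g \<in> carrier G \<Longrightarrow> x \<in> carrier G \<Longrightarrow> g \<otimes> x \<otimes> inv x = g"
  by (simp_all add: m_assoc)

lemma lastx:
  assumes g: "g \<in> carrier G" "g \<noteq> \<one>"
  shows "lastx g \<in> X" "Suc (ln (g \<otimes> inv (lastx g))) = ln g" "lastx g \<in> Dset g"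
proof -
  obtain w where w: "w \<in> geodesics G X" "ev w = g" using geod_ex g by blast
  have "w \<noteq> []" using w g by auto
  then obtain v x where v: "w = v @ [x]" by (metis rev_exhaust)
  have x: "v \<in> lists X" "x \<in> X" "x \<in> carrier G" using geod_lists[OF w(1)] v X_sub by auto
  have "g = ev v \<otimes> x" using w v x by (auto simp: ev_append)
  then have "g \<otimes> inv x = ev v" using x inv_cancel_right(2) by simp
  moreover have "ln (ev v) < ln g" using geod_factor(1)[of v "[x]"] w v geod_len by (metis length_append_singleton lessI)
  ultimately have "x \<in> Dset g" using x by (simp add: Dset_def)
  then show D: "lastx g \<in> Dset g" unfolding lastx_def by (rule someI)
  then show lX: "lastx g \<in> X" by (simp add: Dset_def)
  then have c: "lastx g \<in> carrier G" using X_sub by auto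
  have "ln g \<le> ln (g \<otimes> inv (lastx g)) + ln (lastx g)"
    using ln_mult[of "g \<otimes> inv (lastx g)" "lastx g"] inv_cancel_right g c by simp
  then show "Suc (ln (g \<otimes> inv (lastx g))) = ln g" using ln_gen[OF lX] D by (simp add: Dset_def)
qed

lemma s_one [simp]: "s \<one> = oneE" by (simp add: s_def)

lemma s_step: "g \<in> carrier G \<Longrightarrow> g \<noteq> \<one> \<Longrightarrow> s g = nxt (s (g \<otimes> inv (lastx g))) (lastx g)"
  unfolding s_def by (simp flip: lastx(2))

lemma nxt: assumes "e \<in> carrier E" "x \<in> X"
  shows "nxt e x \<in> carrier E" "\<pi> (nxt e x) = \<pi> e \<otimes> x" "Psi (nxt e x) \<in> Rset"
proof -
  have x: "x \<in> carrier G" using assms X_sub by auto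
  show "nxt e x \<in> carrier E" "\<pi> (nxt e x) = \<pi> e \<otimes> x" unfolding nxt_def using assms x by auto
  show "Psi (nxt e x) \<in> Rset" unfolding nxt_def using assms x by (simp add: Psi_iota ch)
qed

lemma s_props: "g \<in> carrier G \<Longrightarrow> s g \<in> carrier E \<and> \<pi> (s g) = g \<and> Psi (s g) \<in> Rset"
proof (induction "ln g" arbitrary: g rule: less_induct)
  case less
  show ?case
  proof (cases "g = \<one>")
    case True
    then show ?thesis using Rset by simp
  next
    case False
    have l: "lastx g \<in> X" "lastx g \<in> carrier G" using lastx[OF less.prems False] X_sub by auto
    let ?h = "g \<otimes> inv (lastx g)"
    have "ln ?h < ln g" using lastx(2)[OF less.prems False] by simp
    then have "s ?h \<in> carrier E \<and> \<pi> (s ?h) = ?h \<and> Psi (s ?h) \<in> Rset" using less l by simp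
    then show ?thesis unfolding s_step[OF less.prems False] using nxt[OF _ l(1)] inv_cancel_right[OF less.prems l(2)] by simp
  qed
qed

lemma s_closed [simp]: "g \<in> carrier G \<Longrightarrow> s g \<in> carrier E" and pi_s [simp]: "g \<in> carrier G \<Longrightarrow> \<pi> (s g) = g"
  and Psi_s: "g \<in> carrier G \<Longrightarrow> Psi (s g) \<in> Rset"
  using s_props by auto

definition tau :: "'g \<Rightarrow> 'g \<Rightarrow> 'a" where "tau g h = fd (s (g \<otimes> h)) (s g \<star> s h)"

lemma tau: "g \<in> carrier G \<Longrightarrow> h \<in> carrier G \<Longrightarrow> s (g \<otimes> h) \<star> \<iota> (tau g h) = s g \<star> s h"
  unfolding tau_def by (rule fd) auto

lemma finite_Psi_diff:
  assumes "finite K1" "finite K2"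
  shows "finite {a. \<exists>e\<in>carrier E. Psi e \<in> K1 \<and> Psi (e \<star> \<iota> a) \<in> K2}"
proof -
  have "{a. \<exists>e\<in>carrier E. Psi e \<in> K1 \<and> Psi (e \<star> \<iota> a) \<in> K2} \<subseteq> {a. zs mm a \<in> (\<lambda>(x, y). y - x) ` (K1 \<times> K2)}"
    by (auto simp: Psi_iota image_iff intro!: bexI)
  then show ?thesis by (rule finite_subset) (rule finite_zs_preimage[OF mm_pos], use assms in auto)
qed

lemma finite_act: "finite Q \<Longrightarrow> finite {act g a | g a. g \<in> carrier G \<and> a \<in> Q}"
proof -
  assume "finite Q"
  then have "finite ((\<lambda>(\<eta>, a). \<eta> a) ` (H \<times> Q))" using finH by auto
  moreover have "{act g a | g a. g \<in> carrier G \<and> a \<in> Q} \<subseteq> (\<lambda>(\<eta>, a). \<eta> a) ` (H \<times> Q)" using act_H by force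
  ultimately show ?thesis by (rule finite_subset[rotated])
qed

lemma finite_left: "e' \<in> carrier E \<Longrightarrow> finite Q \<Longrightarrow> finite {Psi (e' \<star> e) | e. e \<in> carrier E \<and> Psi e \<in> Q}" (is "_ \<Longrightarrow> _ \<Longrightarrow> finite ?S")
proof -
  assume e': "e' \<in> carrier E" and Q: "finite Q"
  have "?S \<subseteq> (\<lambda>(x, y). x + y) ` ({Psi (e' \<star> e) - Psi e | e. e \<in> carrier E} \<times> Q)"
  proof
    fix y assume "y \<in> ?S"
    then obtain e where e: "y = Psi (e' \<star> e)" "e \<in> carrier E" "Psi e \<in> Q" by auto
    show "y \<in> (\<lambda>(x, y). x + y) ` ({Psi (e' \<star> e) - Psi e | e. e \<in> carrier E} \<times> Q)"
      by (rule image_eqI[of _ _ "(Psi (e' \<star> e) - Psi e, Psi e)"]) (use e in auto)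
  qed
  then show ?thesis by (rule finite_subset) (use Psi_left[OF e'] Q in auto)
qed

lemma finite_right: "e' \<in> carrier E \<Longrightarrow> finite Q \<Longrightarrow> finite {Psi (e \<star> e') | e. e \<in> carrier E \<and> Psi e \<in> Q}" (is "_ \<Longrightarrow> _ \<Longrightarrow> finite ?S")
proof -
  assume e': "e' \<in> carrier E" and Q: "finite Q"
  let ?T = "{Psi (e \<star> e') - act (\<pi> e') (Psi e) | e. e \<in> carrier E} \<times> act (\<pi> e') ` Q"
  have "?S \<subseteq> (\<lambda>(x, y). x + y) ` ?T"
  proof
    fix y assume "y \<in> ?S"
    then obtain e where e: "y = Psi (e \<star> e')" "e \<in> carrier E" "Psi e \<in> Q" by auto
    show "y \<in> (\<lambda>(x, y). x + y) ` ?T"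
      by (rule image_eqI[of _ _ "(Psi (e \<star> e') - act (\<pi> e') (Psi e), act (\<pi> e') (Psi e))"]) (use e in auto)
  qed
  then show ?thesis by (rule finite_subset) (use Psi_right[OF e'] Q in auto)
qed

text \<open>Both \<open>s (g \<otimes> h)\<close> and \<open>s g \<star> s h\<close> lie over the
  same element and have \<open>Psi\<close> in finite sets that do not depend on h, because left
  multiplication by \<open>s g\<close> moves \<open>Psi\<close> by a bounded amount.\<close>

lemma tau_finite_left: "g \<in> carrier G \<Longrightarrow> finite (tau g ` carrier G)"
proof -
  assume g: "g \<in> carrier G"
  let ?K = "{Psi (s g \<star> e) | e. e \<in> carrier E \<and> Psi e \<in> Rset}"
  have "tau g ` carrier G \<subseteq> {a. \<exists>e\<in>carrier E. Psi e \<in> Rset \<and> Psi (e \<star> \<iota> a) \<in> ?K}"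
  proof (rule image_subsetI)
    fix h assume h: "h \<in> carrier G"
    have "Psi (s g \<star> s h) \<in> ?K" by (intro CollectI exI[of _ "s h"] conjI refl s_closed Psi_s h)
    then show "tau g h \<in> {a. \<exists>e\<in>carrier E. Psi e \<in> Rset \<and> Psi (e \<star> \<iota> a) \<in> ?K}"
      unfolding mem_Collect_eq using tau[OF g h] Psi_s[of "g \<otimes> h"] g h by (intro bexI[of _ "s (g \<otimes> h)"] conjI) simp_all
  qed
  then show ?thesis by (rule finite_subset) (intro finite_Psi_diff finite_left Rset(1) s_closed g)
qed

lemma tau_finite_right: "g \<in> carrier G \<Longrightarrow> finite ((\<lambda>h. tau h g) ` carrier G)"
proof -
  assume g: "g \<in> carrier G"
  let ?K = "{Psi (e \<star> s g) | e. e \<in> carrier E \<and> Psi e \<in> Rset}"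
  have "(\<lambda>h. tau h g) ` carrier G \<subseteq> {a. \<exists>e\<in>carrier E. Psi e \<in> Rset \<and> Psi (e \<star> \<iota> a) \<in> ?K}"
  proof (rule image_subsetI)
    fix h assume h: "h \<in> carrier G"
    have "Psi (s h \<star> s g) \<in> ?K" by (intro CollectI exI[of _ "s h"] conjI refl s_closed Psi_s h)
    then show "tau h g \<in> {a. \<exists>e\<in>carrier E. Psi e \<in> Rset \<and> Psi (e \<star> \<iota> a) \<in> ?K}"
      unfolding mem_Collect_eq using tau[OF h g] Psi_s[of "h \<otimes> g"] g h by (intro bexI[of _ "s (h \<otimes> g)"] conjI) simp_all
  qed
  then show ?thesis by (rule finite_subset) (intro finite_Psi_diff finite_right Rset(1) s_closed g)
qed

end

section \<open>Finiteness of types and regularity\<close>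

context ext begin

definition ball :: "nat \<Rightarrow> 'g set" where "ball n = {h \<in> carrier G. ln h \<le> n}"

lemma finite_ball': "finite (ball n)" unfolding ball_def by (rule finite_ball)

lemma s_ratio: "g \<in> carrier G \<Longrightarrow> h \<in> carrier G \<Longrightarrow> invE (s g) \<star> s (g \<otimes> h) = s h \<star> \<iota> (- tau g h)"
proof -
  assume g: "g \<in> carrier G" "h \<in> carrier G"
  have "s (g \<otimes> h) \<star> \<iota> (tau g h) \<star> \<iota> (- tau g h) = s (g \<otimes> h)" using g by (simp add: E.m_assoc flip: iota_add)
  then have "s (g \<otimes> h) = s g \<star> (s h \<star> \<iota> (- tau g h))" unfolding tau[OF g] using g by (simp add: E.m_assoc)
  then show ?thesis using g E_cancel(2)[of "s g" "s h \<star> \<iota> (- tau g h)"] by simp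
qed

definition ratios :: "'g \<Rightarrow> 'e set" where "ratios h = (\<lambda>g. invE (s g) \<star> s (g \<otimes> h)) ` carrier G"

lemma finite_ratios: "h \<in> carrier G \<Longrightarrow> finite (ratios h)"
proof -
  assume h: "h \<in> carrier G"
  have "ratios h \<subseteq> (\<lambda>a. s h \<star> \<iota> (- a)) ` (\<lambda>g. tau g h) ` carrier G"
    unfolding ratios_def using s_ratio[OF _ h] by auto
  then show ?thesis by (rule finite_subset) (intro finite_imageI tau_finite_right h)
qed

text \<open>The finite data around g. Lengths, values of s and values of \<open>Phi\<close> are all
  recorded relative to g, since only differences are bounded. The functional is twisted by h because
  that is how \<open>Phi\<close> at \<open>s g\<close> enters for elements over gh
  (\<open>Phi_right\<close>). The last component makes the offsets between two elements of equal
  type cancel in \<open>Psi_sim\<close>.\<close>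

definition gtyp :: "nat \<Rightarrow> 'g \<Rightarrow> ('g \<Rightarrow> int) \<times> ('g \<Rightarrow> 'e) \<times> ('g \<times> ('a \<Rightarrow> int) \<Rightarrow> int) \<times> 'a" where
  "gtyp n g = (restrict (\<lambda>h. int (ln (g \<otimes> h)) - int (ln g)) (ball n),
     restrict (\<lambda>h. invE (s g) \<star> s (g \<otimes> h)) (ball n),
     restrict (\<lambda>(h, l). Phi l (s (g \<otimes> h)) - Phi (l \<circ> act h) (s g)) (ball n \<times> Lam), Psi (s g))"

lemma finite_gtyp: "finite (gtyp n ` carrier G)"
proof -
  define b where "b = (\<lambda>h. Max (insert 0 ((\<lambda>e. PB e + PB (invE e)) ` ratios h)))"
  let ?A = "PiE (ball n) (\<lambda>_. {- int n .. int n})"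
  let ?B = "PiE (ball n) ratios"
  let ?C = "PiE (ball n \<times> Lam) (\<lambda>(h, l). {- b h .. b h})"
  have bC: "h \<in> ball n \<Longrightarrow> h \<in> carrier G" for h by (simp add: ball_def)
  have "gtyp n g \<in> ?A \<times> ?B \<times> ?C \<times> Rset" if g: "g \<in> carrier G" for g
  proof -
    have 1: "int (ln (g \<otimes> h)) - int (ln g) \<in> {- int n .. int n}" if h: "h \<in> ball n" for h
    proof -
      have hc: "h \<in> carrier G" "ln h \<le> n" using h by (auto simp: ball_def)
      have "ln (g \<otimes> h) \<le> ln g + ln h" using ln_mult g hc by simp
      moreover have "ln g \<le> ln (g \<otimes> h) + ln (inv h)" using ln_mult[of "g \<otimes> h" "inv h"] g hc inv_cancel_right by simp
      ultimately show ?thesis using hc ln_inv by simp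
    qed
    have 3: "Phi l (s (g \<otimes> h)) - Phi (l \<circ> act h) (s g) \<in> {- b h .. b h}" if h: "h \<in> ball n" and l: "l \<in> Lam" for h l
    proof -
      have hc: "h \<in> carrier G" using h bC by simp
      let ?e = "invE (s g) \<star> s (g \<otimes> h)"
      have e: "?e \<in> ratios h" "?e \<in> carrier E" "\<pi> ?e = h" "s g \<star> ?e = s (g \<otimes> h)"
        using g hc E_cancel by (auto simp: ratios_def m_assoc[symmetric])
      have "\<bar>Phi l (s g \<star> ?e) - Phi (l \<circ> act (\<pi> ?e)) (s g)\<bar> \<le> PB ?e + PB (invE ?e)"
        by (rule Phi_right[OF l]) (use g e in auto)
      also have "\<dots> \<le> b h" unfolding b_def using finite_ratios[OF hc] e(1) by (intro Max_ge) auto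
      finally show ?thesis unfolding e(3,4) by (simp add: abs_le_iff)
    qed
    show ?thesis unfolding gtyp_def
      using 1 3 bC g Psi_s by (auto simp: ratios_def)
  qed
  then have "gtyp n ` carrier G \<subseteq> ?A \<times> ?B \<times> ?C \<times> Rset" by blast
  moreover have "finite (?A \<times> ?B \<times> ?C \<times> Rset)"
    using finite_ball' finite_Lam finite_ratios bC Rset(1)
    by (intro finite_cartesian_product finite_PiE) (auto split: prod.splits)
  ultimately show ?thesis by (rule finite_subset)
qed

definition sim :: "nat \<Rightarrow> 'g \<Rightarrow> 'g \<Rightarrow> bool" where
  "sim n g g' \<longleftrightarrow> (\<forall>h\<in>ball n. int (ln (g \<otimes> h)) - int (ln g) = int (ln (g' \<otimes> h)) - int (ln g')
     \<and> invE (s g) \<star> s (g \<otimes> h) = invE (s g') \<star> s (g' \<otimes> h)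
     \<and> (\<forall>l\<in>Lam. Phi l (s (g \<otimes> h)) - Phi (l \<circ> act h) (s g) = Phi l (s (g' \<otimes> h)) - Phi (l \<circ> act h) (s g')))
     \<and> Psi (s g) = Psi (s g')"

lemma sim_sym: "sim n g g' \<Longrightarrow> sim n g' g" unfolding sim_def by metis

lemma sim_mono: "sim n g g' \<Longrightarrow> k \<le> n \<Longrightarrow> sim k g g'" unfolding sim_def ball_def by auto

lemma gtyp_sim: "gtyp n g = gtyp n g' \<Longrightarrow> sim n g g'"
  unfolding gtyp_def sim_def
proof (intro conjI ballI)
  assume t: "(restrict (\<lambda>h. int (ln (g \<otimes> h)) - int (ln g)) (ball n),
     restrict (\<lambda>h. invE (s g) \<star> s (g \<otimes> h)) (ball n),
     restrict (\<lambda>(h, l). Phi l (s (g \<otimes> h)) - Phi (l \<circ> act h) (s g)) (ball n \<times> Lam), Psi (s g)) =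
    (restrict (\<lambda>h. int (ln (g' \<otimes> h)) - int (ln g')) (ball n),
     restrict (\<lambda>h. invE (s g') \<star> s (g' \<otimes> h)) (ball n),
     restrict (\<lambda>(h, l). Phi l (s (g' \<otimes> h)) - Phi (l \<circ> act h) (s g')) (ball n \<times> Lam), Psi (s g'))"
  then show "Psi (s g) = Psi (s g')" by simp
  fix h assume h: "h \<in> ball n"
  show "int (ln (g \<otimes> h)) - int (ln g) = int (ln (g' \<otimes> h)) - int (ln g')"
    using fun_cong[of "fst _" "fst _" h, OF arg_cong[OF t, of fst]] h by simp
  show "invE (s g) \<star> s (g \<otimes> h) = invE (s g') \<star> s (g' \<otimes> h)"
    using fun_cong[OF arg_cong[OF t, of "\<lambda>x. fst (snd x)"], of h] h by simp
  fix l assume l: "l \<in> Lam"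
  show "Phi l (s (g \<otimes> h)) - Phi (l \<circ> act h) (s g) = Phi l (s (g' \<otimes> h)) - Phi (l \<circ> act h) (s g')"
    using fun_cong[OF arg_cong[OF t, of "\<lambda>x. fst (snd (snd x))"], of "(h, l)"] h l by simp
qed

section \<open>Cone types and the values of s beyond g\<close>

definition cone :: "'g \<Rightarrow> 'g set" where "cone g = {z \<in> carrier G. ln (g \<otimes> z) = ln g + ln z}"

definition near :: "nat \<Rightarrow> nat" where
  "near M = (SOME N. \<forall>g\<in>carrier G. \<forall>z\<in>carrier G. \<forall>h\<in>carrier G. \<forall>w. ln (g \<otimes> z) = ln g + ln z \<longrightarrow> ln h \<le> M
     \<longrightarrow> wquasi 3 w \<longrightarrow> ev w = g \<otimes> z \<otimes> h \<longrightarrow> (\<exists>p r. w = p @ r \<and> dd g (ev p) \<le> N))"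

lemma near:
  assumes "g \<in> carrier G" "z \<in> cone g" "h \<in> carrier G" "ln h \<le> M" "wquasi 3 w" "ev w = g \<otimes> z \<otimes> h"
  obtains p r h' where "w = p @ r" "h' \<in> ball (near M)" "ev p = g \<otimes> h'" "p \<in> lists X" "r \<in> lists X"
proof -
  have "\<exists>p r. w = p @ r \<and> dd g (ev p) \<le> near M"
    using someI_ex[OF pass_near[of M 3]] assms unfolding near_def[symmetric] cone_def by blast
  then obtain p r where pr: "w = p @ r" "dd g (ev p) \<le> near M" by blast
  have l: "p \<in> lists X" "r \<in> lists X" using assms(5) pr by (auto simp: wquasi_def)
  have "inv g \<otimes> ev p \<in> ball (near M)" "ev p = g \<otimes> (inv g \<otimes> ev p)"
    using pr l assms(1) by (simp_all add: ball_def word_dist_def inv_solve)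
  then show ?thesis using that pr l by blast
qed

lemma geod_wquasi: "w \<in> geodesics G X \<Longrightarrow> wquasi 3 w"
proof -
  assume w: "w \<in> geodesics G X"
  have "length u \<le> 3 * ln (ev u)" if "w = p @ u @ r" for p u r
  proof -
    have "u \<in> geodesics G X" using geod_factor(1)[OF geod_factor(2)] w that by metis
    then show ?thesis using geod_len by simp
  qed
  then show ?thesis using geod_lists[OF w] by (simp add: wquasi_def)
qed

lemma coneD: "z \<in> cone g \<Longrightarrow> z \<in> carrier G" "z \<in> cone g \<Longrightarrow> ln (g \<otimes> z) = ln g + ln z"
  by (auto simp: cone_def)

text \<open>A geodesic to gzh passes near g, say through gh', and its tail r also leads from g'h' to
  g'zh. The types compare gh' with g'h'.\<close>

lemma len_sim_le:
  assumes S: "sim (near M) g g'" and g: "g \<in> carrier G" "g' \<in> carrier G" and z: "z \<in> cone g"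
    and h: "h \<in> carrier G" "ln h \<le> M"
  shows "int (ln (g' \<otimes> z \<otimes> h)) - int (ln g') \<le> int (ln (g \<otimes> z \<otimes> h)) - int (ln g)"
proof -
  have zc: "z \<in> carrier G" using z by (rule coneD)
  obtain w where w: "w \<in> geodesics G X" "ev w = g \<otimes> z \<otimes> h" using geod_ex[of "g \<otimes> z \<otimes> h"] g zc h by auto
  obtain p r h' where p: "w = p @ r" "h' \<in> ball (near M)" "ev p = g \<otimes> h'" "p \<in> lists X" "r \<in> lists X"
    using near[OF g(1) z h geod_wquasi[OF w(1)] w(2)] by blast
  have hc: "h' \<in> carrier G" using p by (simp add: ball_def)
  have "g \<otimes> h' \<otimes> ev r = g \<otimes> (z \<otimes> h)" using w p g zc h by (simp add: ev_append m_assoc)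
  then have r: "h' \<otimes> ev r = z \<otimes> h" using g zc h hc p by (simp add: m_assoc)
  have "ln (g \<otimes> z \<otimes> h) = ln (g \<otimes> h') + ln (ev r)" using geod_factor(3)[of p r] w p by simp
  moreover have "g' \<otimes> z \<otimes> h = (g' \<otimes> h') \<otimes> ev r" using r g zc h hc p by (simp add: m_assoc)
  then have "ln (g' \<otimes> z \<otimes> h) \<le> ln (g' \<otimes> h') + ln (ev r)" using ln_mult g hc p by simp
  moreover have "int (ln (g \<otimes> h')) - int (ln g) = int (ln (g' \<otimes> h')) - int (ln g')"
    using S p(2) by (simp add: sim_def)
  ultimately show ?thesis by linarith
qed

lemma len_sim:
  assumes S: "sim (near M) g g'" and g: "g \<in> carrier G" "g' \<in> carrier G" and z: "z \<in> cone g" "z \<in> cone g'"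
    and h: "h \<in> carrier G" "ln h \<le> M"
  shows "int (ln (g' \<otimes> z \<otimes> h)) - int (ln g') = int (ln (g \<otimes> z \<otimes> h)) - int (ln g)"
  using len_sim_le[OF S g z(1) h] len_sim_le[OF sim_sym[OF S] g(2,1) z(2) h] by simp

text \<open>Cannon's argument, one letter at a time: the predecessor z' lies in both cones by
  induction, so \<open>len_sim\<close> with M = 1 compares the lengths of gz'x and g'z'x.\<close>

lemma cone_sim:
  assumes S: "sim (near 1) g g'" and g: "g \<in> carrier G" "g' \<in> carrier G"
  shows "z \<in> cone g \<Longrightarrow> z \<in> cone g'"
proof (induction "ln z" arbitrary: z)
  case 0
  then have "z = \<one>" using ln_eq_0 coneD by metis
  then show ?case using g by (simp add: cone_def)
next
  case (Suc n)
  have zc: "z \<in> carrier G" using Suc.prems by (rule coneD)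
  have "z \<noteq> \<one>" using Suc.hyps(2) by auto
  then have lx: "lastx z \<in> X" "Suc (ln (z \<otimes> inv (lastx z))) = ln z" using lastx zc by auto
  define x where "x = lastx z"
  define z' where "z' = z \<otimes> inv x"
  have x: "x \<in> X" "x \<in> carrier G" using lx X_sub by (auto simp: x_def)
  have z': "z' \<in> carrier G" "ln z' = n" "z = z' \<otimes> x" using lx zc x Suc.hyps(2) inv_cancel_right by (auto simp: z'_def x_def)
  have "ln (g \<otimes> z) \<le> ln (g \<otimes> z') + ln x" using ln_mult[of "g \<otimes> z'" x] g z' x by (simp add: m_assoc)
  moreover have "ln (g \<otimes> z') \<le> ln g + ln z'" by (rule ln_mult[OF g(1) z'(1)])
  moreover have "ln (g \<otimes> z) = ln g + ln z" using Suc.prems by (rule coneD)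
  ultimately have "z' \<in> cone g" using ln_gen[OF x(1)] z' Suc.hyps(2) by (simp add: cone_def)
  moreover then have "z' \<in> cone g'" using Suc.hyps(1) z' by blast
  ultimately have "int (ln (g' \<otimes> z' \<otimes> x)) - int (ln g') = int (ln (g \<otimes> z' \<otimes> x)) - int (ln g)"
    using len_sim[OF S g _ _ x(2)] ln_gen[OF x(1)] by simp
  moreover have "g' \<otimes> z' \<otimes> x = g' \<otimes> z" "g \<otimes> z' \<otimes> x = g \<otimes> z" using z' g x by (simp_all add: m_assoc)
  ultimately have "ln (g' \<otimes> z) = ln g' + ln z" using coneD(2)[OF Suc.prems] by simp
  then show ?case using zc by (simp add: cone_def)
qed

text \<open>Left translation by this element carries \<open>s g\<close> to \<open>s g'\<close> and,
  as long as the types agree, the picture around g to that around g'.\<close>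

definition th :: "'g \<Rightarrow> 'g \<Rightarrow> 'e" where "th g g' = s g' \<star> invE (s g)"

lemma th: "g \<in> carrier G \<Longrightarrow> g' \<in> carrier G \<Longrightarrow> th g g' \<in> carrier E" "g \<in> carrier G \<Longrightarrow> g' \<in> carrier G \<Longrightarrow> \<pi> (th g g') = g' \<otimes> inv g"
  by (simp_all add: th_def)

lemma th_th: "g \<in> carrier G \<Longrightarrow> g' \<in> carrier G \<Longrightarrow> e \<in> carrier E \<Longrightarrow> th g' g \<star> (th g g' \<star> e) = e"
  unfolding th_def using E_cancel[of "s g'" "invE (s g) \<star> e"] E_cancel(1)[of "s g" e] by (simp add: E.m_assoc)

lemma sim_s: 
  assumes S: "sim n g g'" and g: "g \<in> carrier G" "g' \<in> carrier G" and h: "h \<in> ball n"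
  shows "s (g' \<otimes> h) = th g g' \<star> s (g \<otimes> h)"
proof -
  have hc: "h \<in> carrier G" using h by (simp add: ball_def)
  have "s (g' \<otimes> h) = s g' \<star> (invE (s g') \<star> s (g' \<otimes> h))" using g hc by (simp add: E_cancel)
  also have "invE (s g') \<star> s (g' \<otimes> h) = invE (s g) \<star> s (g \<otimes> h)" using S h by (simp add: sim_def)
  finally show ?thesis unfolding th_def using g hc by (simp add: E.m_assoc)
qed

text \<open>Every element over gh differs from s at gh by an element of A, which shifts both values
  of \<open>Phi\<close> alike. The offset depends on e only through h.\<close>

lemma sim_Phi:
  assumes S: "sim n g g'" and g: "g \<in> carrier G" "g' \<in> carrier G" and h: "h \<in> ball n"
    and e: "e \<in> carrier E" "\<pi> e = g \<otimes> h" and l: "l \<in> Lam"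
  shows "Phi l (th g g' \<star> e) = Phi l e + (Phi (l \<circ> act h) (s g') - Phi (l \<circ> act h) (s g))"
proof -
  have hc: "h \<in> carrier G" using h by (simp add: ball_def)
  define a where "a = fd (s (g \<otimes> h)) e"
  have ea: "e = s (g \<otimes> h) \<star> \<iota> a" unfolding a_def using fd[of "s (g \<otimes> h)" e] e g hc by simp
  have "th g g' \<star> e = s (g' \<otimes> h) \<star> \<iota> a" unfolding ea sim_s[OF S g h] using th g hc by (simp add: E.m_assoc)
  then have "Phi l (th g g' \<star> e) - Phi l e = Phi l (s (g' \<otimes> h)) - Phi l (s (g \<otimes> h))"
    unfolding ea using Phi_iota[OF l] g hc by simp
  moreover have "Phi l (s (g \<otimes> h)) - Phi (l \<circ> act h) (s g) = Phi l (s (g' \<otimes> h)) - Phi (l \<circ> act h) (s g')"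
    using S h l by (simp add: sim_def)
  ultimately show ?thesis by linarith
qed

text \<open>Cut a minimising word for e where it passes near g. \<open>Phi_split\<close> separates
  the costs; translation changes the first part by the offset of \<open>sim_Phi\<close> and leaves
  the second part alone. The identity h'k = zh makes the offset independent of the place of the
  cut.\<close>

lemma Phi_sim_le:
  assumes S: "sim (near M) g g'" and g: "g \<in> carrier G" "g' \<in> carrier G" and z: "z \<in> cone g"
    and h: "h \<in> carrier G" "ln h \<le> M" and e: "e \<in> carrier E" "\<pi> e = g \<otimes> z \<otimes> h" and l: "l \<in> Lam"
  shows "Phi l (th g g' \<star> e) \<le> Phi l e + (Phi (l \<circ> act (z \<otimes> h)) (s g') - Phi (l \<circ> act (z \<otimes> h)) (s g))"
proof -
  have zc: "z \<in> carrier G" using z by (rule coneD)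
  obtain w a where w: "opt l e w a" "Phi l e = l a + K * int (length w)" using Phi_opt[OF l e(1)] by blast
  have wl: "w \<in> lists X" "e = lift w \<star> \<iota> a" using w by (auto simp: opt_def)
  have "ev w = g \<otimes> z \<otimes> h" using wl e pi_mult[of "lift w" "\<iota> a"] by simp
  then obtain p r h' where p: "w = p @ r" "h' \<in> ball (near M)" "ev p = g \<otimes> h'" "p \<in> lists X" "r \<in> lists X"
    using near[OF g(1) z h opt_wquasi[OF l w(1)]] by blast
  have hc: "h' \<in> carrier G" using p by (simp add: ball_def)
  let ?e2 = "lift p" and ?e3 = "invE (lift p) \<star> e"
  have E2: "?e2 \<in> carrier E" "\<pi> ?e2 = g \<otimes> h'" using p by auto
  have E3: "?e3 \<in> carrier E" "?e2 \<star> ?e3 = e" using E2 e E_cancel by auto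
  define k where "k = \<pi> ?e3"
  have kc: "k \<in> carrier G" using E3 by (simp add: k_def)
  have "g \<otimes> h' \<otimes> k = g \<otimes> z \<otimes> h" using pi_mult[OF E2(1) E3(1)] E2 E3 e by (simp add: k_def)
  then have hk: "h' \<otimes> k = z \<otimes> h" using g hc kc zc h by (simp add: m_assoc)
  have l': "l \<circ> act k \<in> Lam" using Lam_act l kc by auto
  have "Phi l e = Phi (l \<circ> act k) ?e2 + Phi l ?e3"
    using Phi_split[OF l e(1), of p r a] w p by (simp add: k_def)
  moreover have "Phi l (th g g' \<star> e) \<le> Phi (l \<circ> act k) (th g g' \<star> ?e2) + Phi l ?e3"
    using Phi_mult[OF l, of "th g g' \<star> ?e2" ?e3] E2 E3 th g by (simp add: E.m_assoc k_def)
  moreover have "Phi (l \<circ> act k) (th g g' \<star> ?e2) = Phi (l \<circ> act k) ?e2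
      + (Phi (l \<circ> act k \<circ> act h') (s g') - Phi (l \<circ> act k \<circ> act h') (s g))"
    by (rule sim_Phi[OF S g p(2) E2 l'])
  moreover have "l \<circ> act k \<circ> act h' = l \<circ> act (z \<otimes> h)" using act_comp[OF hc kc] hk by simp
  ultimately show ?thesis by simp
qed

lemma Phi_sim:
  assumes S: "sim (near M) g g'" and g: "g \<in> carrier G" "g' \<in> carrier G" and z: "z \<in> cone g" "z \<in> cone g'"
    and h: "h \<in> carrier G" "ln h \<le> M" and e: "e \<in> carrier E" "\<pi> e = g \<otimes> z \<otimes> h" and l: "l \<in> Lam"
  shows "Phi l (th g g' \<star> e) = Phi l e + (Phi (l \<circ> act (z \<otimes> h)) (s g') - Phi (l \<circ> act (z \<otimes> h)) (s g))"
proof -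
  have zc: "z \<in> carrier G" using z by (auto dest: coneD)
  have e': "th g g' \<star> e \<in> carrier E" "\<pi> (th g g' \<star> e) = g' \<otimes> z \<otimes> h"
    using th[OF g] e g zc h by (simp_all add: m_assoc) (metis inv_closed inv_solve inv_inv m_assoc m_closed)
  have "Phi l e \<le> Phi l (th g g' \<star> e) + (Phi (l \<circ> act (z \<otimes> h)) (s g) - Phi (l \<circ> act (z \<otimes> h)) (s g'))"
    using Phi_sim_le[OF sim_sym[OF S] g(2,1) z(2) h e' l] th_th[OF g e(1)] by simp
  then show ?thesis using Phi_sim_le[OF S g z(1) h e l] by linarith
qed

text \<open>Assembled by \<open>psi\<close>, the offsets give the action of zh on the difference of
  \<open>Psi\<close> at \<open>s g'\<close> and \<open>s g\<close>, and equal types have equal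
  \<open>Psi\<close>. Individual values of \<open>Phi\<close> may well change.\<close>

lemma Psi_sim:
  assumes S: "sim (near M) g g'" and g: "g \<in> carrier G" "g' \<in> carrier G" and z: "z \<in> cone g" "z \<in> cone g'"
    and h: "h \<in> carrier G" "ln h \<le> M" and e: "e \<in> carrier E" "\<pi> e = g \<otimes> z \<otimes> h"
  shows "Psi (th g g' \<star> e) = Psi e"
proof -
  have zh: "z \<otimes> h \<in> carrier G" using z h coneD by simp
  have "Psi (th g g' \<star> e) = psi (\<lambda>l. Phi l e + (Phi (l \<circ> act (z \<otimes> h)) (s g') - Phi (l \<circ> act (z \<otimes> h)) (s g)))"
    unfolding Psi_def using Phi_sim[OF S g z h e] by (intro psi_cong) auto
  also have "\<dots> = Psi e + (act (z \<otimes> h) (Psi (s g')) - act (z \<otimes> h) (Psi (s g)))"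
    unfolding Psi_def psi_add psi_diff psi_act[OF act_H[OF zh]] ..
  also have "\<dots> = Psi e" using S by (simp add: sim_def)
  finally show ?thesis .
qed

text \<open>The recursion for s at gzh walks back along a geodesic, whose points must again be
  described as a cone element times a bounded one. A point gk no shorter than g is close to some y
  beyond g, either gz itself or a point on a geodesic through g to gz: comparing geodesics costs at
  most \<open>3 * \<delta>\<close>, slimness \<open>\<delta>\<close>, and the end M.\<close>

lemma region:
  assumes g: "g \<in> carrier G" and z: "z \<in> cone g" and h: "h \<in> carrier G" "ln h \<le> M"
    and k: "k \<in> carrier G" "g \<otimes> k \<in> gs.ival \<one> (g \<otimes> z \<otimes> h)" and big: "ln g \<le> ln (g \<otimes> k)"
  shows "\<exists>z'\<in>cone g. \<exists>h'\<in>carrier G. k = z' \<otimes> h' \<and> ln h' \<le> 4 * \<delta> + M"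
proof -
  have zc: "z \<in> carrier G" using z by (rule coneD)
  have P: "g \<otimes> z \<in> carrier G" "g \<otimes> z \<otimes> h \<in> carrier G" "g \<otimes> k \<in> carrier G" using g zc h k by auto
  obtain q where q: "q \<in> gs.ival \<one> (g \<otimes> z) \<or> q \<in> gs.ival (g \<otimes> z) (g \<otimes> z \<otimes> h)" "dd (g \<otimes> k) q \<le> \<delta>" "q \<in> carrier G"
    using gs.slimD[OF slim one_closed P(2,1) k(2)] by metis
  have fin: ?thesis if y: "y \<in> carrier G" "g \<in> gs.ival \<one> y" "dd y (g \<otimes> k) \<le> 4 * \<delta> + M" for y
  proof -
    have "dd \<one> g + dd g y = dd \<one> y" using y gs.ivalD by auto
    then have 1: "inv g \<otimes> y \<in> cone g" using g y by (simp add: cone_def dd_one inv_solve word_dist_def)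
    have 2: "k = inv g \<otimes> y \<otimes> (inv y \<otimes> (g \<otimes> k))" using g y k by (simp add: m_assoc inv_solve) (simp flip: m_assoc)
    have 3: "ln (inv y \<otimes> (g \<otimes> k)) \<le> 4 * \<delta> + M" using y by (simp add: word_dist_def)
    have 4: "inv y \<otimes> (g \<otimes> k) \<in> carrier G" using g y k by simp
    show ?thesis using 1 2 3 4 by blast
  qed
  have gi: "g \<in> gs.ival \<one> (g \<otimes> z)" using g zc coneD(2)[OF z] by (simp add: gs.ival_def dd_one dd_mult)
  show ?thesis using q(1)
  proof
    assume "q \<in> gs.ival (g \<otimes> z) (g \<otimes> z \<otimes> h)"
    then have "dd (g \<otimes> z) q + dd q (g \<otimes> z \<otimes> h) = dd (g \<otimes> z) (g \<otimes> z \<otimes> h)" using gs.ivalD by auto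
    also have "\<dots> = ln h" using dd_mult[OF P(1) h(1)] .
    finally have "dd (g \<otimes> z) q \<le> M" using h by simp
    moreover have "dd (g \<otimes> z) (g \<otimes> k) \<le> dd (g \<otimes> z) q + dd q (g \<otimes> k)" using gs.d_tri P q by auto
    moreover have "dd q (g \<otimes> k) = dd (g \<otimes> k) q" using gs.d_sym P q by auto
    ultimately show ?thesis using fin[OF P(1) gi] q by simp
  next
    assume qi: "q \<in> gs.ival \<one> (g \<otimes> z)"
    have dq: "dd q (g \<otimes> k) \<le> \<delta>" using gs.d_sym[of q "g \<otimes> k"] P q by auto
    have "ln (g \<otimes> k) \<le> ln q + \<delta>" using gs.d_tri[of \<one> q "g \<otimes> k"] P q dq dd_one by simp
    then have lq: "ln g \<le> ln q + \<delta>" using big by simp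
    have qe: "ln q + dd q (g \<otimes> z) = ln (g \<otimes> z)" using gs.ivalD(2)[OF qi] dd_one q P by simp
    show ?thesis
    proof (cases "ln q \<le> ln g")
      case True
      have "dd g q \<le> 2 * \<delta> + (ln g - ln q)"
        using gs.ival_thin[OF slim one_closed P(1) gi qi] dd_one g q True by (auto split: if_splits)
      then have "dd g q \<le> 3 * \<delta>" using lq by simp
      moreover have "dd g (g \<otimes> k) \<le> dd g q + dd q (g \<otimes> k)" using gs.d_tri P q g by auto
      ultimately show ?thesis using fin[OF g gs.ival_ends(2)[OF one_closed g]] dq by simp
    next
      case False
      have "ln q - ln g \<le> dd g (g \<otimes> z)" using qe coneD(2)[OF z] dd_mult[OF g zc] by simp
      then obtain y where y: "y \<in> carrier G" "dd g y = ln q - ln g" "dd y (g \<otimes> z) = dd g (g \<otimes> z) - (ln q - ln g)"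
        using gs.d_mid[OF g P(1)] by blast
      have "y \<in> gs.ival g (g \<otimes> z)" using y \<open>ln q - ln g \<le> dd g (g \<otimes> z)\<close> by (simp add: gs.ival_def)
      note r = gs.ival_right[OF one_closed P(1) gi this]
      have "dd \<one> y = ln q" using gs.ivalD(2)[OF r(2)] y False dd_one g by simp
      then have "dd y q \<le> 2 * \<delta>" using gs.ival_thin[OF slim one_closed P(1) r(1) qi] dd_one q by simp
      moreover have "dd y (g \<otimes> k) \<le> dd y q + dd q (g \<otimes> k)" using gs.d_tri P q y by auto
      ultimately show ?thesis using fin[OF y(1) r(2)] dq by simp
    qed
  qed
qed

text \<open>A sum in place of a maximum. With M1 = \<open>4 * \<delta> + M\<close> from
  \<open>region\<close>, it covers the radii for cone types, for lengths and \<open>Psi\<close> over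
  the region, for the neighbours tested by \<open>Dset\<close>, one step further out, and the ball
  of radius 2 M1 where the values of s are compared directly.\<close>

definition bign :: "nat \<Rightarrow> nat" where
  "bign M = near 1 + near (4 * \<delta> + M) + near (4 * \<delta> + M + 1) + 2 * (4 * \<delta> + M)"

text \<open>Run the recursions at gk and g'k in parallel, going back from k = zh. Equal relative
  lengths give the same last letter, equal \<open>Psi\<close> the same correction; when the walk
  gets down to the length of g it is so close to g that the type itself contains the value of
  s.\<close>

lemma s_sim:
  assumes S: "sim (bign M) g g'" and g: "g \<in> carrier G" "g' \<in> carrier G" and z: "z \<in> cone g"
    and h: "h \<in> carrier G" "ln h \<le> M"
  shows "s (g' \<otimes> z \<otimes> h) = th g g' \<star> s (g \<otimes> z \<otimes> h)"
proof -
  define M1 where "M1 = 4 * \<delta> + M"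
  have S1: "sim (near 1) g g'" and S2: "sim (near M1) g g'" and S3: "sim (near (M1 + 1)) g g'"
    using sim_mono[OF S] by (simp_all add: bign_def M1_def)
  have zc: "z \<in> carrier G" using z by (rule coneD)
  let ?K = "z \<otimes> h"
  have Kc: "?K \<in> carrier G" "g \<otimes> z \<otimes> h = g \<otimes> ?K" using zc h g by (simp_all add: m_assoc)
  have main: "s (g' \<otimes> k) = th g g' \<star> s (g \<otimes> k)"
    if "k \<in> carrier G" "g \<otimes> k \<in> gs.ival \<one> (g \<otimes> ?K)" "k = ?K \<or> ln g \<le> ln (g \<otimes> k)" for k
    using that
  proof (induction "ln (g \<otimes> k)" arbitrary: k rule: less_induct)
    case less
    note kc = less.prems(1)
    obtain z' h' where zh: "z' \<in> cone g" "h' \<in> carrier G" "k = z' \<otimes> h'" "ln h' \<le> M1"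
    proof (cases "k = ?K")
      case True
      then show ?thesis using that[of z h] z h by (simp add: M1_def)
    next
      case False
      then show ?thesis using region[OF g(1) z h kc, unfolded Kc] less.prems that by (auto simp: M1_def)
    qed
    have z': "z' \<in> carrier G" "z' \<in> cone g'" using zh cone_sim[OF S1 g] coneD by auto
    have lenk: "int (ln (g' \<otimes> k)) - int (ln g') = int (ln (g \<otimes> k)) - int (ln g)"
      using len_sim[OF S2 g zh(1) z'(2) zh(2,4)] zh z' g by (simp add: m_assoc)
    show ?case
    proof (cases "ln (g \<otimes> k) \<le> ln g")
      case True
      \<comment> \<open>As gk is no longer than g, the cone part z' can be no longer than the
        deviation h'.\<close>
      have "g \<otimes> z' = (g \<otimes> k) \<otimes> inv h'" using zh z' g by (simp add: m_assoc)
      then have "ln (g \<otimes> z') \<le> ln (g \<otimes> k) + ln h'" using ln_mult[of "g \<otimes> k" "inv h'"] ln_inv zh kc g by simp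
      then have "ln z' \<le> M1" using coneD(2)[OF zh(1)] zh True by simp
      then have "ln k \<le> 2 * M1" using ln_mult[OF z'(1) zh(2)] zh by simp
      then have "k \<in> ball (bign M)" using kc by (simp add: ball_def bign_def M1_def)
      then show ?thesis by (rule sim_s[OF S g])
    next
      case False
      have ne: "g \<otimes> k \<noteq> \<one>" using False by auto
      have ne': "g' \<otimes> k \<noteq> \<one>" using lenk False by auto
      have lenx: "int (ln (g' \<otimes> k \<otimes> inv x)) - int (ln g') = int (ln (g \<otimes> k \<otimes> inv x)) - int (ln g)" if x: "x \<in> X" for x
      proof -
        have xc: "x \<in> carrier G" "ln (inv x) \<le> 1" using x X_sub ln_gen X_inv by auto
        have "ln (h' \<otimes> inv x) \<le> M1 + 1" using ln_mult[of h' "inv x"] xc zh by simp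
        then show ?thesis using len_sim[OF S3 g zh(1) z'(2), of "h' \<otimes> inv x"] zh z' g xc by (simp add: m_assoc)
      qed
      have "Dset (g' \<otimes> k) = Dset (g \<otimes> k)" unfolding Dset_def using lenx lenk by (intro Collect_cong) force
      then have lx: "lastx (g' \<otimes> k) = lastx (g \<otimes> k)" by (simp add: lastx_def)
      define x where "x = lastx (g \<otimes> k)"
      have gk: "g \<otimes> k \<in> carrier G" "g' \<otimes> k \<in> carrier G" using g kc by auto
      have x: "x \<in> X" "x \<in> carrier G" "Suc (ln (g \<otimes> k \<otimes> inv x)) = ln (g \<otimes> k)"
        using lastx[OF gk(1) ne] X_sub by (auto simp: x_def)
      define k' where "k' = k \<otimes> inv x"
      have k': "k' \<in> carrier G" "g \<otimes> k \<otimes> inv x = g \<otimes> k'" "g' \<otimes> k \<otimes> inv x = g' \<otimes> k'" "g \<otimes> k = g \<otimes> k' \<otimes> x"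
        using g kc x by (simp_all add: k'_def m_assoc)
      have P: "g \<otimes> ?K \<in> carrier G" "g \<otimes> k' \<in> carrier G" using g Kc k' by auto
      have iv: "g \<otimes> k' \<in> gs.ival \<one> (g \<otimes> ?K)"
      proof -
        have 1: "ln (g \<otimes> k) + dd (g \<otimes> k) (g \<otimes> ?K) = ln (g \<otimes> ?K)" using gs.ivalD(2)[OF less.prems(2)] dd_one gk P by simp
        have 2: "dd (g \<otimes> k') (g \<otimes> ?K) \<le> dd (g \<otimes> k') (g \<otimes> k) + dd (g \<otimes> k) (g \<otimes> ?K)" using gs.d_tri P gk by auto
        have 3: "dd (g \<otimes> k') (g \<otimes> k) \<le> 1" unfolding k'(4) using dd_mult[OF P(2) x(2)] ln_gen[OF x(1)] by simp
        have 4: "ln (g \<otimes> ?K) \<le> ln (g \<otimes> k') + dd (g \<otimes> k') (g \<otimes> ?K)" using gs.d_tri[of \<one> "g \<otimes> k'" "g \<otimes> ?K"] P dd_one by simp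
        have "ln (g \<otimes> k') + dd (g \<otimes> k') (g \<otimes> ?K) = ln (g \<otimes> ?K)" using 1 2 3 4 x(3) k'(2) by simp
        then show ?thesis using P dd_one by (simp add: gs.ival_def)
      qed
      have IH: "s (g' \<otimes> k') = th g g' \<star> s (g \<otimes> k')"
        using less.hyps[of k'] k' iv x(3) False by simp
      have tE: "th g g' \<in> carrier E" using th g by simp
      let ?e = "s (g \<otimes> k') \<star> hat x"
      have e: "?e \<in> carrier E" "\<pi> ?e = g \<otimes> z' \<otimes> h'" using P x k' zh z' g by (auto simp: m_assoc)
      \<comment> \<open>Equal \<open>Psi\<close> makes \<open>nxt\<close> apply the same correction,
        since \<open>ch\<close> sees nothing else.\<close>
      have Ps: "Psi (th g g' \<star> ?e) = Psi ?e" by (rule Psi_sim[OF S2 g zh(1) z'(2) zh(2,4) e])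
      have "s (g' \<otimes> k) = nxt (th g g' \<star> s (g \<otimes> k')) x"
        using s_step[OF gk(2) ne'] lx IH k'(3) by (simp add: x_def)
      also have "\<dots> = th g g' \<star> nxt (s (g \<otimes> k')) x"
        unfolding nxt_def using tE P x Ps by (simp add: E.m_assoc)
      also have "nxt (s (g \<otimes> k')) x = s (g \<otimes> k)" using s_step[OF gk(1) ne] k'(2) by (simp add: x_def)
      finally show ?thesis .
    qed
  qed
  have "s (g' \<otimes> ?K) = th g g' \<star> s (g \<otimes> ?K)"
    by (rule main) (use Kc g gs.ival_ends in auto)
  then show ?thesis using g zc h by (simp add: m_assoc)
qed

text \<open>Both sides of the equation defining the cocycle are translated by the same element
  \<open>th g g'\<close>, which cancels.\<close>

lemma tau_sim:
  assumes S: "sim (bign (ln h)) g g'" and g: "g \<in> carrier G" "g' \<in> carrier G" and z: "z \<in> cone g" and h: "h \<in> carrier G"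
  shows "tau (g' \<otimes> z) h = tau (g \<otimes> z) h"
proof -
  have zc: "z \<in> carrier G" using z by (rule coneD)
  have tE: "th g g' \<in> carrier E" using th g by simp
  have 1: "s (g' \<otimes> z) = th g g' \<star> s (g \<otimes> z)" using s_sim[OF S g z one_closed] g zc by simp
  have 2: "s (g' \<otimes> z \<otimes> h) = th g g' \<star> s (g \<otimes> z \<otimes> h)" using s_sim[OF S g z h] by simp
  have "s (g' \<otimes> z) \<star> s h = th g g' \<star> (s (g \<otimes> z) \<star> s h)" unfolding 1 using tE g zc h by (simp add: E.m_assoc)
  also have "\<dots> = th g g' \<star> (s (g \<otimes> z \<otimes> h) \<star> \<iota> (tau (g \<otimes> z) h))" using tau[of "g \<otimes> z" h] g zc h by simp
  also have "\<dots> = s (g' \<otimes> z \<otimes> h) \<star> \<iota> (tau (g \<otimes> z) h)" unfolding 2 using tE g zc h by (simp add: E.m_assoc)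
  finally have "fd (s (g' \<otimes> z \<otimes> h)) (s (g' \<otimes> z) \<star> s h) = tau (g \<otimes> z) h" using g zc h by simp
  then show ?thesis by (simp add: tau_def)
qed

section \<open>Regular languages of geodesics and of their lifts\<close>

lemma geod_cone: "u @ z \<in> geodesics G X \<Longrightarrow> ev z \<in> cone (ev u)"
  using geod_factor(3)[of u z] geod_lists[of "u @ z"] by (simp add: cone_def ev_append)

lemma geod_sim:
  assumes S: "sim (near 1) (ev u) (ev v)" and u: "u @ z \<in> geodesics G X" and v: "v \<in> geodesics G X"
  shows "v @ z \<in> geodesics G X"
proof -
  have l: "u \<in> lists X" "z \<in> lists X" "v \<in> lists X" using geod_lists[OF u] geod_lists[OF v] by auto
  have "ev z \<in> cone (ev v)" using cone_sim[OF S _ _ geod_cone[OF u]] l by simp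
  then have "ln (ev (v @ z)) = length v + length z"
    using geod_len[OF v] geod_len[OF geod_factor(2)[OF u]] l by (simp add: cone_def ev_append)
  then show ?thesis using l by (simp add: geodesics_def)
qed

text \<open>The type of the element reached determines the residual: it tells which continuations
  are geodesic and which value of the cocycle they produce.\<close>

lemma tau_rational:
  assumes h: "h \<in> carrier G"
  shows "L_rational G X (geodesics G X) {g \<in> carrier G. tau g h = a}"
  unfolding L_rational_def
proof (rule regular_langI)
  let ?L = "{w \<in> geodesics G X. ev w \<in> {g \<in> carrier G. tau g h = a}}"
  show "?L \<subseteq> lists X" using geod_lists by auto
  let ?f = "\<lambda>w. gtyp (bign (ln h)) (ev w)"
  show "finite (derivs ?L)"
  proof (rule finite_derivsI[where P = "geodesics G X" and g = ?f])
    have "?f ` geodesics G X \<subseteq> gtyp (bign (ln h)) ` carrier G" using geod_lists by auto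
    then show "finite (?f ` geodesics G X)" by (rule finite_subset) (rule finite_gtyp)
    show "u \<in> geodesics G X" if "u @ z \<in> ?L" for u z
      by (rule geod_factor(1)[of u z]) (use that in simp)
    fix u v z assume u: "u \<in> geodesics G X" and v: "v \<in> geodesics G X" and t: "?f u = ?f v" and uz: "u @ z \<in> ?L"
    have S: "sim (bign (ln h)) (ev u) (ev v)" using t by (rule gtyp_sim)
    have S1: "sim (near 1) (ev u) (ev v)" using sim_mono[OF S] by (simp add: bign_def)
    have uzg: "u @ z \<in> geodesics G X" using uz by simp
    have l: "u \<in> lists X" "v \<in> lists X" "z \<in> lists X" using geod_lists[OF uzg] geod_lists[OF v] by auto
    have "tau (ev v \<otimes> ev z) h = tau (ev u \<otimes> ev z) h" by (rule tau_sim[OF S _ _ geod_cone[OF uzg] h]) (use l in auto)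
    then show "v @ z \<in> ?L" using geod_sim[OF S1 uzg v] uz l by (simp add: ev_append)
  qed
qed

text \<open>The letters are quotients of consecutive values of s, a finite alphabet by
  \<open>finite_ratios\<close>. Their products telescope (\<open>lt_eval\<close>), so the lifted
  path runs exactly along the section, from which a lift by \<open>hat\<close> could drift
  away.\<close>

fun lt :: "'g \<Rightarrow> 'g list \<Rightarrow> 'e list" where
  "lt g [] = []"
| "lt g (x # u) = (invE (s g) \<star> s (g \<otimes> x)) # lt (g \<otimes> x) u"

lemma lt_append: "g \<in> carrier G \<Longrightarrow> u \<in> lists X \<Longrightarrow> lt g (u @ v) = lt g u @ lt (g \<otimes> ev u) v"
  using X_sub by (induction u arbitrary: g) (auto simp: m_assoc subset_iff)

lemma length_lt [simp]: "length (lt g u) = length u"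
  by (induction u arbitrary: g) auto

lemma take_lt: "take t (lt g u) = lt g (take t u)"
  by (induction u arbitrary: g t) (auto simp: take_Cons split: nat.split)

lemma lt_pi: "g \<in> carrier G \<Longrightarrow> u \<in> lists X \<Longrightarrow> map \<pi> (lt g u) = u"
  using X_sub by (induction u arbitrary: g) (auto simp: subset_iff simp flip: m_assoc)

lemma lt_eval: "g \<in> carrier G \<Longrightarrow> u \<in> lists X \<Longrightarrow> word_eval E (lt g u) = invE (s g) \<star> s (g \<otimes> ev u)"
proof (induction u arbitrary: g)
  case (Cons x u)
  have x: "x \<in> carrier G" "u \<in> lists X" using Cons.prems X_sub by auto
  then show ?case using Cons E_cancel(1)[of "s (g \<otimes> x)" "s (g \<otimes> (x \<otimes> ev u))"]
    by (simp add: m_assoc E.m_assoc)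
qed simp

lemma lt_letters: "g \<in> carrier G \<Longrightarrow> u \<in> lists X \<Longrightarrow> set (lt g u) \<subseteq> \<Union> (ratios ` X)"
proof (induction u arbitrary: g)
  case (Cons x u)
  have x: "x \<in> X" "x \<in> carrier G" "u \<in> lists X" using Cons.prems X_sub by auto
  then have "set (lt (g \<otimes> x) u) \<subseteq> \<Union> (ratios ` X)" using Cons by simp
  moreover have "invE (s g) \<star> s (g \<otimes> x) \<in> ratios x" unfolding ratios_def using Cons.prems by (intro imageI)
  ultimately show ?case using x(1) by auto
qed simp

lemma ratios_closed: "x \<in> carrier G \<Longrightarrow> ratios x \<subseteq> carrier E" by (auto simp: ratios_def)

text \<open>Quotients of values of s do not notice the common left translation
  \<open>th g g'\<close>.\<close>

lemma lt_sim:
  assumes S: "sim (bign 0) g g'" and g: "g \<in> carrier G" "g' \<in> carrier G"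
  shows "z1 @ z2 \<in> lists X \<Longrightarrow> ln (g \<otimes> ev (z1 @ z2)) = ln g + length (z1 @ z2) \<Longrightarrow>
    lt (g \<otimes> ev z1) z2 = lt (g' \<otimes> ev z1) z2"
proof (induction z2 arbitrary: z1)
  case (Cons x z2)
  have l: "z1 \<in> lists X" "x \<in> X" "x \<in> carrier G" "z2 \<in> lists X" using Cons.prems X_sub by auto
  have pre: "ev y \<in> cone g" if y: "y \<in> lists X" "y' \<in> lists X" "ln (g \<otimes> ev (y @ y')) = ln g + length (y @ y')" for y y'
  proof -
    have "ln (g \<otimes> ev (y @ y')) \<le> ln (g \<otimes> ev y) + ln (ev y')"
      using ln_mult[of "g \<otimes> ev y" "ev y'"] y g by (simp add: ev_append m_assoc)
    moreover have "ln (g \<otimes> ev y) \<le> ln g + ln (ev y)" using ln_mult g y by simp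
    ultimately show ?thesis using ln_le[OF y(1)] ln_le[OF y(2)] y g by (simp add: cone_def)
  qed
  have c1: "ev z1 \<in> cone g" using pre[of z1 "x # z2"] Cons.prems l by simp
  have c2: "ev (z1 @ [x]) \<in> cone g" using pre[of "z1 @ [x]" z2] Cons.prems l by simp
  have e: "ev (z1 @ [x]) = ev z1 \<otimes> x" using l by (simp add: ev_append)
  have tE: "th g g' \<in> carrier E" using th g by simp
  have s1: "s (g' \<otimes> ev z1) = th g g' \<star> s (g \<otimes> ev z1)" using s_sim[OF S g c1 one_closed] g l by simp
  have s2: "s (g' \<otimes> ev z1 \<otimes> x) = th g g' \<star> s (g \<otimes> ev z1 \<otimes> x)"
    using s_sim[OF S g c2 one_closed] g l e by (simp add: m_assoc)
  have "invE (th g g' \<star> s (g \<otimes> ev z1)) \<star> (th g g' \<star> s (g \<otimes> ev z1 \<otimes> x)) = invE (s (g \<otimes> ev z1)) \<star> s (g \<otimes> ev z1 \<otimes> x)"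
    using tE g l E_cancel(2)[of "th g g'" "s (g \<otimes> ev z1 \<otimes> x)"] by (simp add: E.inv_mult_group E.m_assoc)
  then have hd: "invE (s (g' \<otimes> ev z1)) \<star> s (g' \<otimes> ev z1 \<otimes> x) = invE (s (g \<otimes> ev z1)) \<star> s (g \<otimes> ev z1 \<otimes> x)"
    unfolding s1 s2 .
  have "lt (g \<otimes> ev (z1 @ [x])) z2 = lt (g' \<otimes> ev (z1 @ [x])) z2" using Cons.IH[of "z1 @ [x]"] Cons.prems by simp
  then show ?case using hd e g l by (simp add: m_assoc)
qed simp

definition L1 :: "'e list set" where "L1 = lt \<one> ` geodesics G X"

text \<open>Projection by \<open>\<pi>\<close> recovers the underlying geodesic, so its type serves
  as the state, as in \<open>tau_rational\<close>.\<close>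

lemma finite_derivs_L1: "finite (derivs L1)"
proof (rule finite_derivsI[where P = L1 and g = "\<lambda>W. gtyp (bign 0) (ev (map \<pi> W))"])
  let ?f = "\<lambda>W. gtyp (bign 0) (ev (map \<pi> W))"
  have "?f ` L1 \<subseteq> gtyp (bign 0) ` carrier G" using geod_lists lt_pi[OF one_closed] by (auto simp: L1_def)
  then show "finite (?f ` L1)" by (rule finite_subset) (rule finite_gtyp)
  fix W Z assume "W @ Z \<in> L1"
  then obtain u where u: "u \<in> geodesics G X" "W @ Z = lt \<one> u" by (auto simp: L1_def)
  have "W = lt \<one> (take (length W) u)" using u(2) take_lt by (metis append_eq_conv_conj)
  moreover have "take (length W) u \<in> geodesics G X" using geod_factor(1) u(1) by (metis append_take_drop_id)
  ultimately show "W \<in> L1" by (auto simp: L1_def)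
next
  fix W V Z assume W: "W \<in> L1" and V: "V \<in> L1" and t: "gtyp (bign 0) (ev (map \<pi> W)) = gtyp (bign 0) (ev (map \<pi> V))"
    and WZ: "W @ Z \<in> L1"
  obtain u where u: "u \<in> geodesics G X" "W = lt \<one> u" using W by (auto simp: L1_def)
  obtain v where v: "v \<in> geodesics G X" "V = lt \<one> v" using V by (auto simp: L1_def)
  obtain y where y: "y \<in> geodesics G X" "W @ Z = lt \<one> y" using WZ by (auto simp: L1_def)
  have l: "u \<in> lists X" "v \<in> lists X" "y \<in> lists X" using geod_lists u v y by auto
  define z where "z = map \<pi> Z"
  have "map \<pi> (W @ Z) = y" unfolding y(2) using lt_pi l by simp
  then have yz: "y = u @ z" using lt_pi l by (simp add: z_def u(2))
  have lz: "z \<in> lists X" using l yz by simp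
  have uz: "u @ z \<in> geodesics G X" using y yz by simp
  have S: "sim (bign 0) (ev u) (ev v)" using t lt_pi l by (simp add: u v gtyp_sim)
  have S1: "sim (near 1) (ev u) (ev v)" using sim_mono[OF S] by (simp add: bign_def)
  have Z: "Z = lt (ev u) z" using y(2) lt_append[OF one_closed l(1), of z] l by (simp add: yz u(2))
  have "ln (ev u \<otimes> ev z) = ln (ev u) + length z" using coneD(2)[OF geod_cone[OF uz]] geod_len[OF geod_factor(2)[OF uz]] by simp
  then have "lt (ev u) z = lt (ev v) z" using lt_sim[OF S, of "[]" z] l lz by simp
  then have "V @ Z = lt \<one> (v @ z)" using lt_append[OF one_closed l(2), of z] l v Z by simp
  then show "V @ Z \<in> L1" using geod_sim[OF S1 uz v(1)] by (simp add: L1_def)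
qed

end

section \<open>The biautomatic structure on the extension\<close>

context fg_lattice begin

lemma trunc_0 [simp]: "trunc c 0 = 0" by (simp add: trunc_def cmb_zero)

lemma trunc_Suc: "trunc c (Suc j) = trunc c j + sum ray {f \<in> faces. j < c f}"
proof -
  have "trunc c (Suc j) = (\<Sum>f\<in>faces. zs (int (min (c f) j)) (ray f) + (if j < c f then ray f else 0))"
    unfolding trunc_def cmb_def
  proof (rule sum.cong[OF refl])
    fix f
    have "int (min (c f) (Suc j)) = int (min (c f) j) + (if j < c f then 1 else 0)" by auto
    then show "zs (int (min (c f) (Suc j))) (ray f) = zs (int (min (c f) j)) (ray f) + (if j < c f then ray f else 0)"
      by (simp add: ZM.scale_left_distrib)
  qed
  moreover have "(\<Sum>f\<in>faces. if j < c f then ray f else 0) = sum ray {f \<in> faces. j < c f}"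
    using finite_faces by (simp add: sum.If_cases Int_def)
  ultimately show ?thesis by (simp add: sum.distrib trunc_def cmb_def)
qed

lemma trunc_ge: "(\<And>f. c f \<le> n) \<Longrightarrow> n \<le> j \<Longrightarrow> trunc c j = cmb c"
proof -
  assume "\<And>f. c f \<le> n" "n \<le> j"
  then have "(\<lambda>f. min (c f) j) = c" by (intro ext min_absorb1) (meson order_trans)
  then show ?thesis by (simp add: trunc_def)
qed

lemma trunc_finite: "finite {trunc c j | c j. j \<le> k}"
proof -
  have "{trunc c j | c j. j \<le> k} \<subseteq> (\<lambda>c. \<Sum>f\<in>faces. zs (c f) (ray f)) ` {c. \<forall>f\<in>faces. \<bar>c f\<bar> \<le> int k}"
  proof
    fix x assume "x \<in> {trunc c j | c j. j \<le> k}"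
    then obtain c j where "x = trunc c j" "j \<le> k" by auto
    then show "x \<in> (\<lambda>c. \<Sum>f\<in>faces. zs (c f) (ray f)) ` {c. \<forall>f\<in>faces. \<bar>c f\<bar> \<le> int k}"
      by (intro image_eqI[of _ _ "\<lambda>f. int (min (c f) j)"]) (auto simp: trunc_def cmb_def)
  qed
  then show ?thesis by (rule finite_subset) (rule finite_bounded_combos[OF finite_faces])
qed

end

context ext begin

definition bet :: "('a \<Rightarrow> int) set set \<Rightarrow> 'e" where "bet S = \<iota> (sum ray S)"

text \<open>All rays are traversed simultaneously: the letter at time j is the sum of the rays with coefficient above j.\<close>

definition aw :: "(('a \<Rightarrow> int) set \<Rightarrow> nat) \<Rightarrow> nat \<Rightarrow> 'e list" where
  "aw c n = map (\<lambda>j. bet {f \<in> faces. j < c f}) [0..<n]"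

text \<open>After the largest coefficient the letters are neutral; such padding is harmless, as a
  normal form need not be unique.\<close>

definition L2 :: "'e list set" where "L2 = {aw c n | c n. chain c \<and> (\<forall>f. c f \<le> n)}"

lemma aw_take: "k \<le> n \<Longrightarrow> take k (aw c n) = aw c k"
  by (simp add: aw_def take_map)

lemma aw_nth: "j < n \<Longrightarrow> aw c n ! j = bet {f \<in> faces. j < c f}"
  by (simp add: aw_def)

lemma bet_closed [simp]: "bet S \<in> carrier E" by (simp add: bet_def)

lemma aw_eval: "word_eval E (aw c n) = \<iota> (trunc c n)"
proof (induction n)
  case (Suc n)
  have "aw c (Suc n) = aw c n @ [bet {f \<in> faces. n < c f}]" by (simp add: aw_def)
  moreover have "set (aw c n) \<subseteq> carrier E" by (auto simp: aw_def)
  ultimately show ?case using Suc by (simp add: E.word_eval_append trunc_Suc bet_def flip: iota_add)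
qed (simp add: aw_def)

text \<open>The future of a word depends on the set S of faces whose ray occurs in all letters so
  far, since only these can go on. As \<open>bet\<close> is not known to be injective, a word need
  not determine its coefficients, and the invariant g collects all possible S.\<close>

lemma finite_derivs_L2: "finite (derivs L2)"
proof -
  define g where "g u = {S. \<exists>c n. chain c \<and> length u \<le> n \<and> (\<forall>f. c f \<le> n) \<and> u = aw c (length u)
      \<and> S = {f \<in> faces. length u \<le> c f}}" for u
  show ?thesis
  proof (rule finite_derivsI[where P = UNIV and g = g])
    have "range g \<subseteq> Pow (Pow faces)" by (auto simp: g_def)
    then show "finite (range g)" by (rule finite_subset) (use finite_faces in simp)
    fix u v z assume e: "g u = g v" and "u @ z \<in> L2"
    then obtain c n where c: "chain c" "\<And>f. c f \<le> n" "u @ z = aw c n" by (auto simp: L2_def)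
    have len: "length u + length z = n" using arg_cong[OF c(3), of length] by (simp add: aw_def)
    have u: "u = aw c (length u)" using aw_take[of "length u" n c] c(3) len by (metis append_eq_conv_conj le_add1)
    define S where "S = {f \<in> faces. length u \<le> c f}"
    have "length u \<le> n" using len by simp
    then have "S \<in> g u" unfolding g_def S_def using c(1,2) u by blast
    then have "S \<in> g v" using e by simp
    then obtain c' n' where c': "chain c'" "length v \<le> n'" "\<And>f. c' f \<le> n'" "v = aw c' (length v)"
      "S = {f \<in> faces. length v \<le> c' f}" unfolding g_def by blast
    \<comment> \<open>Splice the two: rays that have ended keep the past of v, and those in S
      continue the past of v with the future of u.\<close>
    define d where "d f = (if f \<in> S then length v + (c f - length u) else c' f)" for f
    have c0: "c f = 0" "c' f = 0" if "f \<notin> faces" for f using c(1) c'(1) that unfolding chain_def by auto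
    \<comment> \<open>With v empty, S consists of all faces and the support comes from c; otherwise
      the faces in S have already occurred in v, and the support comes from c'.\<close>
    have "chain d"
    proof (cases "v = []")
      case True
      show ?thesis
      proof (rule chain_mono[OF c(1)])
        fix f assume "d f \<noteq> 0"
        then show "c f \<noteq> 0" using True c'(5) c0[of f] by (auto simp: d_def split: if_splits)
      qed
    next
      case False
      show ?thesis
      proof (rule chain_mono[OF c'(1)])
        fix f assume "d f \<noteq> 0"
        moreover have "length v > 0" using False by simp
        ultimately show "c' f \<noteq> 0" using c'(5) by (auto simp: d_def simp del: length_greater_0_conv split: if_splits)
      qed
    qed
    moreover have "d f \<le> length v + length z" for f
    proof (cases "f \<in> S")
      case True
      then show ?thesis using c(2)[of f] len by (simp add: d_def)
    next
      case False
      then have "c' f \<le> length v" using c'(5) c0(2)[of f] by (cases "f \<in> faces") auto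
      then show ?thesis using False by (simp add: d_def)
    qed
    moreover have "v @ z = aw d (length v + length z)"
    proof (rule nth_equalityI)
      show "length (v @ z) = length (aw d (length v + length z))" by (simp add: aw_def)
      fix j assume "j < length (v @ z)"
      then have j: "j < length v + length z" by simp
      show "(v @ z) ! j = aw d (length v + length z) ! j"
      proof (cases "j < length v")
        case True
        have "v ! j = aw c' (length v) ! j" using c'(4) by simp
        also have "\<dots> = bet {f \<in> faces. j < c' f}" using True by (simp add: aw_def)
        also have "{f \<in> faces. j < c' f} = {f \<in> faces. j < d f}"
          using True unfolding d_def c'(5) by auto
        finally show ?thesis using True j by (simp add: aw_def nth_append)
      next
        case False
        have "z ! (j - length v) = (u @ z) ! (length u + (j - length v))" by (simp add: nth_append)
        also have "\<dots> = bet {f \<in> faces. length u + (j - length v) < c f}"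
          unfolding c(3) by (rule aw_nth) (use j False len in linarith)
        also have "{f \<in> faces. length u + (j - length v) < c f} = {f \<in> faces. j < d f}"
        proof -
          have iff: "length u + (j - length v) < c f \<longleftrightarrow> j < d f" if f: "f \<in> faces" for f
          proof (cases "f \<in> S")
            case True
            then show ?thesis using False by (auto simp: d_def S_def)
          next
            case nS: False
            have "c f < length u" using nS f unfolding S_def by simp
            moreover have "c' f < length v" using nS f unfolding c'(5) by simp
            ultimately show ?thesis using nS False by (simp add: d_def)
          qed
          show ?thesis by (intro Collect_cong conj_cong refl iff)
        qed
        finally show ?thesis using False j by (simp add: aw_def nth_append)
      qed
    qed
    ultimately show "v @ z \<in> L2" unfolding L2_def by blast
  qed simp
qed

section \<open>The normal form of the extension\<close>

definition L0 :: "'e list set" where "L0 = (\<lambda>r. [\<iota> r]) ` rems"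
definition LE :: "'e list set" where "LE = conc (conc L0 L1) L2"
definition YE :: "'e set" where "YE = \<iota> ` rems \<union> \<Union> (ratios ` X) \<union> bet ` Pow faces"
definition XE :: "'e set" where "XE = YE \<union> invE ` YE"

lemma LE_iff: "W \<in> LE \<longleftrightarrow> (\<exists>r u c n. r \<in> rems \<and> u \<in> geodesics G X \<and> chain c \<and> (\<forall>f. c f \<le> n)
    \<and> W = \<iota> r # lt \<one> u @ aw c n)"
proof -
  have "W \<in> LE \<longleftrightarrow> (\<exists>r u c n. W = ([\<iota> r] @ lt \<one> u) @ aw c n \<and> r \<in> rems \<and> u \<in> geodesics G X \<and> chain c \<and> (\<forall>f. c f \<le> n))"
    unfolding LE_def conc_def L0_def L1_def L2_def by blast
  then show ?thesis by auto
qed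

lemma YE: "finite YE" "YE \<subseteq> carrier E"
proof -
  show "finite YE" unfolding YE_def using finite_rems finX finite_faces finite_ratios X_sub by auto
  show "YE \<subseteq> carrier E" 
    unfolding YE_def using ratios_closed X_sub by (intro Un_least UN_least image_subsetI) auto
qed

lemma XE: "finite XE" "XE \<subseteq> carrier E" "y \<in> XE \<Longrightarrow> invE y \<in> XE"
  using YE by (auto simp: XE_def)

lemma LE_lists: "LE \<subseteq> lists XE"
proof
  fix W assume "W \<in> LE"
  then obtain r u c n where W: "r \<in> rems" "u \<in> geodesics G X" "W = \<iota> r # lt \<one> u @ aw c n" unfolding LE_iff by blast
  have "set (lt \<one> u) \<subseteq> YE" using lt_letters[OF one_closed geod_lists[OF W(2)]] by (auto simp: YE_def)
  moreover have "set (aw c n) \<subseteq> YE" by (auto simp: aw_def YE_def)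
  moreover have "\<iota> r \<in> YE" using W by (simp add: YE_def)
  ultimately show "W \<in> lists XE" using W(3) by (auto simp: XE_def in_lists_conv_set)
qed

lemma LE_regular: "regular_lang XE LE"
proof (rule regular_langI[OF LE_lists])
  show "finite (derivs LE)" unfolding LE_def
    by (intro finite_derivs_conc finite_derivs_L1 finite_derivs_L2 finite_derivs_finite)
       (simp add: L0_def finite_rems)
qed

text \<open>The letter \<open>\<iota> r\<close> accounts for the \<open>Suc\<close>. Truncated
  subtraction keeps the A-part at 0 while u is read, and \<open>path_pt\<close> rests at the end of
  u afterwards.\<close>

lemma LE_path:
  assumes u: "u \<in> geodesics G X" and c: "\<And>f. c f \<le> n"
  shows "path_pt E (\<iota> r # lt \<one> u @ aw c n) (Suc t) = \<iota> r \<star> s (path_pt G u t) \<star> \<iota> (trunc c (t - length u))"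
proof -
  have l: "u \<in> lists X" "take t u \<in> lists X" using geod_lists[OF u] take_lists by auto
  have s1: "set (lt \<one> (take t u)) \<subseteq> carrier E"
    using lt_letters[OF one_closed l(2)] YE(2) by (auto simp: YE_def)
  have "word_eval E (take k (aw c n)) = \<iota> (trunc c k)" for k
  proof (cases "k \<le> n")
    case False
    then have "take k (aw c n) = aw c n" by (simp add: aw_def)
    then show ?thesis using False aw_eval trunc_ge[OF c, of n] trunc_ge[OF c, of k] by simp
  qed (simp add: aw_take aw_eval)
  moreover have "set (take k (aw c n)) \<subseteq> carrier E" for k by (auto simp: aw_def dest!: in_set_takeD)
  ultimately show ?thesis
    using s1 lt_eval[OF one_closed l(2)] l by (simp add: path_pt_def take_lt E.word_eval_append E.m_assoc)
qed

lemma LE_eval: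
  assumes u: "u \<in> geodesics G X" and c: "\<And>f. c f \<le> n"
  shows "word_eval E (\<iota> r # lt \<one> u @ aw c n) = \<iota> r \<star> s (ev u) \<star> \<iota> (cmb c)"
proof -
  let ?t = "length u + n"
  have "path_pt E (\<iota> r # lt \<one> u @ aw c n) (Suc ?t) = word_eval E (\<iota> r # lt \<one> u @ aw c n)"
    by (simp add: path_pt_def aw_def)
  then show ?thesis unfolding LE_path[OF u c] using trunc_ge[OF c, of n] by (simp add: path_end)
qed

lemma LE_surj: "word_eval E ` LE = carrier E"
proof
  have "set W \<subseteq> carrier E" if "W \<in> LE" for W using LE_lists XE(2) that by (auto simp: in_lists_conv_set)
  then show "word_eval E ` LE \<subseteq> carrier E" by auto
  show "carrier E \<subseteq> word_eval E ` LE"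
  proof
    fix e assume e: "e \<in> carrier E"
    define g where "g = \<pi> e"
    have g: "g \<in> carrier G" using e by (simp add: g_def)
    obtain u where u: "u \<in> geodesics G X" "ev u = g" using geod_ex g by blast
    define a where "a = fd (s g) e"
    have ea: "e = s g \<star> \<iota> a" unfolding a_def using fd[of "s g" e] e g by (simp add: g_def)
    obtain c where c: "chain c" "a - cmb c \<in> rems" using cover by blast
    \<comment> \<open>The remainder is written at the front, so it is transported back through the
      action of g, under which \<open>rems\<close> is invariant.\<close>
    define r where "r = act (inv g) (a - cmb c)"
    have r: "r \<in> rems" unfolding r_def using rems_act[OF act_H c(2)] g by simp
    define n where "n = (\<Sum>f\<in>faces. c f)"
    have cn: "c f \<le> n" for f
    proof (cases "f \<in> faces")
      case True
      then show ?thesis unfolding n_def using finite_faces by (intro member_le_sum) auto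
    next
      case False
      then have "c f = 0" using c(1) unfolding chain_def by auto
      then show ?thesis by simp
    qed
    have "\<iota> r \<star> s g = s g \<star> \<iota> (a - cmb c)" using iota_move[of "s g" r] g by (simp add: r_def)
    then have "word_eval E (\<iota> r # lt \<one> u @ aw c n) = e"
      unfolding LE_eval[OF u(1) cn] u(2) ea using g by (simp add: E.m_assoc flip: iota_add)
    moreover have "\<iota> r # lt \<one> u @ aw c n \<in> LE" unfolding LE_iff using r u c cn by blast
    ultimately show "e \<in> word_eval E ` LE" by blast
  qed
qed

lemma XE_gen: "fin_sym_gen E XE"
  unfolding fin_sym_gen_def
proof (intro conjI ballI)
  show "finite XE" "XE \<subseteq> carrier E" by (rule XE)+
  show "invE y \<in> XE" if "y \<in> XE" for y using that by (rule XE(3))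
  show "\<exists>w\<in>lists XE. word_eval E w = e" if "e \<in> carrier E" for e
  proof -
    have "e \<in> word_eval E ` LE" using that LE_surj by simp
    then obtain W where "W \<in> LE" "e = word_eval E W" by (rule imageE)
    then show ?thesis using LE_lists by blast
  qed
qed

text \<open>Everything is rewritten relative to the value of s over the projection of y times p.
  Passing from y to the section costs a value of the cocycle with fixed first argument and an
  element of a finite set of orbits, the step h costs a ratio, and the other remainder stays in
  \<open>rems\<close>.\<close>

lemma section_bounded:
  assumes y: "y \<in> carrier E"
  shows "finite {invE (y \<star> \<iota> r \<star> s p) \<star> (\<iota> r' \<star> s (\<pi> y \<otimes> p \<otimes> h)) | r r' p h.
    r \<in> rems \<and> r' \<in> rems \<and> p \<in> carrier G \<and> h \<in> ball n}" (is "finite ?D")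
proof -
  define k where "k = \<pi> y"
  have k: "k \<in> carrier G" using y by (simp add: k_def)
  define a0 where "a0 = fd (s k) y"
  have ya: "y = s k \<star> \<iota> a0" unfolding a0_def using fd[of "s k" y] y k by (simp add: k_def)
  define A where "A = {act g a | g a. g \<in> carrier G \<and> a \<in> (\<lambda>r. a0 + r) ` rems}"
  have finA: "finite A" unfolding A_def by (rule finite_act) (simp add: finite_rems)
  let ?F = "\<lambda>(x, b, \<rho>, r). \<iota> (- (x + b)) \<star> \<rho> \<star> \<iota> r"
  have "?D \<subseteq> ?F ` (tau k ` carrier G \<times> A \<times> (\<Union> (ratios ` ball n)) \<times> rems)"
  proof
    fix d assume "d \<in> ?D"
    then obtain r r' p h where d: "d = invE (y \<star> \<iota> r \<star> s p) \<star> (\<iota> r' \<star> s (k \<otimes> p \<otimes> h))"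
      and m: "r \<in> rems" "r' \<in> rems" "p \<in> carrier G" "h \<in> ball n" by (auto simp: k_def)
    have hc: "h \<in> carrier G" using m by (simp add: ball_def)
    have kp: "k \<otimes> p \<in> carrier G" "k \<otimes> p \<otimes> h \<in> carrier G" using k m hc by auto
    define b where "b = act p (a0 + r)"
    define \<rho> where "\<rho> = invE (s (k \<otimes> p)) \<star> s (k \<otimes> p \<otimes> h)"
    define r'' where "r'' = act (k \<otimes> p \<otimes> h) r'"
    have bA: "b \<in> A" unfolding b_def A_def using m by blast
    have rh: "\<rho> \<in> ratios h" "\<rho> \<in> carrier E" unfolding \<rho>_def ratios_def using kp by auto
    have r'': "r'' \<in> rems" unfolding r''_def using rems_act[OF act_H] kp m by simp
    have "y \<star> \<iota> r \<star> s p = s k \<star> (\<iota> (a0 + r) \<star> s p)" unfolding ya using k m by (simp add: iota_add E.m_assoc)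
    also have "\<dots> = s k \<star> s p \<star> \<iota> b" using iota_move[of "s p" "a0 + r"] k m by (simp add: b_def E.m_assoc)
    also have "\<dots> = s (k \<otimes> p) \<star> \<iota> (tau k p + b)"
      unfolding tau[OF k m(3), symmetric] using kp by (simp add: E.m_assoc iota_add)
    finally have 1: "y \<star> \<iota> r \<star> s p = s (k \<otimes> p) \<star> \<iota> (tau k p + b)" .
    have 2: "\<iota> r' \<star> s (k \<otimes> p \<otimes> h) = s (k \<otimes> p) \<star> \<rho> \<star> \<iota> r''"
      using iota_move[of "s (k \<otimes> p \<otimes> h)" r'] kp by (simp add: \<rho>_def r''_def E_cancel)
    have "d = \<iota> (- (tau k p + b)) \<star> \<rho> \<star> \<iota> r''" unfolding d 1 2 iota_minus
      using kp rh E_cancel(2)[of "s (k \<otimes> p)" "\<rho> \<star> \<iota> r''"] by (simp add: E.inv_mult_group E.m_assoc)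
    then show "d \<in> ?F ` (tau k ` carrier G \<times> A \<times> (\<Union> (ratios ` ball n)) \<times> rems)"
      using bA rh(1) r'' m by (intro image_eqI[of _ _ "(tau k p, b, \<rho>, r'')"]) auto
  qed
  moreover have "finite (\<Union> (ratios ` ball n))"
    using finite_ball' finite_ratios by (auto simp: ball_def)
  ultimately show ?thesis
    by (elim finite_subset) (intro finite_imageI finite_cartesian_product tau_finite_left k finA finite_rems)
qed

text \<open>The two-sided form covers all conditions of biautomaticity at once: y1 and y2 will be
  letters or neutral. The geodesic parts fellow-travel in G and hence, along the section, in E; the
  A-parts start with a relative delay of at most M and are compared by
  \<open>trunc_fellow\<close>.\<close>

lemma LE_fellow:
  assumes y: "y1 \<in> carrier E" "y2 \<in> carrier E"
  shows "\<exists>D. finite D \<and> D \<subseteq> carrier E \<and> (\<forall>W\<in>LE. \<forall>W'\<in>LE. word_eval E W' = y1 \<star> word_eval E W \<star> y2 \<longrightarrow>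
    (\<forall>t. invE (y1 \<star> path_pt E W t) \<star> path_pt E W' t \<in> D))"
proof -
  define k1 k2 where "k1 = \<pi> y1" and "k2 = \<pi> y2"
  have k: "k1 \<in> carrier G" "k2 \<in> carrier G" using y by (simp_all add: k1_def k2_def)
  define M where "M = ln k1 + ln k2"
  define R where "R = 8 * \<delta> + 6 * M"
  define D1 where "D1 = {invE (y1 \<star> \<iota> r \<star> s p) \<star> (\<iota> r' \<star> s (\<pi> y1 \<otimes> p \<otimes> h)) | r r' p h.
    r \<in> rems \<and> r' \<in> rems \<and> p \<in> carrier G \<and> h \<in> ball R}"
  have D1: "finite D1" unfolding D1_def by (rule section_bounded[OF y(1)])
  have D1E: "D1 \<subseteq> carrier E" unfolding D1_def using y k by (auto simp: ball_def k1_def[symmetric])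
  \<comment> \<open>Once both geodesic parts are over, the paths without their A-parts differ by a
    constant f in D1, and the end points differ by y2. So the total A-parts differ, up to the
    action, by one of the finitely many elements collected here.\<close>
  define S0 where "S0 = (\<lambda>f. - fd f y2) ` D1"
  \<comment> \<open>While one geodesic part is still running, the other path has spent at most M
    steps in A.\<close>
  define T0 where "T0 = {trunc c j | c j. j \<le> M}"
  define T1 where "T1 = {act g a | g a. g \<in> carrier G \<and> a \<in> T0}"
  define T2 where "T2 = {\<eta> (trunc c j) - trunc c' j' | \<eta> c c' j j'. \<eta> \<in> H \<and> chain c \<and> chain c' \<and>
     \<eta> (cmb c) - cmb c' \<in> S0 \<and> j \<le> j' + M \<and> j' \<le> j + M}"
  define T where "T = uminus ` T0 \<union> T1 \<union> T2"
  have finT: "finite T" unfolding T_def T1_def T2_def using D1 trunc_finite finite_act[of T0]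
    by (auto simp: T0_def S0_def intro!: trunc_fellow)
  define D where "D = insert (invE y1) ((\<lambda>(f, x). f \<star> \<iota> (- x)) ` (D1 \<times> T))"
  have finD: "finite D" unfolding D_def using D1 finT by simp
  have DE: "D \<subseteq> carrier E" unfolding D_def using D1E y by auto
  have main: "invE (y1 \<star> path_pt E W t) \<star> path_pt E W' t \<in> D"
    if W: "W \<in> LE" and W': "W' \<in> LE" and eq: "word_eval E W' = y1 \<star> word_eval E W \<star> y2" for W W' t
  proof (cases t)
    case 0
    then show ?thesis using y by (simp add: path_pt_def D_def)
  next
    case (Suc i)
    obtain r u c n where 1: "r \<in> rems" "u \<in> geodesics G X" "chain c" "\<And>f. c f \<le> n" "W = \<iota> r # lt \<one> u @ aw c n"
      using W unfolding LE_iff by blast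
    obtain r' u' c' n' where 2: "r' \<in> rems" "u' \<in> geodesics G X" "chain c'" "\<And>f. c' f \<le> n'" "W' = \<iota> r' # lt \<one> u' @ aw c' n'"
      using W' unfolding LE_iff by blast
    have l: "u \<in> lists X" "u' \<in> lists X" using geod_lists 1 2 by auto
    have eq': "\<iota> r' \<star> s (ev u') \<star> \<iota> (cmb c') = y1 \<star> (\<iota> r \<star> s (ev u) \<star> \<iota> (cmb c)) \<star> y2"
      using eq unfolding 1(5) 2(5) LE_eval[OF 1(2,4)] LE_eval[OF 2(2,4)] .
    have g': "ev u' = k1 \<otimes> ev u \<otimes> k2"
      using arg_cong[OF eq', of \<pi>] y l k by (simp add: k1_def k2_def)
    define p where "p = path_pt G u i"
    define h where "h = inv (k1 \<otimes> p) \<otimes> path_pt G u' i"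
    have pc: "p \<in> carrier G" "path_pt G u' i \<in> carrier G" using l by (auto simp: p_def)
    have hc: "h \<in> carrier G" "k1 \<otimes> p \<otimes> h = path_pt G u' i" using pc k by (auto simp: h_def inv_solve)
    have "dd (k1 \<otimes> path_pt G u i) (path_pt G u' i) \<le> R"
      unfolding R_def by (rule geod_fellow[OF 1(2) 2(2) k _ _ g']) (auto simp: M_def)
    then have hb: "h \<in> ball R" using hc(1) by (simp add: ball_def h_def p_def word_dist_def)
    define f where "f = invE (y1 \<star> \<iota> r \<star> s p) \<star> (\<iota> r' \<star> s (path_pt G u' i))"
    have fD: "f \<in> D1" unfolding D1_def f_def hc(2)[symmetric] k1_def[symmetric] using 1(1) 2(1) pc hb by blast
    have fE: "f \<in> carrier E" using fD D1E by blast
    have pf: "\<pi> f = h" unfolding f_def h_def using y pc k by (simp add: k1_def)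
    define \<alpha> where "\<alpha> = trunc c (i - length u)"
    define \<alpha>' where "\<alpha>' = trunc c' (i - length u')"
    have conj: "invE (e \<star> \<iota> a) \<star> (e' \<star> \<iota> a') = invE e \<star> e' \<star> \<iota> (- (act (\<pi> (invE e \<star> e')) a - a'))"
      if e: "e \<in> carrier E" "e' \<in> carrier E" for e e' a a'
    proof -
      have "invE (e \<star> \<iota> a) \<star> (e' \<star> \<iota> a') = \<iota> (- a) \<star> (invE e \<star> e') \<star> \<iota> a'"
        using e by (simp add: E.inv_mult_group E.m_assoc iota_minus)
      also have "\<iota> (- a) \<star> (invE e \<star> e') = (invE e \<star> e') \<star> \<iota> (act (\<pi> (invE e \<star> e')) (- a))"
        by (rule iota_move) (use e in simp)
      also have "act (\<pi> (invE e \<star> e')) (- a) = - act (\<pi> (invE e \<star> e')) a"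
        by (rule add_hom_minus[OF act_hom]) (use e in simp)
      finally show ?thesis using e by (simp add: E.m_assoc flip: iota_add)
    qed
    have "invE (y1 \<star> path_pt E W t) \<star> path_pt E W' t
        = invE (y1 \<star> \<iota> r \<star> s p \<star> \<iota> \<alpha>) \<star> (\<iota> r' \<star> s (path_pt G u' i) \<star> \<iota> \<alpha>')"
      unfolding Suc 1(5) 2(5) LE_path[OF 1(2,4)] LE_path[OF 2(2,4)] \<alpha>_def \<alpha>'_def p_def
      using y l by (simp add: E.m_assoc)
    also have "\<dots> = f \<star> \<iota> (- (act h \<alpha> - \<alpha>'))"
      using conj[of "y1 \<star> \<iota> r \<star> s p" "\<iota> r' \<star> s (path_pt G u' i)" \<alpha> \<alpha>'] y pc
      unfolding f_def[symmetric] pf by simp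
    finally have val: "invE (y1 \<star> path_pt E W t) \<star> path_pt E W' t = f \<star> \<iota> (- (act h \<alpha> - \<alpha>'))" .
    have len: "length u \<le> length u' + M" "length u' \<le> length u + M"
    proof -
      have "ln (ev u') \<le> ln k1 + ln (ev u) + ln k2"
        unfolding g' using ln_mult[of "k1 \<otimes> ev u" k2] ln_mult[of k1 "ev u"] k l by simp
      then show "length u' \<le> length u + M" using geod_len 1 2 by (simp add: M_def)
      have "ev u = inv k1 \<otimes> (ev u' \<otimes> inv k2)" unfolding g' using k l
        by (simp add: m_assoc) (simp flip: m_assoc)
      then have "ln (ev u) \<le> ln (inv k1) + (ln (ev u') + ln (inv k2))"
        using ln_mult[of "inv k1" "ev u' \<otimes> inv k2"] ln_mult[of "ev u'" "inv k2"] k l by simp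
      then show "length u \<le> length u' + M" using geod_len 1 2 ln_inv k by (simp add: M_def)
    qed
    have "act h \<alpha> - \<alpha>' \<in> T"
    proof -
      consider "i \<le> length u" | "i \<le> length u'" | "length u < i" "length u' < i" by linarith
      then show ?thesis
      proof cases
        case 1
        then have "i - length u' \<le> M" using len by linarith
        then have "\<alpha>' \<in> T0" unfolding T0_def \<alpha>'_def by blast
        moreover have "act h \<alpha> = 0" using 1 add_hom_0[OF act_hom[OF hc(1)]] by (simp add: \<alpha>_def)
        ultimately show ?thesis by (simp add: T_def)
      next
        case 2
        then have "i - length u \<le> M" using len by linarith
        then have "\<alpha> \<in> T0" unfolding T0_def \<alpha>_def by blast
        then have "act h \<alpha> \<in> T1" unfolding T1_def using hc(1) by blast
        moreover have "\<alpha>' = 0" using 2 by (simp add: \<alpha>'_def)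
        ultimately show ?thesis by (simp add: T_def)
      next
        case 3
        have pe: "p = ev u" "path_pt G u' i = ev u'" using 3 by (simp_all add: p_def path_end)
        have hk: "h = k2" unfolding h_def pe g' using k l by (metis ev_closed inv_closed l_inv l_one m_assoc m_closed)
        have "y2 = invE (y1 \<star> \<iota> r \<star> s (ev u) \<star> \<iota> (cmb c)) \<star> (\<iota> r' \<star> s (ev u') \<star> \<iota> (cmb c'))"
          unfolding eq' using y l E_cancel(2)[of "y1 \<star> \<iota> r \<star> s (ev u) \<star> \<iota> (cmb c)" y2] by (simp add: E.m_assoc)
        also have "\<dots> = f \<star> \<iota> (- (act h (cmb c) - cmb c'))"
          using conj[of "y1 \<star> \<iota> r \<star> s p" "\<iota> r' \<star> s (path_pt G u' i)" "cmb c" "cmb c'"] y pc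
          unfolding f_def[symmetric] pf by (simp add: pe)
        finally have "fd f y2 = - (act h (cmb c) - cmb c')" using fd_iota[OF fE] by simp
        then have "act h (cmb c) - cmb c' \<in> S0" unfolding S0_def using fD by (intro image_eqI[of _ _ f]) auto
        moreover have "i - length u \<le> i - length u' + M" "i - length u' \<le> i - length u + M" using len by linarith+
        ultimately have "act h \<alpha> - \<alpha>' \<in> T2" unfolding T2_def \<alpha>_def \<alpha>'_def
          using act_H[OF hc(1)] \<open>chain c\<close> \<open>chain c'\<close> by blast
        then show ?thesis by (simp add: T_def)
      qed
    qed
    then show ?thesis unfolding val D_def using fD by (intro insertI2 image_eqI[of _ _ "(f, act h \<alpha> - \<alpha>')"]) auto
  qed
  show ?thesis using finD DE main by blast
qed

text \<open>Only finitely many pairs (y1, y2) of letters or neutral elements occur, so the constants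
  from \<open>LE_fellow\<close> have a maximum.\<close>

lemma biautomatic_ext: "biautomatic E"
proof -
  interpret C: cayley E XE using XE_gen by unfold_locales
  let ?ft = "\<lambda>d y1 y2. \<forall>W\<in>LE. \<forall>W'\<in>LE. word_eval E W' = y1 \<star> word_eval E W \<star> y2 \<longrightarrow> fellow_travel E XE d y1 W W'"
  have ex: "\<exists>d. ?ft d y1 y2" if y: "y1 \<in> carrier E" "y2 \<in> carrier E" for y1 y2
  proof -
    obtain D where D: "finite D" "D \<subseteq> carrier E" "\<And>W W' t. W \<in> LE \<Longrightarrow> W' \<in> LE \<Longrightarrow> word_eval E W' = y1 \<star> word_eval E W \<star> y2
        \<Longrightarrow> invE (y1 \<star> path_pt E W t) \<star> path_pt E W' t \<in> D" using LE_fellow[OF y] by blast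
    have "fellow_travel E XE (Max (C.ln ` D)) y1 W W'"
      if "W \<in> LE" "W' \<in> LE" "word_eval E W' = y1 \<star> word_eval E W \<star> y2" for W W'
      unfolding fellow_travel_def word_dist_def using D(1) D(3)[OF that] by (auto intro!: Max_ge)
    then show ?thesis by blast
  qed
  define dl where "dl y1 y2 = (SOME d. ?ft d y1 y2)" for y1 y2
  have dl: "?ft (dl y1 y2) y1 y2" if "y1 \<in> carrier E" "y2 \<in> carrier E" for y1 y2
    unfolding dl_def by (rule someI_ex[OF ex[OF that]])
  let ?P = "insert oneE XE \<times> insert oneE XE"
  define d where "d = Max ((\<lambda>(y1, y2). dl y1 y2) ` ?P)"
  have le: "dl y1 y2 \<le> d" if "(y1, y2) \<in> ?P" for y1 y2
    unfolding d_def using XE(1) that by (intro Max_ge) auto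
  have ft: "fellow_travel E XE d y1 W W'"
    if "(y1, y2) \<in> ?P" "W \<in> LE" "W' \<in> LE" "word_eval E W' = y1 \<star> word_eval E W \<star> y2" for y1 y2 W W'
  proof -
    have "y1 \<in> carrier E" "y2 \<in> carrier E" using that(1) XE(2) by auto
    then have "fellow_travel E XE (dl y1 y2) y1 W W'" using dl that by blast
    then show ?thesis unfolding fellow_travel_def using le[OF that(1)] by (meson order_trans)
  qed
  have cl: "word_eval E W \<in> carrier E" if "W \<in> LE" for W using LE_surj that by blast
  have "biautomatic_structure E XE LE"
    unfolding biautomatic_structure_def
  proof (intro conjI exI[of _ d] ballI impI)
    fix v w assume v: "v \<in> LE" and w: "w \<in> LE"
    show "fellow_travel E XE d oneE v w" if "word_eval E w = word_eval E v"
      by (rule ft[of oneE oneE, OF _ v w]) (use that cl[OF v] in auto)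
    fix x assume x: "x \<in> XE"
    show "fellow_travel E XE d x v w" if "word_eval E w = x \<star> word_eval E v"
      by (rule ft[of x oneE, OF _ v w]) (use that cl[OF v] x XE(2) in auto)
    show "fellow_travel E XE d oneE v w" if "word_eval E w = word_eval E v \<star> x"
      by (rule ft[of oneE x, OF _ v w]) (use that cl[OF v] x XE(2) in auto)
  qed (use XE_gen LE_lists LE_regular LE_surj in auto)
  then show ?thesis using E.is_group unfolding biautomatic_def by blast
qed

lemma tau_cocycle: "cocycle2 G act tau"
  unfolding cocycle2_def
proof (intro ballI)
  fix g h1 h2 assume c: "g \<in> carrier G" "h1 \<in> carrier G" "h2 \<in> carrier G"
  have m: "s g \<star> s h1 = s (g \<otimes> h1) \<star> \<iota> (tau g h1)" "s h1 \<star> s h2 = s (h1 \<otimes> h2) \<star> \<iota> (tau h1 h2)"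
    "s (g \<otimes> h1) \<star> s h2 = s (g \<otimes> h1 \<otimes> h2) \<star> \<iota> (tau (g \<otimes> h1) h2)"
    "s g \<star> s (h1 \<otimes> h2) = s (g \<otimes> h1 \<otimes> h2) \<star> \<iota> (tau g (h1 \<otimes> h2))"
    using tau[of g h1] tau[of h1 h2] tau[of "g \<otimes> h1" h2] tau[of g "h1 \<otimes> h2"] c by (simp_all add: m_assoc)
  have "s g \<star> s h1 \<star> s h2 = s (g \<otimes> h1) \<star> (\<iota> (tau g h1) \<star> s h2)" unfolding m(1) using c by (simp add: E.m_assoc)
  also have "\<dots> = s (g \<otimes> h1) \<star> s h2 \<star> \<iota> (act h2 (tau g h1))" using iota_move[of "s h2"] c by (simp add: E.m_assoc)
  also have "\<dots> = s (g \<otimes> h1 \<otimes> h2) \<star> \<iota> (tau (g \<otimes> h1) h2 + act h2 (tau g h1))"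
    unfolding m(3) using c by (simp add: E.m_assoc iota_add)
  finally have 1: "s g \<star> s h1 \<star> s h2 = s (g \<otimes> h1 \<otimes> h2) \<star> \<iota> (tau (g \<otimes> h1) h2 + act h2 (tau g h1))" .
  have "s g \<star> s h1 \<star> s h2 = s g \<star> s (h1 \<otimes> h2) \<star> \<iota> (tau h1 h2)" using c m(2) by (simp add: E.m_assoc)
  also have "\<dots> = s (g \<otimes> h1 \<otimes> h2) \<star> \<iota> (tau g (h1 \<otimes> h2) + tau h1 h2)"
    unfolding m(4) using c by (simp add: E.m_assoc iota_add)
  finally have "s (g \<otimes> h1 \<otimes> h2) \<star> \<iota> (tau (g \<otimes> h1) h2 + act h2 (tau g h1)) = s (g \<otimes> h1 \<otimes> h2) \<star> \<iota> (tau g (h1 \<otimes> h2) + tau h1 h2)"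
    using 1 by simp
  then have "tau (g \<otimes> h1) h2 + act h2 (tau g h1) = tau g (h1 \<otimes> h2) + tau h1 h2"
    using c by (intro iota_cancel[of "s (g \<otimes> h1 \<otimes> h2)"]) auto
  then show "tau g (h1 \<otimes> h2) = act h2 (tau g h1) + tau (g \<otimes> h1) h2 - tau h1 h2" by (simp add: algebra_simps)
qed

lemma tau_L_regular: "L_regular_cocycle G X (geodesics G X) tau"
  unfolding L_regular_cocycle_def weakly_bounded_def
  using tau_finite_left tau_finite_right tau_rational by blast

end

text \<open>Cocycles need not be normalised, whence the unit element and the shift in the embedding of A.\<close>

definition ext_group :: "('g, 'm) monoid_scheme \<Rightarrow> ('g \<Rightarrow> 'a::ab_group_add \<Rightarrow> 'a) \<Rightarrow> ('g \<Rightarrow> 'g \<Rightarrow> 'a) \<Rightarrow> ('g \<times> 'a) monoid" where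
  "ext_group G act \<sigma> = \<lparr>carrier = carrier G \<times> UNIV,
     mult = (\<lambda>(g, a) (h, b). (g \<otimes>\<^bsub>G\<^esub> h, act h a + b + \<sigma> g h)), one = (\<one>\<^bsub>G\<^esub>, - \<sigma> \<one>\<^bsub>G\<^esub> \<one>\<^bsub>G\<^esub>)\<rparr>"

lemma ext_group_extension:
  assumes G: "group G" and ra: "right_action G act" and co: "cocycle2 G act \<sigma>"
  shows "extension_inducing (ext_group G act \<sigma>) G act (\<lambda>a. (\<one>\<^bsub>G\<^esub>, a - \<sigma> \<one>\<^bsub>G\<^esub> \<one>\<^bsub>G\<^esub>)) fst"
proof -
  interpret group G by fact
  let ?E = "ext_group G act \<sigma>"
  let ?o = "\<one>\<^bsub>G\<^esub>" and ?z = "\<sigma> \<one>\<^bsub>G\<^esub> \<one>\<^bsub>G\<^esub>"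
  have hom: "add_hom (act g)" if "g \<in> carrier G" for g using ra that by (auto simp: right_action_def add_hom_def)
  have one: "act ?o a = a" for a using ra by (auto simp: right_action_def)
  have mlt: "act (g \<otimes>\<^bsub>G\<^esub> h) a = act h (act g a)" if "g \<in> carrier G" "h \<in> carrier G" for g h a
    using ra that by (auto simp: right_action_def)
  have coc: "\<sigma> g (h1 \<otimes>\<^bsub>G\<^esub> h2) = act h2 (\<sigma> g h1) + \<sigma> (g \<otimes>\<^bsub>G\<^esub> h1) h2 - \<sigma> h1 h2"
    if "g \<in> carrier G" "h1 \<in> carrier G" "h2 \<in> carrier G" for g h1 h2 using co that by (auto simp: cocycle2_def)
  \<comment> \<open>The cocycle identity with middle argument 1; it expresses all values with an
    argument 1 by the single constant at (1, 1).\<close>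
  have l1: "\<sigma> ?o h = act h (\<sigma> g ?o)" if "g \<in> carrier G" "h \<in> carrier G" for g h
    using coc[of g ?o h] that by simp
  have gz: "\<sigma> g ?o = ?z" if "g \<in> carrier G" for g using l1[of g ?o] that one by simp
  have oz: "\<sigma> ?o h = act h ?z" if "h \<in> carrier G" for h using l1[of ?o h] that by simp
  have c: "carrier ?E = carrier G \<times> UNIV" "\<one>\<^bsub>?E\<^esub> = (?o, - ?z)" by (simp_all add: ext_group_def)
  have m: "(g, a) \<otimes>\<^bsub>?E\<^esub> (h, b) = (g \<otimes>\<^bsub>G\<^esub> h, act h a + b + \<sigma> g h)" for g h a b by (simp add: ext_group_def)
  have E: "group ?E"
  proof (rule groupI)
    fix x y assume xy: "x \<in> carrier ?E" "y \<in> carrier ?E"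
    then obtain g a h b where e: "x = (g, a)" "y = (h, b)" "g \<in> carrier G" "h \<in> carrier G" by (auto simp: c)
    show "x \<otimes>\<^bsub>?E\<^esub> y \<in> carrier ?E" using e by (simp add: m c)
    fix w assume "w \<in> carrier ?E"
    then obtain k d where w: "w = (k, d)" "k \<in> carrier G" by (auto simp: c)
    show "x \<otimes>\<^bsub>?E\<^esub> y \<otimes>\<^bsub>?E\<^esub> w = x \<otimes>\<^bsub>?E\<^esub> (y \<otimes>\<^bsub>?E\<^esub> w)"
      using e w by (simp add: m m_assoc mlt coc add_hom_add[OF hom[OF w(2)]] algebra_simps)
  next
    show "\<one>\<^bsub>?E\<^esub> \<in> carrier ?E" by (simp add: c)
  next
    fix x assume "x \<in> carrier ?E"
    then obtain g a where e: "x = (g, a)" "g \<in> carrier G" by (auto simp: c)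
    show "\<one>\<^bsub>?E\<^esub> \<otimes>\<^bsub>?E\<^esub> x = x" using e(2) by (simp add: e(1) m c(2) oz[OF e(2)] add_hom_minus[OF hom[OF e(2)]])
    have "act g (act (inv\<^bsub>G\<^esub> g) b) = b" for b using mlt[of "inv\<^bsub>G\<^esub> g" g b] e one by simp
    then have "(inv\<^bsub>G\<^esub> g, act (inv\<^bsub>G\<^esub> g) (- ?z - a - \<sigma> (inv\<^bsub>G\<^esub> g) g)) \<otimes>\<^bsub>?E\<^esub> x = \<one>\<^bsub>?E\<^esub>"
      using e by (simp add: m c algebra_simps)
    then show "\<exists>y\<in>carrier ?E. y \<otimes>\<^bsub>?E\<^esub> x = \<one>\<^bsub>?E\<^esub>" using e
      by (intro bexI[of _ "(inv\<^bsub>G\<^esub> g, act (inv\<^bsub>G\<^esub> g) (- ?z - a - \<sigma> (inv\<^bsub>G\<^esub> g) g))"]) (auto simp: c)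
  qed
  interpret E: group ?E by (rule E)
  have cj: "inv\<^bsub>?E\<^esub> e \<otimes>\<^bsub>?E\<^esub> (?o, a - ?z) \<otimes>\<^bsub>?E\<^esub> e = (?o, act (fst e) a - ?z)" if e: "e \<in> carrier ?E" for e a
  proof -
    obtain g b where g: "e = (g, b)" "g \<in> carrier G" using e by (auto simp: c)
    have "(?o, a - ?z) \<otimes>\<^bsub>?E\<^esub> e = e \<otimes>\<^bsub>?E\<^esub> (?o, act (fst e) a - ?z)"
      using g(2) by (simp add: g(1) m one gz[OF g(2)] oz[OF g(2)] add_hom_diff[OF hom[OF g(2)]])
    moreover have "(?o, a - ?z) \<in> carrier ?E" "(?o, act (fst e) a - ?z) \<in> carrier ?E" by (simp_all add: c)
    ultimately show ?thesis using e by (simp add: E.m_assoc) (simp flip: E.m_assoc)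
  qed
  show ?thesis unfolding extension_inducing_def
  proof (intro conjI allI ballI)
    show "inj (\<lambda>a. (?o, a - ?z))" by (auto simp: inj_def)
    show "fst \<in> hom ?E G" by (auto simp: hom_def c m)
    show "fst ` carrier ?E = carrier G" by (auto simp: c image_iff)
    show "range (\<lambda>a. (?o, a - ?z)) = {e \<in> carrier ?E. fst e = ?o}"
    proof
      show "{e \<in> carrier ?E. fst e = ?o} \<subseteq> range (\<lambda>a. (?o, a - ?z))"
      proof
        fix e assume "e \<in> {e \<in> carrier ?E. fst e = ?o}"
        then have "e = (?o, (snd e + ?z) - ?z)" by (cases e) auto
        then show "e \<in> range (\<lambda>a. (?o, a - ?z))" by (rule image_eqI) simp
      qed
    qed (auto simp: c)
  qed (use E cj in \<open>auto simp: c m one\<close>)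
qed

lemma fg_lattice_of_action:
  assumes "group G" "fin_gen_ab TYPE('a::ab_group_add)" "right_action G (act :: 'g \<Rightarrow> 'a \<Rightarrow> 'a)" "finite (act ` carrier G)"
  shows "\<exists>B m lam. fg_lattice (act ` carrier G) B m lam"
proof -
  interpret group G by fact
  have ra: "bij (act g)" "add_hom (act g)" if "g \<in> carrier G" for g
    using assms(3) that by (auto simp: right_action_def add_hom_def)
  have one: "act \<one>\<^bsub>G\<^esub> = id" using assms(3) by (auto simp: right_action_def)
  have mlt: "act h \<circ> act g = act (g \<otimes>\<^bsub>G\<^esub> h)" if "g \<in> carrier G" "h \<in> carrier G" for g h
    using assms(3) that by (auto simp: right_action_def)
  have inv: "hinv (act g) = act (inv\<^bsub>G\<^esub> g)" if "g \<in> carrier G" for g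
    using mlt[of g "inv\<^bsub>G\<^esub> g"] mlt[of "inv\<^bsub>G\<^esub> g" g] that one by (intro inv_unique_comp) auto
  obtain B :: "'a set" and m lam where 1: "finite B" "m > 0" "\<And>b. add_hom (lam b)" "\<And>a. zs m a = (\<Sum>b\<in>B. zs (lam b a) b)"
    "\<And>n. n > 0 \<Longrightarrow> finite {a::'a. zs n a = 0}" using fin_gen_coords[OF assms(2)] by blast
  have "fg_lattice (act ` carrier G) B m lam"
  proof
    show "id \<in> act ` carrier G" using one by (metis imageI one_closed)
    show "\<eta> \<circ> \<theta> \<in> act ` carrier G" if "\<eta> \<in> act ` carrier G" "\<theta> \<in> act ` carrier G" for \<eta> \<theta> using that mlt by auto
    show "hinv \<eta> \<in> act ` carrier G" if "\<eta> \<in> act ` carrier G" for \<eta> using that inv by auto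
    show "\<exists>R::'a set. finite R \<and> (\<forall>a. \<exists>x. a - zs n x \<in> R)" if "n > 0" for n using fin_gen_quot[OF assms(2) that] .
  qed (use assms(4) ra 1 in auto)
  then show ?thesis by blast
qed

theorem theorem1p3:
  fixes G :: "('g, 'm) monoid_scheme"
    and X :: "'g set"
    and act :: "'g \<Rightarrow> 'a::ab_group_add \<Rightarrow> 'a"
  assumes "group G"
    and "word_hyperbolic G"
    and "fin_sym_gen G X"
    and "fin_gen_ab TYPE('a)"
    and "right_action G act"
    and "finite (act ` carrier G)"
  shows "(\<forall>\<sigma>. cocycle2 G act \<sigma> \<longrightarrow>
            (\<exists>\<tau>. cocycle2 G act \<tau> \<and> L_regular_cocycle G X (geodesics G X) \<tau>
                 \<and> cohomologous G act \<sigma> \<tau>))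
       \<and> (\<forall>(E :: ('e, 'n) monoid_scheme) \<iota> \<pi>.
            extension_inducing E G act \<iota> \<pi> \<longrightarrow> biautomatic E)"
proof -
  obtain \<delta> where sl: "geodesic_space.slim (carrier G) (word_dist G X) \<delta>" using hyperbolic_slim assms(2,3) by blast
  obtain B m lam where lat: "fg_lattice (act ` carrier G) B m lam" using fg_lattice_of_action assms(1,4,5,6) by blast
  interpret cayley G X using assms(1,3) by (simp add: cayley_def cayley_axioms_def)
  have hyp: "hyp_cayley G X \<delta>" using sl by unfold_locales
  \<comment> \<open>Stated for arbitrary types of the extension: it serves the given E and also the
    group of pairs built from a cocycle.\<close>
  have extI: "ext G X \<delta> E (act ` carrier G) B m lam act \<iota> \<pi>"
    if "extension_inducing E G act \<iota> \<pi>" for E :: "('f, 'o) monoid_scheme" and \<iota> \<pi>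
    using that hyp lat assms(5) by (simp add: ext_def ext_axioms_def extension_inducing_def)
  show ?thesis
  proof (intro conjI allI impI)
    fix E :: "('e, 'n) monoid_scheme" and \<iota> \<pi> assume "extension_inducing E G act \<iota> \<pi>"
    then interpret ext G X \<delta> E "act ` carrier G" B m lam act \<iota> \<pi>
      by (rule extI)
    show "biautomatic E" by (rule biautomatic_ext)
  next
    fix \<sigma> assume co: "cocycle2 G act \<sigma>"
    define E where "E = ext_group G act \<sigma>"
    define i where "i = (\<lambda>a. (\<one>\<^bsub>G\<^esub>, a - \<sigma> \<one>\<^bsub>G\<^esub> \<one>\<^bsub>G\<^esub>))"
    have ex: "extension_inducing E G act i fst" unfolding E_def i_def by (rule ext_group_extension[OF assms(1,5) co])
    interpret ext G X \<delta> E "act ` carrier G" B m lam act i fst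
      using ex by (rule extI)
    have gz: "\<sigma> g \<one>\<^bsub>G\<^esub> = \<sigma> \<one>\<^bsub>G\<^esub> \<one>\<^bsub>G\<^esub>" if g: "g \<in> carrier G" for g
      using co[unfolded cocycle2_def, rule_format, of g "\<one>\<^bsub>G\<^esub>" "\<one>\<^bsub>G\<^esub>"] g by simp
    have mE: "(g, a) \<otimes>\<^bsub>E\<^esub> (h, b) = (g \<otimes>\<^bsub>G\<^esub> h, act h a + b + \<sigma> g h)" for g h a b by (simp add: E_def ext_group_def)
    \<comment> \<open>The section differs from sending g to (g, 0) by its second component, whose
      negative is the cochain relating the two cocycles.\<close>
    have "\<sigma> g h - tau g h = act h (- snd (s g)) + (- snd (s h)) - (- snd (s (g \<otimes>\<^bsub>G\<^esub> h)))"
      if c: "g \<in> carrier G" "h \<in> carrier G" for g h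
    proof -
      have sp: "s k = (k, snd (s k))" if "k \<in> carrier G" for k using pi_s[OF that] by (metis prod.collapse)
      have gh: "g \<otimes>\<^bsub>G\<^esub> h \<in> carrier G" using c by simp
      have "s (g \<otimes>\<^bsub>G\<^esub> h) \<otimes>\<^bsub>E\<^esub> i (tau g h) = s g \<otimes>\<^bsub>E\<^esub> s h" by (rule tau[OF c])
      then have "(g \<otimes>\<^bsub>G\<^esub> h, snd (s (g \<otimes>\<^bsub>G\<^esub> h))) \<otimes>\<^bsub>E\<^esub> i (tau g h) = (g, snd (s g)) \<otimes>\<^bsub>E\<^esub> (h, snd (s h))"
        using sp[OF gh] sp[OF c(1)] sp[OF c(2)] by metis
      then have "snd (s (g \<otimes>\<^bsub>G\<^esub> h)) + tau g h = act h (snd (s g)) + snd (s h) + \<sigma> g h"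
        unfolding i_def mE using gz[OF gh] by simp
      then show ?thesis using add_hom_minus[OF act_hom[OF c(2)], of "snd (s g)"] by (simp add: algebra_simps)
    qed
    then have "cohomologous G act \<sigma> tau" unfolding cohomologous_def by (intro exI[of _ "\<lambda>g. - snd (s g)"]) blast
    then show "\<exists>\<tau>. cocycle2 G act \<tau> \<and> L_regular_cocycle G X (geodesics G X) \<tau> \<and> cohomologous G act \<sigma> \<tau>"
      using tau_cocycle tau_L_regular by blast
  qed
qed

end
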